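(* For every measurable $A\subset\mathcal{R}$ with $m(A)>0$ and for every $1\leq p\leq\infty$, the space $\mathcal{L}^p(A)$ is not sequentially complete with respect to strong convergence in the $\mathcal{L}^p$ norm; that is, there is a sequence $\{f_n\}_{n\in\mathbb{N}}$ in $\mathcal{L}^p(A)$ that is strongly Cauchy in $\mathcal{L}^p(A)$ but for which there is no $f\in\mathcal{L}^p(A)$ such that $\|f_n-f\|_p$ strongly converges to $0$.
   Context: A set $F\subset\mathbb{Q}$ is left-finite if $\{x\in F: x\le q\}$ is finite for every $q\in\mathbb{Q}$. The Levi-Civita field $\mathcal{R}$ is the set of functions $x:\mathbb{Q}\to\mathbb{R}$ (values written $x[q]$) whose support $\{q: x[q]\neq 0\}$ is left-finite, with pointwise sum and product $(x\cdot y)[q]=\sum_{q_1+q_2=q}x[q_1]y[q_2]$. For $x\ne 0$, $\lambda(x)=\min\operatorname{supp}(x)$, and $\lambda(0)=\infty$. For $x\neq y$, $x<y$ iff $(x-y)[\lambda(x-y)]<0$. This makes $\mathcal{R}$ an ordered (real closed) field containing $\mathbb{R}$. A sequence strongly converges to $l$ if for every $\varepsilon\in\mathcal{R}$, $\varepsilon>0$, eventually $|a_n-l|<\varepsilon$. It weakly converges to $l\in\mathcal{R}$ if for every real $\varepsilon>0$, eventually $\max_{q\in\mathbb{Q},q\le\varepsilon^{-1}}|(a_n-l)[q]|<\varepsilon$. It diverges to $+\infty$ if for every $M\in\mathcal{R}$ eventually $a_n>M$. For $a\le b$ in $\mathcal{R}$, $I(a,b)$ denotes any of the four intervals of $\mathcal{R}$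 with endpoints $a,b$ (degenerate intervals allowed), with length $l(I(a,b))=b-a$. A set $A\subseteq\mathcal{R}$ is measurable iff for every $\varepsilon\in\mathcal{R}$, $\varepsilon>0$, there are two sequences of mutually disjoint intervals $\{I_n\}$, $\{J_n\}$ such that $\bigcup_n I_n\subseteq A\subseteq\bigcup_n J_n$, $\sum_n l(I_n)$ and $\sum_n l(J_n)$ strongly converge, and $\sum_n l(J_n)-\sum_n l(I_n)\le\varepsilon$. The measure $m(A)\in\mathcal{R}$ is the (existing) supremum of such inner sums, equal to the infimum of such outer sums. A property holds almost everywhere (a.e.) on $A$ iff the set of points of $A$ where it holds is measurable with measure $m(A)$. A function $f$ is simple on an interval $I$ if there are $x_0,a_k\in\mathcal{R}$ such that for every $x\in I$ the partial sums $\sum_{k\le K}a_k(x-x_0)^k$ weakly converge to $f(x)$. For $A$ measurable, $f:A\to\mathcal{R}$ is measurable ($f\in\mathcal{M}(A)$) iff for every $\varepsilon\in\mathcal{R}$, $\varepsilon>0$, there is a sequence of mutually disjoint intervals $\{I_n\}$ with $\bigcup_n I_n\subseteq A$, $\sum_n l(I_n)$ strongly convergent, $m(A)-\sum_n l(I_n)<\varepsilon$, and $f$ simple on each $I_n$. If $f$ is simple on $I(a,b)$ with (termwise) antiderivative $F$, $\int_{I(a,b)}f=\lim_{x\to b}F(x)-\lim_{x\to a}F(x)$. For $f\in\mathcal{M}(A)$, $\int_A f$ is the limit of $\sum_n\int_{I_n}f$ (strong sum) over sequences of mutually disjoint intervals $\{I_n\}$ with $\bigcup_n I_n\subseteq A$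 and $f$ simple on each $I_n$, as $\sum_n l(I_n)\to m(A)$; it is $\pm\infty$ if the partial sums diverge, and undefined if the limit does not exist. Functions equal a.e. are identified. For $1\le p<\infty$, $\mathcal{L}^p(A)$ is the set of (classes of) $f\in\mathcal{M}(A)$ with $f^p\in\mathcal{M}(A)$ such that $\int_A|f|^p$ is defined and $<+\infty$; $\|f\|_p=(\int_A|f|^p)^{1/p}$. For $p=\infty$, $\|f\|_\infty=\inf\{c\in\mathcal{R}:|f(x)|\le c\text{ for a.e. }x\in A\}$ (undefined if this infimum does not exist in $\mathcal{R}$), and $\mathcal{L}^\infty(A)$ is the set of (classes of) $f\in\mathcal{M}(A)$ for which $\|f\|_\infty$ is defined. A sequence $\{f_n\}$ in $\mathcal{L}^p(A)$ is strongly Cauchy in $\mathcal{L}^p(A)$ iff for every $\varepsilon\in\mathcal{R}$, $\varepsilon>0$, there is $n_\varepsilon$ with $\|f_n-f_m\|_p<\varepsilon$ for all $m,n>n_\varepsilon$.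
   Formalization: Finite exponents p are taken rational: for irrational p the power x^p is not defined in the Levi-Civita field (its valuation pλ(x) would be irrational). For negative x and p with even denominator, x^p is read as |x|^p. *)

theory Defs
  imports Complex_Main "HOL-Library.Extended" "HOL-Library.Disjoint_Sets" "HOL-Library.Lub_Glb"
begin

section \<open>The Levi-Civita field\<close>

definition left_finite :: "rat set \<Rightarrow> bool" where
  "left_finite F \<longleftrightarrow> (\<forall>q. finite {x \<in> F. x \<le> q})"

typedef levi_civita = "{x :: rat \<Rightarrow> real. left_finite {q. x q \<noteq> 0}}"
  morphisms lc_coeff Abs_levi_civita
  by (rule exI[of _ "\<lambda>_. 0"]) (simp add: left_finite_def)

lemma lfI: "(\<And>Q. finite {q. q \<le> Q \<and> f q \<noteq> (0::real)}) \<Longrightarrow> left_finite {q. f q \<noteq> 0}"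
  by (simp add: left_finite_def conj_commute)

lemma lf_coeff: "finite {q. q \<le> Q \<and> lc_coeff x q \<noteq> 0}"
  using lc_coeff[of x] by (simp add: left_finite_def conj_commute)

lemma lc_coeff_Abs: "(\<And>Q. finite {q. q \<le> Q \<and> f q \<noteq> (0::real)}) \<Longrightarrow> lc_coeff (Abs_levi_civita f) = f"
  by (rule Abs_levi_civita_inverse) (simp add: lfI)

lemma lc_eqI: "(\<And>q. lc_coeff x q = lc_coeff y q) \<Longrightarrow> x = y"
  by (metis lc_coeff_inject ext)

lemma lc_coeff_min:
  assumes "lc_coeff x p \<noteq> 0"
  obtains q where "lc_coeff x q \<noteq> 0" "\<And>r. r < q \<Longrightarrow> lc_coeff x r = 0"
proof -
  let ?S = "{q. q \<le> p \<and> lc_coeff x q \<noteq> 0}"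
  have fin: "finite ?S" by (rule lf_coeff)
  have ne: "?S \<noteq> {}" using assms by auto
  have "Min ?S \<in> ?S" using fin ne by (rule Min_in)
  moreover have "lc_coeff x r = 0" if "r < Min ?S" for r
  proof (rule ccontr)
    assume "lc_coeff x r \<noteq> 0"
    moreover have "r \<le> p" using that \<open>Min ?S \<in> ?S\<close> by simp
    ultimately have "r \<in> ?S" by simp
    then show False using Min_le[OF fin] that by fastforce
  qed
  ultimately show ?thesis using that by blast
qed

lemma lc_coeff_bound: obtains L where "\<And>r. r < L \<Longrightarrow> lc_coeff x r = 0"
  by (metis lc_coeff_min)

instantiation levi_civita :: comm_ring_1
begin

definition zero_levi_civita where "0 = Abs_levi_civita (\<lambda>_. 0)"
definition one_levi_civita where "1 = Abs_levi_civita (\<lambda>q. if q = 0 then 1 else 0)"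
definition plus_levi_civita where "x + y = Abs_levi_civita (\<lambda>q. lc_coeff x q + lc_coeff y q)"
definition uminus_levi_civita where "- x = Abs_levi_civita (\<lambda>q. - lc_coeff x q)"
definition minus_levi_civita where "x - y = Abs_levi_civita (\<lambda>q. lc_coeff x q - lc_coeff y q)"
text \<open>For each \<open>q\<close> only finitely many pairs \<open>(q\<^sub>1, q - q\<^sub>1)\<close> contribute to the convolution.\<close>
definition times_levi_civita where
  "x * y = Abs_levi_civita (\<lambda>q. \<Sum>q\<^sub>1 | lc_coeff x q\<^sub>1 \<noteq> 0 \<and> lc_coeff y (q - q\<^sub>1) \<noteq> 0. lc_coeff x q\<^sub>1 * lc_coeff y (q - q\<^sub>1))"

lemma lc_coeff_zero [simp]: "lc_coeff 0 q = 0"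
  by (simp add: zero_levi_civita_def lc_coeff_Abs)

lemma lc_coeff_one: "lc_coeff 1 q = (if q = 0 then 1 else 0)"
  unfolding one_levi_civita_def by (subst lc_coeff_Abs) auto

lemma lc_coeff_plus [simp]: "lc_coeff (x + y) q = lc_coeff x q + lc_coeff y q"
proof -
  have "finite {q. q \<le> Q \<and> lc_coeff x q + lc_coeff y q \<noteq> 0}" for Q
    by (rule finite_subset[OF _ finite_UnI[OF lf_coeff[of Q x] lf_coeff[of Q y]]]) auto
  then show ?thesis by (simp add: plus_levi_civita_def lc_coeff_Abs)
qed

lemma lc_coeff_minus [simp]: "lc_coeff (x - y) q = lc_coeff x q - lc_coeff y q"
proof -
  have "finite {q. q \<le> Q \<and> lc_coeff x q - lc_coeff y q \<noteq> 0}" for Q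
    by (rule finite_subset[OF _ finite_UnI[OF lf_coeff[of Q x] lf_coeff[of Q y]]]) auto
  then show ?thesis by (simp add: minus_levi_civita_def lc_coeff_Abs)
qed

lemma lc_coeff_uminus [simp]: "lc_coeff (- x) q = - lc_coeff x q"
  using lf_coeff by (simp add: uminus_levi_civita_def lc_coeff_Abs)

lemma fin_conv: "finite {a. lc_coeff x a \<noteq> 0 \<and> lc_coeff y (q - a) \<noteq> 0}"
proof -
  obtain L where "\<And>r. r < L \<Longrightarrow> lc_coeff y r = 0" using lc_coeff_bound by blast
  then have "{a. lc_coeff x a \<noteq> 0 \<and> lc_coeff y (q - a) \<noteq> 0} \<subseteq> {a. a \<le> q - L \<and> lc_coeff x a \<noteq> 0}"
    by (smt (verit) Collect_mono_iff diff_less_eq linorder_not_le add.commute le_diff_eq)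
  then show ?thesis using lf_coeff finite_subset by blast
qed

lemma lc_coeff_times: "lc_coeff (x * y) q =
  (\<Sum>a | lc_coeff x a \<noteq> 0 \<and> lc_coeff y (q - a) \<noteq> 0. lc_coeff x a * lc_coeff y (q - a))"
proof -
  let ?f = "\<lambda>q. (\<Sum>a | lc_coeff x a \<noteq> 0 \<and> lc_coeff y (q - a) \<noteq> 0. lc_coeff x a * lc_coeff y (q - a))"
  obtain L where L: "\<And>r. r < L \<Longrightarrow> lc_coeff x r = 0" using lc_coeff_bound by blast
  obtain M where M: "\<And>r. r < M \<Longrightarrow> lc_coeff y r = 0" using lc_coeff_bound by blast
  have "finite {q. q \<le> Q \<and> ?f q \<noteq> 0}" for Q
  proof (rule finite_subset)
    let ?A = "{a. a \<le> Q - M \<and> lc_coeff x a \<noteq> 0}" and ?B = "{a. a \<le> Q - L \<and> lc_coeff y a \<noteq> 0}"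
    show "finite ((\<lambda>(a,b). a + b) ` (?A \<times> ?B))"
      using lf_coeff by (intro finite_imageI finite_cartesian_product)
    show "{q. q \<le> Q \<and> ?f q \<noteq> 0} \<subseteq> (\<lambda>(a,b). a + b) ` (?A \<times> ?B)"
    proof
      fix q assume "q \<in> {q. q \<le> Q \<and> ?f q \<noteq> 0}"
      then have q: "q \<le> Q" "?f q \<noteq> 0" by auto
      then obtain a where a: "lc_coeff x a \<noteq> 0" "lc_coeff y (q - a) \<noteq> 0"
        by (auto elim: sum.not_neutral_contains_not_neutral)
      have "\<not> a < L" "\<not> q - a < M" using a L M by auto
      then have "(a, q - a) \<in> ?A \<times> ?B" using a q by auto
      then show "q \<in> (\<lambda>(a,b). a + b) ` (?A \<times> ?B)" by force
    qed
  qed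
  then show ?thesis by (simp add: times_levi_civita_def lc_coeff_Abs)
qed

lemma lc_coeff_times_superset:
  assumes "finite S" "\<And>a. lc_coeff x a \<noteq> 0 \<Longrightarrow> lc_coeff y (q - a) \<noteq> 0 \<Longrightarrow> a \<in> S"
  shows "lc_coeff (x * y) q = (\<Sum>a\<in>S. lc_coeff x a * lc_coeff y (q - a))"
  unfolding lc_coeff_times using assms by (intro sum.mono_neutral_left) auto

lemma lc_coeff_times_double:
  assumes "finite S" "finite T"
    and "\<And>a. lc_coeff x a \<noteq> 0 \<Longrightarrow> lc_coeff y (q - a) \<noteq> 0 \<Longrightarrow> a \<in> S \<and> q - a \<in> T"
  shows "lc_coeff (x * y) q = (\<Sum>a\<in>S. \<Sum>b\<in>T. if a + b = q then lc_coeff x a * lc_coeff y b else 0)"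
proof -
  have "(\<Sum>b\<in>T. if a + b = q then lc_coeff x a * lc_coeff y b else 0) = lc_coeff x a * lc_coeff y (q - a)" for a
  proof -
    have "(\<Sum>b\<in>T. if a + b = q then lc_coeff x a * lc_coeff y b else 0)
        = (\<Sum>b\<in>T. if b = q - a then lc_coeff x a * lc_coeff y b else 0)"
      by (intro sum.cong) (auto simp: algebra_simps)
    also have "\<dots> = (if q - a \<in> T then lc_coeff x a * lc_coeff y (q - a) else 0)"
      using assms(2) by (subst sum.delta) auto
    also have "\<dots> = lc_coeff x a * lc_coeff y (q - a)" using assms(3)[of a] by auto
    finally show ?thesis .
  qed
  then show ?thesis using lc_coeff_times_superset[OF assms(1), of x y q] assms(3) by simp
qed

lemma times_comm: "x * y = y * (x::levi_civita)"
proof (rule lc_eqI)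
  fix q
  let ?S = "{a. lc_coeff x a \<noteq> 0 \<and> lc_coeff y (q - a) \<noteq> 0}"
  let ?T = "(\<lambda>a. q - a) ` ?S"
  have fin: "finite ?S" "finite ?T" using fin_conv by auto
  have "lc_coeff (x * y) q = (\<Sum>a\<in>?S. \<Sum>b\<in>?T. if a + b = q then lc_coeff x a * lc_coeff y b else 0)"
    by (rule lc_coeff_times_double) (use fin in auto)
  also have "\<dots> = (\<Sum>b\<in>?T. \<Sum>a\<in>?S. if a + b = q then lc_coeff x a * lc_coeff y b else 0)"
    by (rule sum.swap)
  also have "\<dots> = (\<Sum>b\<in>?T. \<Sum>a\<in>?S. if b + a = q then lc_coeff y b * lc_coeff x a else 0)"
    by (intro sum.cong refl) (auto simp: add.commute mult.commute)
  also have "\<dots> = lc_coeff (y * x) q"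
    by (rule lc_coeff_times_double[symmetric]) (use fin in \<open>auto intro!: image_eqI[of _ _ "q - _"]\<close>)
  finally show "lc_coeff (x * y) q = lc_coeff (y * x) q" .
qed

lemma lc_coeff_times_below:
  assumes "\<And>r. r < L \<Longrightarrow> lc_coeff x r = 0" "\<And>r. r < M \<Longrightarrow> lc_coeff y r = 0" "q < L + M"
  shows "lc_coeff (x * y) q = 0"
proof -
  have "{a. lc_coeff x a \<noteq> 0 \<and> lc_coeff y (q - a) \<noteq> 0} = {}"
  proof (safe, goal_cases)
    case (1 a)
    then have "\<not> a < L" "\<not> q - a < M" using assms by auto
    then show ?case using assms(3) by simp
  qed
  then show ?thesis unfolding lc_coeff_times by (metis sum.empty)
qed

lemma times_assoc: "(x * y) * z = x * (y * (z::levi_civita))"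
proof (rule lc_eqI)
  fix q
  obtain L where L: "\<And>r. r < L \<Longrightarrow> lc_coeff x r = 0" using lc_coeff_bound by blast
  obtain M where M: "\<And>r. r < M \<Longrightarrow> lc_coeff y r = 0" using lc_coeff_bound by blast
  obtain N where N: "\<And>r. r < N \<Longrightarrow> lc_coeff z r = 0" using lc_coeff_bound by blast
  let ?A = "{a. a \<le> q - M - N \<and> lc_coeff x a \<noteq> 0}"
  let ?B = "{a. a \<le> q - L - N \<and> lc_coeff y a \<noteq> 0}"
  let ?C = "{a. a \<le> q - L - M \<and> lc_coeff z a \<noteq> 0}"
  let ?AB = "(\<lambda>(a,b). a + b) ` (?A \<times> ?B)" and ?BC = "(\<lambda>(a,b). a + b) ` (?B \<times> ?C)"
  have fin: "finite ?A" "finite ?B" "finite ?C" using lf_coeff by auto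
  have finAB: "finite ?AB" and finBC: "finite ?BC" using fin by auto
  have xy: "lc_coeff (x * y) r = (\<Sum>a\<in>?A. \<Sum>b\<in>?B. if a + b = r then lc_coeff x a * lc_coeff y b else 0)"
    if "r \<le> q - N" for r
  proof (rule lc_coeff_times_double)
    fix a assume a: "lc_coeff x a \<noteq> 0" "lc_coeff y (r - a) \<noteq> 0"
    then have "\<not> a < L" "\<not> r - a < M" using L M by auto
    then show "a \<in> ?A \<and> r - a \<in> ?B" using a that by auto
  qed (use fin in auto)
  have yz: "lc_coeff (y * z) r = (\<Sum>a\<in>?B. \<Sum>b\<in>?C. if a + b = r then lc_coeff y a * lc_coeff z b else 0)"
    if "r \<le> q - L" for r
  proof (rule lc_coeff_times_double)
    fix a assume a: "lc_coeff y a \<noteq> 0" "lc_coeff z (r - a) \<noteq> 0"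
    then have "\<not> a < M" "\<not> r - a < N" using M N by auto
    then show "a \<in> ?B \<and> r - a \<in> ?C" using a that by auto
  qed (use fin in auto)
  have xyAB: "r \<in> ?AB" if "lc_coeff (x * y) r \<noteq> 0" "r \<le> q - N" for r
  proof -
    have "{a. lc_coeff x a \<noteq> 0 \<and> lc_coeff y (r - a) \<noteq> 0} \<noteq> {}"
      using that(1) unfolding lc_coeff_times by (metis sum.empty)
    then obtain a where a: "lc_coeff x a \<noteq> 0" "lc_coeff y (r - a) \<noteq> 0" by auto
    then have "\<not> a < L" "\<not> r - a < M" using L M by auto
    then have "(a, r - a) \<in> ?A \<times> ?B" using a that(2) by auto
    then show ?thesis by force
  qed
  have yzBC: "r \<in> ?BC" if "lc_coeff (y * z) r \<noteq> 0" "r \<le> q - L" for r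
  proof -
    have "{a. lc_coeff y a \<noteq> 0 \<and> lc_coeff z (r - a) \<noteq> 0} \<noteq> {}"
      using that(1) unfolding lc_coeff_times by (metis sum.empty)
    then obtain a where a: "lc_coeff y a \<noteq> 0" "lc_coeff z (r - a) \<noteq> 0" by auto
    then have "\<not> a < M" "\<not> r - a < N" using M N by auto
    then have "(a, r - a) \<in> ?B \<times> ?C" using a that(2) by auto
    then show ?thesis by force
  qed
  have "lc_coeff ((x * y) * z) q = (\<Sum>c\<in>?C. lc_coeff z c * lc_coeff (x * y) (q - c))"
  proof -
    have "lc_coeff (z * (x * y)) q = (\<Sum>c\<in>?C. lc_coeff z c * lc_coeff (x * y) (q - c))"
    proof (rule lc_coeff_times_superset)
      fix c assume c: "lc_coeff z c \<noteq> 0" "lc_coeff (x * y) (q - c) \<noteq> 0"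
      then have "\<not> q - c < L + M" using lc_coeff_times_below[OF L M] by blast
      then show "c \<in> ?C" using c by auto
    qed (use fin in auto)
    then show ?thesis by (simp only: times_comm[of z])
  qed
  also have "\<dots> = (\<Sum>c\<in>?C. \<Sum>a\<in>?A. \<Sum>b\<in>?B. if a + b + c = q then lc_coeff x a * lc_coeff y b * lc_coeff z c else 0)"
  proof (rule sum.cong[OF refl])
    fix c assume c: "c \<in> ?C"
    then have "\<not> c < N" using N by auto
    then have "q - c \<le> q - N" by simp
    from xy[OF this] show "lc_coeff z c * lc_coeff (x * y) (q - c) =
      (\<Sum>a\<in>?A. \<Sum>b\<in>?B. if a + b + c = q then lc_coeff x a * lc_coeff y b * lc_coeff z c else 0)"
      by (auto simp: sum_distrib_left intro!: sum.cong)
  qed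
  also have "\<dots> = (\<Sum>a\<in>?A. \<Sum>c\<in>?C. \<Sum>b\<in>?B. if a + b + c = q then lc_coeff x a * lc_coeff y b * lc_coeff z c else 0)"
    by (rule sum.swap)
  also have "\<dots> = (\<Sum>a\<in>?A. \<Sum>b\<in>?B. \<Sum>c\<in>?C. if a + b + c = q then lc_coeff x a * lc_coeff y b * lc_coeff z c else 0)"
    by (rule sum.cong[OF refl], rule sum.swap)
  also have "\<dots> = (\<Sum>a\<in>?A. lc_coeff x a * lc_coeff (y * z) (q - a))"
  proof (rule sum.cong[OF refl])
    fix a assume a: "a \<in> ?A"
    then have "\<not> a < L" using L by auto
    then have "q - a \<le> q - L" by simp
    from yz[OF this] show "(\<Sum>b\<in>?B. \<Sum>c\<in>?C. if a + b + c = q then lc_coeff x a * lc_coeff y b * lc_coeff z c else 0)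
       = lc_coeff x a * lc_coeff (y * z) (q - a)"
      by (auto simp: sum_distrib_left intro!: sum.cong)
  qed
  also have "\<dots> = lc_coeff (x * (y * z)) q"
  proof (rule lc_coeff_times_superset[symmetric])
    fix c assume c: "lc_coeff x c \<noteq> 0" "lc_coeff (y * z) (q - c) \<noteq> 0"
    then have "\<not> q - c < M + N" using lc_coeff_times_below[OF M N] by blast
    then show "c \<in> ?A" using c by auto
  qed (use fin in auto)
  finally show "lc_coeff ((x * y) * z) q = lc_coeff (x * (y * z)) q" .
qed

instance
proof
  fix x y z :: levi_civita
  show "x + y + z = x + (y + z)" "x + y = y + x" "0 + x = x" "- x + x = 0" "x - y = x + - y"
    by (rule lc_eqI; simp)+
  show "x * y * z = x * (y * z)" by (rule times_assoc)
  show "x * y = y * x" by (rule times_comm)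
  show "1 * x = x"
  proof (rule lc_eqI)
    fix q
    have "lc_coeff (1 * x) q = (\<Sum>a\<in>{0}. lc_coeff 1 a * lc_coeff x (q - a))"
      by (rule lc_coeff_times_superset) (auto simp: lc_coeff_one split: if_splits)
    then show "lc_coeff (1 * x) q = lc_coeff x q" by (simp add: lc_coeff_one)
  qed
  show "(x + y) * z = x * z + y * z"
  proof (rule lc_eqI)
    fix q
    let ?S = "{a. lc_coeff x a \<noteq> 0 \<and> lc_coeff z (q - a) \<noteq> 0} \<union> {a. lc_coeff y a \<noteq> 0 \<and> lc_coeff z (q - a) \<noteq> 0}"
    have fin: "finite ?S" using fin_conv by blast
    have "lc_coeff ((x + y) * z) q = (\<Sum>a\<in>?S. lc_coeff (x + y) a * lc_coeff z (q - a))"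
      by (rule lc_coeff_times_superset[OF fin]) auto
    moreover have "lc_coeff (x * z) q = (\<Sum>a\<in>?S. lc_coeff x a * lc_coeff z (q - a))"
      by (rule lc_coeff_times_superset[OF fin]) auto
    moreover have "lc_coeff (y * z) q = (\<Sum>a\<in>?S. lc_coeff y a * lc_coeff z (q - a))"
      by (rule lc_coeff_times_superset[OF fin]) auto
    ultimately show "lc_coeff ((x + y) * z) q = lc_coeff (x * z + y * z) q"
      by (simp add: sum.distrib distrib_right)
  qed
  show "(0::levi_civita) \<noteq> 1"
    by (metis lc_coeff_one lc_coeff_zero zero_neq_one)
qed

end

definition lc_val :: "levi_civita \<Rightarrow> rat" where
  \<comment> \<open>\<open>\<lambda>(x)\<close>; meaningful for \<open>x \<noteq> 0\<close> only\<close>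
  "lc_val x = (LEAST q. lc_coeff x q \<noteq> 0)"

lemma lc_coeff_val:
  assumes "x \<noteq> 0"
  shows "lc_coeff x (lc_val x) \<noteq> 0" and "r < lc_val x \<Longrightarrow> lc_coeff x r = 0"
proof -
  obtain p where "lc_coeff x p \<noteq> 0" using assms by (metis lc_coeff_zero lc_eqI)
  then obtain q where q: "lc_coeff x q \<noteq> 0" "\<And>r. r < q \<Longrightarrow> lc_coeff x r = 0" by (metis lc_coeff_min)
  then have "lc_val x = q" unfolding lc_val_def
    by (intro Least_equality) (auto simp: not_less[symmetric])
  then show "lc_coeff x (lc_val x) \<noteq> 0" "r < lc_val x \<Longrightarrow> lc_coeff x r = 0" using q by auto
qed

lemma lc_val_eq: "lc_coeff x q \<noteq> 0 \<Longrightarrow> (\<And>r. r < q \<Longrightarrow> lc_coeff x r = 0) \<Longrightarrow> lc_val x = q"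
  unfolding lc_val_def by (intro Least_equality) (auto simp: not_less[symmetric])

lemma lc_coeff_times_lead:
  assumes "\<And>r. r < L \<Longrightarrow> lc_coeff x r = 0" "\<And>r. r < M \<Longrightarrow> lc_coeff y r = 0"
  shows "lc_coeff (x * y) (L + M) = lc_coeff x L * lc_coeff y M"
proof -
  have "lc_coeff (x * y) (L + M) = (\<Sum>a\<in>{L}. lc_coeff x a * lc_coeff y (L + M - a))"
  proof (rule lc_coeff_times_superset)
    fix a assume "lc_coeff x a \<noteq> 0" "lc_coeff y (L + M - a) \<noteq> 0"
    then have "\<not> a < L" "\<not> L + M - a < M" using assms by auto
    then show "a \<in> {L}" by auto
  qed auto
  then show ?thesis by simp
qed

instantiation levi_civita :: linordered_idom
begin

definition less_levi_civita where
  "x < y \<longleftrightarrow> x \<noteq> y \<and> lc_coeff (x - y) (lc_val (x - y)) < 0"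
definition less_eq_levi_civita where "x \<le> (y::levi_civita) \<longleftrightarrow> x < y \<or> x = y"
definition abs_levi_civita where "\<bar>x\<bar> = (if x < 0 then - x else (x::levi_civita))"
definition sgn_levi_civita where "sgn x = (if x = 0 then 0 else if 0 < x then 1 else - 1 :: levi_civita)"

lemma less_iff_coeff:
  "x < y \<longleftrightarrow> (\<exists>q. lc_coeff x q < lc_coeff y q \<and> (\<forall>r<q. lc_coeff x r = lc_coeff y r))"
proof
  assume a: "x < y"
  then have "x - y \<noteq> 0" by (simp add: less_levi_civita_def)
  from lc_coeff_val[OF this] a show "\<exists>q. lc_coeff x q < lc_coeff y q \<and> (\<forall>r<q. lc_coeff x r = lc_coeff y r)"
    by (intro exI[of _ "lc_val (x - y)"]) (auto simp: less_levi_civita_def)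
next
  assume "\<exists>q. lc_coeff x q < lc_coeff y q \<and> (\<forall>r<q. lc_coeff x r = lc_coeff y r)"
  then obtain q where q: "lc_coeff x q < lc_coeff y q" "\<And>r. r < q \<Longrightarrow> lc_coeff x r = lc_coeff y r" by blast
  then have "lc_val (x - y) = q" by (intro lc_val_eq) auto
  then show "x < y" using q by (auto simp: less_levi_civita_def)
qed

lemma less_trans_lc: "x < y \<Longrightarrow> y < z \<Longrightarrow> x < (z::levi_civita)"
proof -
  assume "x < y" "y < z"
  then obtain p q where p: "lc_coeff x p < lc_coeff y p" "\<And>r. r < p \<Longrightarrow> lc_coeff x r = lc_coeff y r"
    and q: "lc_coeff y q < lc_coeff z q" "\<And>r. r < q \<Longrightarrow> lc_coeff y r = lc_coeff z r"
    unfolding less_iff_coeff by blast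
  show ?thesis unfolding less_iff_coeff
    by (rule exI[of _ "min p q"], cases p q rule: linorder_cases) (use p q in auto)
qed

lemma less_irrefl_lc: "\<not> x < (x::levi_civita)"
  by (simp add: less_iff_coeff)

lemma less_linear_lc: "x < y \<or> x = y \<or> y < (x::levi_civita)"
proof (cases "x = y")
  case False
  then have "x - y \<noteq> 0" by simp
  from lc_coeff_val[OF this] show ?thesis unfolding less_iff_coeff
    by (metis lc_coeff_minus eq_iff_diff_eq_0 linorder_neq_iff)
qed auto

instance
proof
  fix x y z :: levi_civita
  show "(x < y) = (x \<le> y \<and> \<not> y \<le> x)"
    using less_trans_lc[of x y x] less_irrefl_lc by (auto simp: less_eq_levi_civita_def)
  show "x \<le> x" by (simp add: less_eq_levi_civita_def)
  show "x \<le> y \<Longrightarrow> y \<le> z \<Longrightarrow> x \<le> z"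
    using less_trans_lc by (auto simp: less_eq_levi_civita_def)
  show "x \<le> y \<Longrightarrow> y \<le> x \<Longrightarrow> x = y"
    using less_trans_lc[of x y x] less_irrefl_lc by (auto simp: less_eq_levi_civita_def)
  show "x \<le> y \<or> y \<le> x" using less_linear_lc by (auto simp: less_eq_levi_civita_def)
  show "x \<le> y \<Longrightarrow> z + x \<le> z + y" by (auto simp: less_eq_levi_civita_def less_iff_coeff)
  show "x < y \<Longrightarrow> 0 < z \<Longrightarrow> z * x < z * y"
  proof -
    assume "x < y" "0 < z"
    then obtain p q where p: "lc_coeff x p < lc_coeff y p" "\<And>r. r < p \<Longrightarrow> lc_coeff x r = lc_coeff y r"
      and q: "0 < lc_coeff z q" "\<And>r. r < q \<Longrightarrow> lc_coeff z r = 0"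
      unfolding less_iff_coeff by auto
    let ?w = "y - x"
    have w: "\<And>r. r < p \<Longrightarrow> lc_coeff ?w r = 0" "lc_coeff ?w p > 0" using p by auto
    have "lc_coeff (z * ?w) (q + p) > 0" using lc_coeff_times_lead[OF q(2) w(1)] q(1) w(2) by simp
    moreover have "lc_coeff (z * ?w) r = 0" if "r < q + p" for r
      using lc_coeff_times_below[OF q(2) w(1) that] .
    moreover have "z * ?w = z * y - z * x" by (simp add: algebra_simps)
    ultimately show ?thesis unfolding less_iff_coeff by (intro exI[of _ "q + p"]) auto
  qed
  show "\<bar>x\<bar> = (if x < 0 then - x else x)" by (rule abs_levi_civita_def)
  show "sgn x = (if x = 0 then 0 else if 0 < x then 1 else - 1)" by (rule sgn_levi_civita_def)
qed

end

lemma lc_coeff_power_below: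
  assumes "\<And>r. r < L \<Longrightarrow> lc_coeff u r = 0" "r < of_nat n * L"
  shows "lc_coeff (u ^ n) r = 0"
  using assms(2)
proof (induction n arbitrary: r)
  case (Suc n)
  have "lc_coeff (u * u ^ n) r = 0"
    by (rule lc_coeff_times_below[of L _ "of_nat n * L"]) (use assms(1) Suc in \<open>auto simp: algebra_simps\<close>)
  then show ?case by simp
qed (simp add: lc_coeff_one)

lemma lc_coeff_sum: "lc_coeff (sum f S) q = (\<Sum>i\<in>S. lc_coeff (f i) q)"
  by (induction S rule: infinite_finite_induct) auto

lemma one_minus_inverse:
  assumes L: "L > 0" "\<And>r. r < L \<Longrightarrow> lc_coeff u r = 0"
  shows "\<exists>y. (1 - u) * y = 1"
proof -
  define N where "N = (\<lambda>q. nat \<lceil>q / L\<rceil>)"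
  have van: "lc_coeff (u ^ n) q = 0" if "n > N q" for n q
  proof (rule lc_coeff_power_below[OF L(2)])
    have "q / L < of_nat n" using that unfolding N_def by linarith
    then show "q < of_nat n * L" using L(1) by (simp add: field_simps)
  qed
  have mono: "N q \<le> N Q" if "q \<le> Q" for q Q
    unfolding N_def using that L(1) by (intro nat_mono ceiling_mono divide_right_mono) auto
  define f where "f = (\<lambda>q. \<Sum>n\<le>N q. lc_coeff (u ^ n) q)"
  have f: "f q = (\<Sum>n\<le>K. lc_coeff (u ^ n) q)" if "N q \<le> K" for q K
    unfolding f_def using that van by (intro sum.mono_neutral_left) auto
  have "finite {q. q \<le> Q \<and> f q \<noteq> 0}" for Q
  proof (rule finite_subset)
    show "finite (\<Union>n\<le>N Q. {q. q \<le> Q \<and> lc_coeff (u ^ n) q \<noteq> 0})" using lf_coeff by blast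
    show "{q. q \<le> Q \<and> f q \<noteq> 0} \<subseteq> (\<Union>n\<le>N Q. {q. q \<le> Q \<and> lc_coeff (u ^ n) q \<noteq> 0})"
    proof
      fix q assume "q \<in> {q. q \<le> Q \<and> f q \<noteq> 0}"
      then have q: "q \<le> Q" "f q \<noteq> 0" by auto
      then obtain n where "n \<le> N q" "lc_coeff (u ^ n) q \<noteq> 0"
        unfolding f_def by (meson atMost_iff sum.not_neutral_contains_not_neutral)
      then show "q \<in> (\<Union>n\<le>N Q. {q. q \<le> Q \<and> lc_coeff (u ^ n) q \<noteq> 0})"
        using q mono[OF q(1)] by (auto intro!: bexI[of _ n])
    qed
  qed
  then have cf: "lc_coeff (Abs_levi_civita f) = f" by (rule lc_coeff_Abs)
  let ?y = "Abs_levi_civita f"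
  have "(1 - u) * ?y = 1"
  proof (rule lc_eqI)
    fix q
    let ?K = "N (q + 1)"
    let ?S = "\<Sum>n\<le>?K. u ^ n"
    have gs: "(1 - u) * ?S = 1 - u ^ Suc ?K"
      by (metis sum_gp_basic)
    have u0: "lc_coeff (1 - u) r = 0" if "r < 0" for r using that L by (simp add: lc_coeff_one)
    have yS: "lc_coeff (?y - ?S) r = 0" if "r < q + 1" for r
      using f[OF mono, of r "q + 1"] that by (simp add: cf lc_coeff_sum)
    have "lc_coeff ((1 - u) * (?y - ?S)) q = 0"
      by (rule lc_coeff_times_below[where L = 0 and M = "q + 1"]) (use u0 yS in auto)
    moreover have "(1 - u) * ?y = (1 - u) * (?y - ?S) + (1 - u) * ?S" by (simp add: algebra_simps)
    moreover have "lc_coeff (u ^ Suc ?K) q = 0"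
      by (rule van) (use mono[of q "q + 1"] in simp)
    ultimately show "lc_coeff ((1 - u) * ?y) q = lc_coeff 1 q" using gs by simp
  qed
  then show ?thesis by blast
qed

lemma inverse_ex:
  assumes "x \<noteq> (0::levi_civita)"
  shows "\<exists>y. x * y = 1"
proof -
  let ?v = "lc_val x"
  define m where "m = Abs_levi_civita (\<lambda>q. if q = - ?v then 1 / lc_coeff x ?v else 0)"
  have m: "lc_coeff m q = (if q = - ?v then 1 / lc_coeff x ?v else 0)" for q
    unfolding m_def by (subst lc_coeff_Abs) auto
  note v = lc_coeff_val[OF assms]
  have m0: "\<And>r. r < - ?v \<Longrightarrow> lc_coeff m r = 0" by (simp add: m)
  have lead: "lc_coeff (x * m) 0 = 1" 
    using lc_coeff_times_lead[of ?v x "- ?v" m] v m0 by (simp add: m)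
  have below: "lc_coeff (x * m) r = 0" if "r < 0" for r
    using lc_coeff_times_below[of ?v x "- ?v" m r] v m0 that by simp
  define u where "u = 1 - x * m"
  have u: "lc_coeff u r = 0" if "r \<le> 0" for r
    using lead below that by (cases "r = 0") (auto simp: u_def lc_coeff_one)
  have "\<exists>L>0. \<forall>r<L. lc_coeff u r = 0"
  proof (cases "u = 0")
    case True then show ?thesis by (intro exI[of _ 1]) simp
  next
    case False
    from lc_coeff_val[OF this] u show ?thesis
      by (intro exI[of _ "lc_val u"]) (auto simp: not_le[symmetric])
  qed
  then obtain y where "(1 - u) * y = 1" using one_minus_inverse by blast
  then have "x * (m * y) = 1" by (simp add: u_def mult.assoc)
  then show ?thesis by blast
qed

instantiation levi_civita :: linordered_field
begin

definition inverse_levi_civita where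
  "inverse x = (if x = 0 then 0 else THE y :: levi_civita. x * y = 1)"
definition divide_levi_civita where "x div y = x * inverse (y :: levi_civita)"

instance
proof
  fix x y :: levi_civita
  show "inverse (0::levi_civita) = 0" by (simp add: inverse_levi_civita_def)
  show "x div y = x * inverse y" by (rule divide_levi_civita_def)
  assume x: "x \<noteq> 0"
  then obtain z where z: "x * z = 1" using inverse_ex by blast
  have "inverse x = z" unfolding inverse_levi_civita_def using x z
    by (auto intro!: the_equality) (metis mult_cancel_left)
  then show "inverse x * x = 1" using z by (simp add: mult.commute)
qed

end


text \<open>
  The power \<open>x\<^sup>p\<close> for rational \<open>p = a/b \<ge> 0\<close> in lowest terms. For \<open>x \<ge> 0\<close> it is the unique
  \<open>y \<ge> 0\<close> with \<open>y\<^sup>b = x\<^sup>a\<close>, which exists since the field is real closed. For \<open>x < 0\<close> and odd \<open>b\<close>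
  it is the \<open>a\<close>-th power of the (negative) \<open>b\<close>-th root of \<open>x\<close>; for \<open>x < 0\<close> and even \<open>b\<close>, where no
  such root exists, the convention is \<open>\<bar>x\<bar>\<^sup>p\<close>. Irrational exponents are not available: the
  \<open>p\<close>-th power of an element of valuation \<open>r\<close> would have valuation \<open>p r\<close>, which must be rational.
\<close>

definition lc_powr :: "levi_civita \<Rightarrow> rat \<Rightarrow> levi_civita" where
  "lc_powr x p = (let (a, b) = quotient_of p in
     (if x < 0 \<and> odd a \<and> odd b then - 1 else 1) *
     (THE y. 0 \<le> y \<and> y ^ nat b = \<bar>x\<bar> ^ nat a))"

lemma lc_powr_of_nat: "lc_powr x (of_nat n) = x ^ n"
proof -
  have "quotient_of (of_nat n) = (int n, 1)" using quotient_of_int[of "int n"] by simp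
  moreover have "(THE y. 0 \<le> y \<and> y ^ nat 1 = \<bar>x\<bar> ^ nat (int n)) = \<bar>x\<bar> ^ n"
    by (rule the_equality) auto
  moreover have "\<bar>x\<bar> ^ n = (if x < 0 \<and> odd n then - (x ^ n) else x ^ n)"
    by (auto simp: abs_if power_minus_odd)
  ultimately show ?thesis by (auto simp: lc_powr_def)
qed


section \<open>Convergence\<close>

definition strong_lim :: "(nat \<Rightarrow> levi_civita) \<Rightarrow> levi_civita \<Rightarrow> bool" where
  "strong_lim u l \<longleftrightarrow> (\<forall>\<epsilon>>0. \<forall>\<^sub>F n in sequentially. \<bar>u n - l\<bar> < \<epsilon>)"

definition weak_lim :: "(nat \<Rightarrow> levi_civita) \<Rightarrow> levi_civita \<Rightarrow> bool" where
  "weak_lim u l \<longleftrightarrow> (\<forall>\<epsilon>>0::real. \<forall>\<^sub>F n in sequentially.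
     Max ((\<lambda>q. \<bar>lc_coeff (u n - l) q\<bar>) ` {q. real_of_rat q \<le> inverse \<epsilon>}) < \<epsilon>)"

text \<open>The maximum above is attained, being taken over finitely many values.\<close>

lemma finite_weak_lim_values:
  "finite ((\<lambda>q. \<bar>lc_coeff x q\<bar>) ` {q. real_of_rat q \<le> r})"
  "(\<lambda>q. \<bar>lc_coeff x q\<bar>) ` {q. real_of_rat q \<le> r} \<noteq> {}"
proof -
  obtain Q where Q: "r < real_of_rat Q" using of_rat_dense[of r "r + 1"] by auto
  let ?S = "{q. q \<le> Q \<and> lc_coeff x q \<noteq> 0}"
  have "(\<lambda>q. \<bar>lc_coeff x q\<bar>) ` {q. real_of_rat q \<le> r} \<subseteq> insert 0 ((\<lambda>q. \<bar>lc_coeff x q\<bar>) ` ?S)"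
  proof (rule image_subsetI)
    fix q assume "q \<in> {q. real_of_rat q \<le> r}"
    then have "real_of_rat q < real_of_rat Q" using Q by simp
    then have "q \<le> Q" by (simp add: of_rat_less)
    then show "\<bar>lc_coeff x q\<bar> \<in> insert 0 ((\<lambda>q. \<bar>lc_coeff x q\<bar>) ` ?S)" by auto
  qed
  then show "finite ((\<lambda>q. \<bar>lc_coeff x q\<bar>) ` {q. real_of_rat q \<le> r})"
    using lf_coeff[of Q x] by (auto intro: finite_subset)
  obtain q where "real_of_rat q < r" using of_rat_dense[of "r - 1" r] by auto
  then have "q \<in> {q. real_of_rat q \<le> r}" by simp
  then show "(\<lambda>q. \<bar>lc_coeff x q\<bar>) ` {q. real_of_rat q \<le> r} \<noteq> {}" by blast
qed

definition strong_sums :: "(nat \<Rightarrow> levi_civita) \<Rightarrow> levi_civita \<Rightarrow> bool" where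
  "strong_sums u s \<longleftrightarrow> strong_lim (\<lambda>n. \<Sum>k<n. u k) s"

definition weak_sums :: "(nat \<Rightarrow> levi_civita) \<Rightarrow> levi_civita \<Rightarrow> bool" where
  "weak_sums u s \<longleftrightarrow> weak_lim (\<lambda>K. \<Sum>k\<le>K. u k) s"

definition lim_within ::
    "levi_civita set \<Rightarrow> (levi_civita \<Rightarrow> levi_civita) \<Rightarrow> levi_civita \<Rightarrow> levi_civita \<Rightarrow> bool" where
  "lim_within I F c l \<longleftrightarrow> (\<forall>\<epsilon>>0. \<exists>\<delta>>0. \<forall>x\<in>I. x \<noteq> c \<and> \<bar>x - c\<bar> < \<delta> \<longrightarrow> \<bar>F x - l\<bar> < \<epsilon>)"


section \<open>Measurable sets\<close>

definition intervals :: "levi_civita \<Rightarrow> levi_civita \<Rightarrow> levi_civita set set" where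
  "intervals a b = (if a \<le> b then {{a..b}, {a<..b}, {a..<b}, {a<..<b}} else {})"

text \<open>The \<open>n\<close>-th interval \<open>I n\<close> has endpoints \<open>a n\<close>, \<open>b n\<close> and length \<open>b n - a n\<close>.\<close>

definition interval_seq ::
    "(nat \<Rightarrow> levi_civita set) \<Rightarrow> (nat \<Rightarrow> levi_civita) \<Rightarrow> (nat \<Rightarrow> levi_civita) \<Rightarrow> bool" where
  "interval_seq I a b \<longleftrightarrow> (\<forall>n. I n \<in> intervals (a n) (b n)) \<and> disjoint_family I"

definition inner_sums :: "levi_civita set \<Rightarrow> levi_civita set" where
  "inner_sums A = {s. \<exists>I a b. interval_seq I a b \<and> (\<Union>n. I n) \<subseteq> A \<and> strong_sums (\<lambda>n. b n - a n) s}"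

definition outer_sums :: "levi_civita set \<Rightarrow> levi_civita set" where
  "outer_sums A = {s. \<exists>J a b. interval_seq J a b \<and> A \<subseteq> (\<Union>n. J n) \<and> strong_sums (\<lambda>n. b n - a n) s}"

definition lc_measurable :: "levi_civita set \<Rightarrow> bool" where
  "lc_measurable A \<longleftrightarrow> (\<forall>\<epsilon>>0. \<exists>s\<in>inner_sums A. \<exists>t\<in>outer_sums A. t - s \<le> \<epsilon>)"

definition lc_measure :: "levi_civita set \<Rightarrow> levi_civita" where
  "lc_measure A = (THE m. isLub UNIV (inner_sums A) m)"

definition lc_ae :: "levi_civita set \<Rightarrow> (levi_civita \<Rightarrow> bool) \<Rightarrow> bool" where
  "lc_ae A P \<longleftrightarrow> lc_measurable {x\<in>A. P x} \<and> lc_measure {x\<in>A. P x} = lc_measure A"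


section \<open>Measurable functions and integration\<close>

text \<open>
  A function \<open>A \<rightarrow> \<R>\<close> is represented by a total function of which only the values on \<open>A\<close> matter.
\<close>

definition simple_on :: "levi_civita set \<Rightarrow> (levi_civita \<Rightarrow> levi_civita) \<Rightarrow> bool" where
  "simple_on I f \<longleftrightarrow> (\<exists>x\<^sub>0 c. \<forall>x\<in>I. weak_sums (\<lambda>k. c k * (x - x\<^sub>0) ^ k) (f x))"

definition measurable_funs :: "levi_civita set \<Rightarrow> (levi_civita \<Rightarrow> levi_civita) set" where
  "measurable_funs A = {f. lc_measurable A \<and>
     (\<forall>\<epsilon>>0. \<exists>I a b s. interval_seq I a b \<and> (\<Union>n. I n) \<subseteq> A \<and> strong_sums (\<lambda>n. b n - a n) s \<and>
        lc_measure A - s < \<epsilon> \<and> (\<forall>n. simple_on (I n) f))}"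

text \<open>
  For \<open>a = b\<close> both limits are the same, so the integral is \<open>0\<close>; the case is separated because
  \<^const>\<open>lim_within\<close> is vacuous on degenerate intervals.
\<close>

definition has_simple_integral ::
    "(levi_civita \<Rightarrow> levi_civita) \<Rightarrow> levi_civita set \<Rightarrow> levi_civita \<Rightarrow> levi_civita \<Rightarrow> levi_civita \<Rightarrow> bool" where
  "has_simple_integral f I a b v \<longleftrightarrow> I \<in> intervals a b \<and> simple_on I f \<and>
     (if a = b then v = 0
      else \<exists>x\<^sub>0 c F l\<^sub>a l\<^sub>b.
        (\<forall>x\<in>I. weak_sums (\<lambda>k. c k * (x - x\<^sub>0) ^ k) (f x)) \<and>
        (\<forall>x\<in>I. weak_sums (\<lambda>k. c k / of_nat (Suc k) * (x - x\<^sub>0) ^ Suc k) (F x)) \<and>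
        lim_within I F a l\<^sub>a \<and> lim_within I F b l\<^sub>b \<and> v = l\<^sub>b - l\<^sub>a)"

text \<open>
  The integral of \<open>f\<close> over \<open>A\<close> is defined and equal to the element \<open>L\<close> of the field (the values
  \<open>\<plusminus>\<infinity>\<close> are thus excluded). The limit is taken along all admissible sequences of intervals as the
  total length tends to \<open>m(A)\<close>; membership in \<^const>\<open>measurable_funs\<close> ensures that there are such
  sequences with total length arbitrarily close to \<open>m(A)\<close>.
\<close>

definition lc_has_integral ::
    "(levi_civita \<Rightarrow> levi_civita) \<Rightarrow> levi_civita set \<Rightarrow> levi_civita \<Rightarrow> bool" where
  "lc_has_integral f A L \<longleftrightarrow> f \<in> measurable_funs A \<and>
     (\<forall>\<epsilon>>0. \<exists>\<delta>>0. \<forall>I a b s.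
        interval_seq I a b \<and> (\<Union>n. I n) \<subseteq> A \<and> (\<forall>n. simple_on (I n) f) \<and>
        strong_sums (\<lambda>n. b n - a n) s \<and> lc_measure A - s < \<delta> \<longrightarrow>
        (\<exists>v t. (\<forall>n. has_simple_integral f (I n) (a n) (b n) (v n)) \<and>
               strong_sums v t \<and> \<bar>t - L\<bar> < \<epsilon>))"


section \<open>The spaces \<open>L\<^sup>p\<close>\<close>

text \<open>
  Elements of \<open>L\<^sup>p(A)\<close> are given by representatives: two functions that agree almost everywhere on
  \<open>A\<close> define the same element and have the same norm. The relation \<open>has_lp_norm p A f v\<close> states that
  \<open>\<parallel>f\<parallel>\<^sub>p\<close> is defined and equal to \<open>v\<close>; \<open>Pinf\<close> is \<open>p = \<infinity>\<close>. Since the integrand \<open>\<bar>f\<bar>\<^sup>p\<close> is nonnegative,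
  its integral being defined and \<open>< +\<infinity>\<close> means that it has a value in the field.
\<close>

fun has_lp_norm ::
    "rat extended \<Rightarrow> levi_civita set \<Rightarrow> (levi_civita \<Rightarrow> levi_civita) \<Rightarrow> levi_civita \<Rightarrow> bool" where
  "has_lp_norm (Fin p) A f v \<longleftrightarrow>
     (\<exists>L. lc_has_integral (\<lambda>x. lc_powr \<bar>f x\<bar> p) A L \<and> v = lc_powr L (1 / p))"
| "has_lp_norm Pinf A f v \<longleftrightarrow> isGlb UNIV {c. lc_ae A (\<lambda>x. \<bar>f x\<bar> \<le> c)} v"
| "has_lp_norm Minf A f v \<longleftrightarrow> False"

fun lp_space :: "rat extended \<Rightarrow> levi_civita set \<Rightarrow> (levi_civita \<Rightarrow> levi_civita) set" where
  "lp_space (Fin p) A = {f \<in> measurable_funs A. (\<lambda>x. lc_powr (f x) p) \<in> measurable_funs A \<and>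
     (\<exists>L. lc_has_integral (\<lambda>x. lc_powr \<bar>f x\<bar> p) A L)}"
| "lp_space Pinf A = {f \<in> measurable_funs A. \<exists>v. has_lp_norm Pinf A f v}"
| "lp_space Minf A = {}"

definition strongly_Cauchy_lp ::
    "rat extended \<Rightarrow> levi_civita set \<Rightarrow> (nat \<Rightarrow> levi_civita \<Rightarrow> levi_civita) \<Rightarrow> bool" where
  "strongly_Cauchy_lp p A f \<longleftrightarrow> (\<forall>\<epsilon>>0. \<exists>N. \<forall>m>N. \<forall>n>N.
     \<exists>v. has_lp_norm p A (\<lambda>x. f n x - f m x) v \<and> v < \<epsilon>)"

text \<open>The norms \<open>\<parallel>f\<^sub>n - g\<parallel>\<^sub>p\<close> are only required to be defined from some index on.\<close>

definition strongly_converges_lp ::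
    "rat extended \<Rightarrow> levi_civita set \<Rightarrow> (nat \<Rightarrow> levi_civita \<Rightarrow> levi_civita) \<Rightarrow> (levi_civita \<Rightarrow> levi_civita) \<Rightarrow> bool" where
  "strongly_converges_lp p A f g \<longleftrightarrow> (\<exists>v. strong_lim v 0 \<and>
     (\<forall>\<^sub>F n in sequentially. has_lp_norm p A (\<lambda>x. f n x - g x) (v n)))"

end

theory Submission
  imports Defs "HOL-Complex_Analysis.Conformal_Mappings"
begin

text \<open>
  Take an interval \<open>[\<alpha>, \<alpha> + h)\<close> contained in \<open>A\<close> and let \<open>f\<^sub>n(x)\<close> be the sum over \<open>k \<le> n\<close> of \<open>d\<^sup>k\<close> times
  the number of points \<open>\<alpha> + i h / 2\<^sup>k \<le> x\<close>. Since \<open>\<bar>f\<^sub>n - f\<^sub>m\<bar> < d\<^sup>m\<close> for \<open>m \<le> n\<close>, the sequence is strongly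
  Cauchy for every \<open>p\<close>. A measurable \<open>g\<close> is simple on intervals of total length close to \<open>m(A)\<close>. Lengths
  whose ratios to \<open>h\<close> are infinitesimal cannot add up to \<open>h / 2\<close> in a strongly convergent series, so one of these
  intervals has a jump point in its interior. Simple functions are strongly continuous there, so \<open>\<bar>f\<^sub>n - g\<bar>\<close>
  is at least some \<open>e > 0\<close> on an interval whose length does not depend on \<open>n\<close>. This bounds the norms from
  below, for \<open>p < \<infinity>\<close> because antiderivatives of nonnegative simple functions are nondecreasing.
\<close>

section \<open>Valuations and strong convergence\<close>

text \<open>In its order topology the field is totally disconnected and not locally compact, and
  bounded sets need not have suprema. Covering arguments and the mean value theorem therefore fail;
  a nonnegative derivative alone does not make a function increase. Two substitutes carry the proof.
  Strong convergence is ultrametric: a series converges strongly as soon as its terms tend to 0.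
  Power series converge only weakly; they are treated one exponent at a time, on real coefficients,
  where real analysis applies, and the least exponent at which anything varies decides the order.
  The functions are built from counts, hence nondecreasing on the interval, so that a jump made at
  one level is never undone at a later one. This gives a lower bound that is uniform in n. The
  spacings \<open>h / 2 ^ k\<close> fall below \<open>h / (2 * N)\<close> for every natural number
  N, but below no length infinitesimal relative to h; intervals of such lengths have to be excluded
  as carriers of g by other means.\<close>

text \<open>\<open>vge x L\<close> stands for \<open>\<lambda>(x) \<ge> L\<close>, and \<open>lc_monom c p\<close> for \<open>c d\<^sup>p\<close> with \<open>d\<close> the basic infinitesimal.\<close>

definition vge :: "levi_civita \<Rightarrow> rat \<Rightarrow> bool" where
  "vge x L \<longleftrightarrow> (\<forall>q<L. lc_coeff x q = 0)"

definition lc_monom :: "real \<Rightarrow> rat \<Rightarrow> levi_civita" where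
  "lc_monom c p = Abs_levi_civita (\<lambda>q. if q = p then c else 0)"

abbreviation lc_real :: "real \<Rightarrow> levi_civita" where
  "lc_real c \<equiv> lc_monom c 0"

abbreviation dpow :: "nat \<Rightarrow> levi_civita" where
  "dpow n \<equiv> lc_monom 1 (of_nat n)"

lemma vgeD: "vge x L \<Longrightarrow> q < L \<Longrightarrow> lc_coeff x q = 0"
  by (simp add: vge_def)

lemma vge_0 [simp]: "vge 0 L"
  by (simp add: vge_def)

lemma vge_weaken: "vge x L \<Longrightarrow> M \<le> L \<Longrightarrow> vge x M"
  by (auto simp: vge_def)

lemma vge_add: "vge x L \<Longrightarrow> vge y L \<Longrightarrow> vge (x + y) L"
  by (auto simp: vge_def)

lemma vge_diff: "vge x L \<Longrightarrow> vge y L \<Longrightarrow> vge (x - y) L"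
  by (auto simp: vge_def)

lemma vge_uminus [simp]: "vge (- x) L \<longleftrightarrow> vge x L"
  by (auto simp: vge_def)

lemma vge_sum: "(\<And>i. i \<in> S \<Longrightarrow> vge (f i) L) \<Longrightarrow> vge (sum f S) L"
  by (auto simp: vge_def lc_coeff_sum)

lemma vge_mult: "vge x L \<Longrightarrow> vge y M \<Longrightarrow> vge (x * y) (L + M)"
  unfolding vge_def using lc_coeff_times_below[of L x M y] by auto

lemma vge_power: "vge x L \<Longrightarrow> vge (x ^ n) (of_nat n * L)"
  using lc_coeff_power_below[of L x] by (auto simp: vge_def)

lemma vge_power0: "vge x 0 \<Longrightarrow> vge (x ^ n) 0"
  using vge_power[of x 0 n] by simp

lemma vge_ex: "\<exists>L. vge x L"
  by (metis lc_coeff_bound vge_def)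

lemma vge_val: "x \<noteq> 0 \<Longrightarrow> vge x (lc_val x)"
  using lc_coeff_val(2) by (auto simp: vge_def)

lemma vge_val_iff: "x \<noteq> 0 \<Longrightarrow> vge x L \<longleftrightarrow> L \<le> lc_val x"
  by (metis lc_coeff_val(1) not_less vgeD vge_val vge_weaken)

lemma coeff_times_lead: "vge x L \<Longrightarrow> vge y M \<Longrightarrow> lc_coeff (x * y) (L + M) = lc_coeff x L * lc_coeff y M"
  by (intro lc_coeff_times_lead) (auto simp: vge_def)

lemma lc_coeff_monom: "lc_coeff (lc_monom c p) q = (if q = p then c else 0)"
  unfolding lc_monom_def by (subst lc_coeff_Abs) auto

lemma lc_monom_0 [simp]: "lc_monom 0 p = 0"
  by (rule lc_eqI) (simp add: lc_coeff_monom)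

lemma vge_monom: "L \<le> p \<Longrightarrow> vge (lc_monom c p) L"
  by (auto simp: vge_def lc_coeff_monom)

lemma lc_coeff_monom_times: "lc_coeff (lc_monom c p * x) q = c * lc_coeff x (q - p)"
  by (subst lc_coeff_times_superset[where S = "{p}"])
     (auto simp: lc_coeff_monom split: if_splits)

lemma lc_monom_times: "lc_monom c p * lc_monom e q = lc_monom (c * e) (p + q)"
  by (rule lc_eqI) (auto simp: lc_coeff_monom_times lc_coeff_monom)

lemma lc_monom_add: "lc_monom c p + lc_monom e p = lc_monom (c + e) p"
  by (rule lc_eqI) (auto simp: lc_coeff_monom)

lemma lc_monom_diff: "lc_monom c p - lc_monom e p = lc_monom (c - e) p"
  by (rule lc_eqI) (auto simp: lc_coeff_monom)

lemma lc_real_1 [simp]: "lc_real 1 = 1"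
  by (rule lc_eqI) (auto simp: lc_coeff_monom lc_coeff_one)

lemma lc_monom_power: "lc_monom c p ^ n = lc_monom (c ^ n) (of_nat n * p)"
  by (induction n) (auto simp: lc_monom_times algebra_simps)

lemma of_nat_lc: "of_nat n = lc_real (real n)"
proof (induction n)
  case (Suc n)
  have "of_nat (Suc n) = lc_real 1 + lc_real (real n)" using Suc by simp
  also have "\<dots> = lc_real (real (Suc n))" by (simp only: lc_monom_add of_nat_Suc)
  finally show ?case .
qed simp

lemma lc_coeff_real_times: "lc_coeff (lc_real c * x) q = c * lc_coeff x q"
  by (simp add: lc_coeff_monom_times)

lemma lc_coeff_of_nat_times: "lc_coeff (of_nat n * x) q = real n * lc_coeff x q"
  by (simp add: of_nat_lc lc_coeff_real_times)

lemma lc_inverse_of_nat: assumes "n > 0" shows "1 / of_nat n = lc_real (1 / real n)"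
proof -
  have e: "lc_real (1 / real n) * of_nat n = 1"
    using assms by (simp add: of_nat_lc lc_monom_times)
  then have "(of_nat n :: levi_civita) \<noteq> 0" by (metis mult_zero_right zero_neq_one)
  then show ?thesis by (rule nonzero_divide_eq_eq[THEN iffD2]) (rule e[symmetric])
qed

lemma lc_coeff_divide_of_nat: "n > 0 \<Longrightarrow> lc_coeff (x / of_nat n) q = lc_coeff x q / real n"
  using lc_inverse_of_nat[of n] lc_coeff_real_times[of "1 / real n" x q]
  by (simp add: divide_inverse mult.commute)

section \<open>Order, valuations and monomials\<close>

lemma lc_pos_iff: "0 < x \<longleftrightarrow> (\<exists>q. 0 < lc_coeff x q \<and> vge x q)"
  by (auto simp: less_iff_coeff vge_def)

lemma lc_nonneg_lead: "0 \<le> x \<Longrightarrow> vge x q \<Longrightarrow> 0 \<le> lc_coeff x q"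
proof (cases "x = 0")
  case False
  assume "0 \<le> x" "vge x q"
  with False obtain p where p: "0 < lc_coeff x p" "vge x p" by (metis lc_pos_iff order_le_less)
  then show ?thesis using \<open>vge x q\<close> by (metis less_eq_real_def linorder_neq_iff vgeD)
qed auto

lemma lc_monom_pos [simp]: "0 < lc_monom c p \<longleftrightarrow> 0 < c"
  unfolding lc_pos_iff lc_coeff_monom using vge_monom[of p p c]
  by (auto split: if_splits)

lemma lc_monom_less [simp]: "lc_monom c p < lc_monom e p \<longleftrightarrow> c < e"
  using lc_monom_pos[of "e - c" p] by (simp flip: lc_monom_diff)

lemma lc_monom_le [simp]: "lc_monom c p \<le> lc_monom e p \<longleftrightarrow> c \<le> e"
  by (simp flip: not_less)

lemma vge_less_monom: assumes "vge x L" "q < L" "0 < c" shows "\<bar>x\<bar> < lc_monom c q"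
proof -
  have "x < lc_monom c q" "- x < lc_monom c q"
    unfolding less_iff_coeff using assms
    by (intro exI[of _ q]; auto simp: lc_coeff_monom vge_def)+
  then show ?thesis by (auto simp: abs_if)
qed

lemma vge_abs [simp]: "vge \<bar>x\<bar> L \<longleftrightarrow> vge x L"
  by (auto simp: abs_if)

lemma less_monom_vge: assumes "\<bar>x\<bar> < lc_monom c q" shows "vge x q"
proof (rule ccontr)
  assume "\<not> vge x q"
  then have "x \<noteq> 0" by auto
  then have "0 < \<bar>x\<bar>" by simp
  then obtain p where p: "0 < lc_coeff \<bar>x\<bar> p" "vge \<bar>x\<bar> p" by (auto simp: lc_pos_iff)
  then have "p < q" using \<open>\<not> vge x q\<close> by (metis not_le vge_abs vge_weaken)
  then have "lc_monom c q < \<bar>x\<bar>" unfolding less_iff_coeff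
    using p by (intro exI[of _ p]) (auto simp: lc_coeff_monom vge_def)
  then show False using assms by simp
qed

lemma vge_mono: "\<bar>x\<bar> \<le> \<bar>y\<bar> \<Longrightarrow> vge y L \<Longrightarrow> vge x L"
proof -
  assume a: "\<bar>x\<bar> \<le> \<bar>y\<bar>" "vge y L"
  show "vge x L" unfolding vge_def
  proof (intro allI impI)
    fix q assume "q < L"
    \<comment> \<open>\<open>vge_less_monom\<close> requires an exponent strictly below L, and
      \<open>less_monom_vge\<close> then controls only exponents below r; hence a point strictly
      between.\<close>
    then obtain r where r: "q < r" "r < L" using dense by blast
    have "\<bar>x\<bar> < lc_monom 1 r" using vge_less_monom[OF a(2) r(2), of 1] a(1) by simp
    from less_monom_vge[OF this] r show "lc_coeff x q = 0" by (auto simp: vge_def)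
  qed
qed

text \<open>Valuation balls form a neighbourhood base of 0, so epsilons can be traded for exponents.
  Any exponent beyond the leading one of \<epsilon> serves.\<close>

lemma eps_vge: "0 < \<epsilon> \<Longrightarrow> \<exists>R. \<forall>u. vge u R \<longrightarrow> \<bar>u\<bar> < \<epsilon>"
proof -
  assume "0 < \<epsilon>"
  then obtain q where q: "0 < lc_coeff \<epsilon> q" "vge \<epsilon> q" by (auto simp: lc_pos_iff)
  have "\<bar>u\<bar> < \<epsilon>" if "vge u (q + 1)" for u
  proof -
    have "vge \<bar>u\<bar> (q+1)" using that by simp
    then show ?thesis unfolding less_iff_coeff using q
      by (intro exI[of _ q]) (auto simp: vge_def)
  qed
  then show ?thesis by blast
qed

section \<open>Strong limits and strongly convergent series\<close>

lemma strong_lim_vge: "strong_lim u l \<longleftrightarrow> (\<forall>R. \<forall>\<^sub>F n in sequentially. vge (u n - l) R)"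
proof
  assume a: "strong_lim u l"
  show "\<forall>R. \<forall>\<^sub>F n in sequentially. vge (u n - l) R"
  proof
    fix R
    have "\<forall>\<^sub>F n in sequentially. \<bar>u n - l\<bar> < lc_monom 1 R" using a by (auto simp: strong_lim_def)
    then show "\<forall>\<^sub>F n in sequentially. vge (u n - l) R" by eventually_elim (rule less_monom_vge)
  qed
next
  assume a: "\<forall>R. \<forall>\<^sub>F n in sequentially. vge (u n - l) R"
  show "strong_lim u l" unfolding strong_lim_def
  proof (intro allI impI)
    fix \<epsilon> :: levi_civita assume "0 < \<epsilon>"
    then obtain R where "\<forall>u. vge u R \<longrightarrow> \<bar>u\<bar> < \<epsilon>" using eps_vge by blast
    then show "\<forall>\<^sub>F n in sequentially. \<bar>u n - l\<bar> < \<epsilon>"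
      using a[rule_format, of R] by (auto elim: eventually_mono)
  qed
qed

lemma strong_lim_const [simp]: "strong_lim (\<lambda>n. c) c"
  by (simp add: strong_lim_vge)

lemma strong_lim_add: "strong_lim u l \<Longrightarrow> strong_lim v m \<Longrightarrow> strong_lim (\<lambda>n. u n + v n) (l + m)"
  unfolding strong_lim_vge
proof
  fix R assume "\<forall>R. \<forall>\<^sub>F n in sequentially. vge (u n - l) R" "\<forall>R. \<forall>\<^sub>F n in sequentially. vge (v n - m) R"
  then have "\<forall>\<^sub>F n in sequentially. vge (u n - l) R" "\<forall>\<^sub>F n in sequentially. vge (v n - m) R" by auto
  then show "\<forall>\<^sub>F n in sequentially. vge (u n + v n - (l + m)) R"
  proof eventually_elim
    case (elim n)
    from vge_add[OF elim] show ?case by (simp add: algebra_simps)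
  qed
qed

lemma strong_lim_cmult: "strong_lim u l \<Longrightarrow> strong_lim (\<lambda>n. c * u n) (c * l)"
  unfolding strong_lim_vge
proof
  fix R assume a: "\<forall>R. \<forall>\<^sub>F n in sequentially. vge (u n - l) R"
  obtain M where M: "vge c M" using vge_ex by blast
  have "\<forall>\<^sub>F n in sequentially. vge (u n - l) (R - M)" using a by blast
  then show "\<forall>\<^sub>F n in sequentially. vge (c * u n - c * l) R"
  proof eventually_elim
    case (elim n)
    from vge_mult[OF M elim] show ?case by (simp add: algebra_simps)
  qed
qed

lemma strong_lim_le: assumes "strong_lim u l" "\<forall>\<^sub>F n in sequentially. u n \<le> c" shows "l \<le> c"
proof (rule ccontr)
  assume "\<not> l \<le> c"
  then have "0 < l - c" by simp
  then have "\<forall>\<^sub>F n in sequentially. \<bar>u n - l\<bar> < l - c" using assms(1) by (auto simp: strong_lim_def)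
  with assms(2) have "\<forall>\<^sub>F n::nat in sequentially. False" by eventually_elim (auto simp: abs_less_iff)
  then show False by simp
qed

lemma strong_lim_uminus: "strong_lim u l \<Longrightarrow> strong_lim (\<lambda>n. - u n) (- l)"
  using strong_lim_cmult[of u l "- 1"] by simp

lemma strong_lim_diff: "strong_lim u l \<Longrightarrow> strong_lim v m \<Longrightarrow> strong_lim (\<lambda>n. u n - v n) (l - m)"
  using strong_lim_add[of u l "\<lambda>n. - v n" "- m"] strong_lim_uminus[of v m] by simp

lemma strong_lim_ge: assumes "strong_lim u l" "\<forall>\<^sub>F n in sequentially. c \<le> u n" shows "c \<le> l"
  using strong_lim_le[OF strong_lim_uminus[OF assms(1)], of "- c"] assms(2) by simp

lemma strong_lim_unique: assumes "strong_lim u l" "strong_lim u m" shows "l = m"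
proof -
  have z: "strong_lim (\<lambda>n. 0) (l - m)" using strong_lim_diff[OF assms] by simp
  have "l - m \<le> 0" by (rule strong_lim_le[OF z]) simp
  moreover have "0 \<le> l - m" by (rule strong_lim_ge[OF z]) simp
  ultimately show ?thesis by simp
qed

lemma strong_lim_monom: assumes "c \<noteq> 0" shows "strong_lim (\<lambda>n. lc_monom c (of_nat n)) 0"
  unfolding strong_lim_vge
proof
  fix R :: rat
  obtain N where "R \<le> of_nat N" using reals_Archimedean2[of R] less_imp_le by blast
  have "vge (lc_monom c (of_nat n) - 0) R" if "n \<ge> N" for n
  proof -
    have "(of_nat N :: rat) \<le> of_nat n" using that by simp
    then have "R \<le> of_nat n" using \<open>R \<le> of_nat N\<close> by (rule order_trans[rotated])
    then show ?thesis by (simp add: vge_monom)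
  qed
  then show "\<forall>\<^sub>F n in sequentially. vge (lc_monom c (of_nat n) - 0) R"
    unfolding eventually_sequentially by blast
qed

lemma strong_sums_add: "strong_sums u s \<Longrightarrow> strong_sums v t \<Longrightarrow> strong_sums (\<lambda>n. u n + v n) (s + t)"
  unfolding strong_sums_def sum.distrib by (rule strong_lim_add)

lemma strong_sums_diff: "strong_sums u s \<Longrightarrow> strong_sums v t \<Longrightarrow> strong_sums (\<lambda>n. u n - v n) (s - t)"
  unfolding strong_sums_def sum_subtractf by (rule strong_lim_diff)

lemma strong_sums_cmult: "strong_sums u s \<Longrightarrow> strong_sums (\<lambda>n. c * u n) (c * s)"
  unfolding strong_sums_def sum_distrib_left[symmetric] by (rule strong_lim_cmult)

lemma strong_sums_zero [simp]: "strong_sums (\<lambda>n. 0) 0"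
  by (simp add: strong_sums_def)

lemma strong_sums_sum: "(\<And>j. j \<in> S \<Longrightarrow> strong_sums (u j) (s j)) \<Longrightarrow>
    strong_sums (\<lambda>n. \<Sum>j\<in>S. u j n) (\<Sum>j\<in>S. s j)"
  by (induction S rule: infinite_finite_induct) (auto intro: strong_sums_add)

lemma strong_sums_null: assumes "strong_sums u s" shows "strong_lim u 0"
proof -
  have l: "strong_lim (\<lambda>n. \<Sum>k<n. u k) s" using assms by (simp add: strong_sums_def)
  then have "strong_lim (\<lambda>n. \<Sum>k<Suc n. u k) s"
    unfolding strong_lim_vge by (subst eventually_sequentially_Suc)
  from strong_lim_diff[OF this l] show ?thesis by simp
qed

lemma strong_sums_finite: assumes "\<And>n. n \<ge> N \<Longrightarrow> u n = 0" shows "strong_sums u (\<Sum>k<N. u k)"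
proof -
  have "(\<Sum>k<n. u k) = (\<Sum>k<N. u k)" if "n \<ge> N" for n
    using that assms by (intro sum.mono_neutral_right) auto
  then have "\<forall>\<^sub>F n in sequentially. (\<Sum>k<n. u k) = (\<Sum>k<N. u k)"
    unfolding eventually_sequentially by blast
  then show ?thesis unfolding strong_sums_def strong_lim_vge by (auto elim!: eventually_mono)
qed

text \<open>Ultrametric completeness: below any exponent R only finitely many terms contribute, so
  every coefficient of the partial sums is eventually constant.\<close>

lemma null_strong_sums: assumes "strong_lim u 0" shows "\<exists>s. strong_sums u s"
proof -
  have "\<forall>R. \<exists>N. \<forall>n\<ge>N. vge (u n) R" using assms by (simp add: strong_lim_vge eventually_sequentially)
  then obtain N where N: "\<And>R n. N R \<le> n \<Longrightarrow> vge (u n) R" by metis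
  define S where "S = (\<lambda>n. \<Sum>k<n. u k)"
  have S0: "lc_coeff (S n) q = lc_coeff (S (N R)) q" if "N R \<le> n" "q < R" for n R q
  proof -
    have "lc_coeff (S n) q = (\<Sum>k<N R. lc_coeff (u k) q)"
      unfolding S_def lc_coeff_sum using that N[of R] by (intro sum.mono_neutral_right) (auto simp: vge_def not_less)
    then show ?thesis by (simp add: S_def lc_coeff_sum)
  qed
  \<comment> \<open>Any bound R > q in place of \<open>q + 1\<close> gives the same value, as the
    next fact shows.\<close>
  define f where "f = (\<lambda>q. lc_coeff (S (N (q + 1))) q)"
  have f: "f q = lc_coeff (S n) q" if "N R \<le> n" "q < R" for q R n
  proof -
    let ?m = "max n (N (q+1))"
    have "f q = lc_coeff (S ?m) q" unfolding f_def by (rule S0[symmetric]) auto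
    also have "\<dots> = lc_coeff (S (N R)) q" by (rule S0) (use that in auto)
    also have "\<dots> = lc_coeff (S n) q" by (rule S0[symmetric]) (use that in auto)
    finally show ?thesis .
  qed
  have "finite {q. q \<le> Q \<and> f q \<noteq> 0}" for Q
  proof (rule finite_subset[OF _ lf_coeff[of Q "S (N (Q+1))"]], safe)
    fix q assume "q \<le> Q" "f q \<noteq> 0" "lc_coeff (S (N (Q+1))) q = 0"
    then show False using f[of "Q+1" "N (Q+1)" q] by simp
  qed
  then have c: "lc_coeff (Abs_levi_civita f) = f" by (rule lc_coeff_Abs)
  have "strong_lim S (Abs_levi_civita f)" unfolding strong_lim_vge eventually_sequentially
  proof (intro allI exI impI)
    fix R n assume "N R \<le> n"
    then show "vge (S n - Abs_levi_civita f) R" unfolding vge_def lc_coeff_minus c by (simp add: f)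
  qed
  then show ?thesis unfolding strong_sums_def S_def by blast
qed

lemma strong_sums_ge_partial:
  assumes "strong_sums u s" "\<And>n. 0 \<le> u n" shows "(\<Sum>k<n. u k) \<le> s"
proof -
  have "(\<Sum>k<n. u k) \<le> (\<Sum>k<m. u k)" if "n \<le> m" for m
    using that assms(2) by (intro sum_mono2) auto
  then have "\<forall>\<^sub>F m in sequentially. (\<Sum>k<n. u k) \<le> (\<Sum>k<m. u k)"
    unfolding eventually_sequentially by blast
  then show ?thesis using assms(1) unfolding strong_sums_def by (rule strong_lim_ge[rotated])
qed

lemma strong_sums_le: assumes "strong_sums u s" "strong_sums v t" "\<And>n. u n \<le> v n" shows "s \<le> t"
proof -
  have "0 \<le> t - s" using strong_sums_diff[OF assms(2,1)] unfolding strong_sums_def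
    by (rule strong_lim_ge) (intro always_eventually allI sum_nonneg, simp add: assms(3))
  then show ?thesis by simp
qed

lemma strong_sums_nonneg: assumes "strong_sums u s" "\<And>n. 0 \<le> u n" shows "0 \<le> s"
  using strong_sums_ge_partial[OF assms, of 0] by simp

lemma strong_lim_dominated:
  assumes "strong_lim v 0" "\<And>n. \<bar>u n\<bar> \<le> \<bar>v n\<bar>" shows "strong_lim u 0"
  unfolding strong_lim_vge
proof
  fix R
  have "\<forall>\<^sub>F n in sequentially. vge (v n - 0) R" using assms(1) by (simp only: strong_lim_vge)
  then show "\<forall>\<^sub>F n in sequentially. vge (u n - 0) R"
    by eventually_elim (use assms(2) vge_mono in auto)
qed

text \<open>Bounded increasing sequences need not converge in this field; the comparison works
  because dominated terms tend to 0 and \<open>null_strong_sums\<close> applies.\<close>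

lemma strong_sums_comparison:
  assumes "strong_sums v t" "\<And>n. 0 \<le> u n" "\<And>n. u n \<le> v n" shows "\<exists>s. strong_sums u s"
proof (rule null_strong_sums, rule strong_lim_dominated[OF strong_sums_null[OF assms(1)]])
  show "\<bar>u n\<bar> \<le> \<bar>v n\<bar>" for n using assms(2,3)[of n] by (simp add: abs_if)
qed

lemma strong_sums_unique: "strong_sums u s \<Longrightarrow> strong_sums u t \<Longrightarrow> s = t"
  unfolding strong_sums_def by (rule strong_lim_unique)

lemma strong_lim_subseq: assumes "strong_lim u l" "filterlim r at_top sequentially"
  shows "strong_lim (\<lambda>n. u (r n)) l"
  using assms unfolding strong_lim_def filterlim_iff by blast

section \<open>Weakly convergent power series\<close>

lemma weak_lim_eventually:
  assumes "weak_lim u l" "0 < \<epsilon>"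
  shows "\<forall>\<^sub>F n in sequentially. \<forall>q\<le>Q. \<bar>lc_coeff (u n - l) q\<bar> < \<epsilon>"
proof -
  \<comment> \<open>In \<open>weak_lim\<close> one real number bounds both the coefficients and,
    through its inverse, the range of exponents; \<delta> is small enough for that range to reach Q.
    The maximum with 1 keeps the inverse positive.\<close>
  define \<delta> where "\<delta> = min \<epsilon> (inverse (max 1 (real_of_rat Q)))"
  have \<delta>: "0 < \<delta>" "\<delta> \<le> \<epsilon>" "\<delta> \<le> inverse (max 1 (real_of_rat Q))" using assms(2) by (auto simp: \<delta>_def)
  have "max 1 (real_of_rat Q) \<le> inverse \<delta>" using le_imp_inverse_le[OF \<delta>(3,1)] by simp
  then have Q: "real_of_rat Q \<le> inverse \<delta>" by simp
  have "\<forall>\<^sub>F n in sequentially.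
     Max ((\<lambda>q. \<bar>lc_coeff (u n - l) q\<bar>) ` {q. real_of_rat q \<le> inverse \<delta>}) < \<delta>"
    using assms(1) \<delta>(1) by (simp add: weak_lim_def)
  then show ?thesis
  proof eventually_elim
    case (elim n)
    show ?case
    proof (intro allI impI)
      fix q assume "q \<le> Q"
      then have "real_of_rat q \<le> real_of_rat Q" by (simp add: of_rat_less_eq)
      then have "\<bar>lc_coeff (u n - l) q\<bar> \<in> (\<lambda>q. \<bar>lc_coeff (u n - l) q\<bar>) ` {q. real_of_rat q \<le> inverse \<delta>}"
        using Q by auto
      from Max_ge[OF finite_weak_lim_values(1) this] elim \<delta>(2)
      show "\<bar>lc_coeff (u n - l) q\<bar> < \<epsilon>" by linarith
    qed
  qed
qed

lemma weak_lim_coeff: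
  assumes "weak_lim u l" shows "(\<lambda>n. lc_coeff (u n) q) \<longlonglongrightarrow> lc_coeff l q"
proof (rule tendstoI)
  fix e :: real assume "0 < e"
  from weak_lim_eventually[OF assms this, of q]
  show "\<forall>\<^sub>F n in sequentially. dist (lc_coeff (u n) q) (lc_coeff l q) < e"
    by eventually_elim (auto simp: dist_real_def)
qed

lemma weak_lim_const [simp]: "weak_lim (\<lambda>n. l) l"
proof -
  have "(\<lambda>q. \<bar>lc_coeff (l - l) q\<bar>) ` {q. real_of_rat q \<le> r} = {0}" for r
    using finite_weak_lim_values(2)[of 0 r] by auto
  then show ?thesis by (simp add: weak_lim_def)
qed

lemma weak_lim_add_const: "weak_lim u l \<Longrightarrow> weak_lim (\<lambda>n. u n + c) (l + c)"
  by (simp add: weak_lim_def)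

lemma weak_sums_terms:
  assumes "weak_sums u s" "0 < \<epsilon>"
  shows "\<forall>\<^sub>F k in sequentially. \<forall>q\<le>Q. \<bar>lc_coeff (u k) q\<bar> < \<epsilon>"
proof -
  have "\<forall>\<^sub>F n in sequentially. \<forall>q\<le>Q. \<bar>lc_coeff ((\<Sum>k\<le>n. u k) - s) q\<bar> < \<epsilon> / 2"
    using assms by (intro weak_lim_eventually) (auto simp: weak_sums_def)
  then obtain N where N: "\<And>n q. n \<ge> N \<Longrightarrow> q \<le> Q \<Longrightarrow> \<bar>lc_coeff ((\<Sum>k\<le>n. u k) - s) q\<bar> < \<epsilon> / 2"
    unfolding eventually_sequentially by blast
  have "\<bar>lc_coeff (u n) q\<bar> < \<epsilon>" if "n \<ge> Suc N" "q \<le> Q" for n q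
  proof -
    define m where "m = n - 1"
    have m: "n = Suc m" "m \<ge> N" using that(1) by (auto simp: m_def)
    have "lc_coeff (u n) q = lc_coeff ((\<Sum>k\<le>n. u k) - s) q - lc_coeff ((\<Sum>k\<le>m. u k) - s) q"
      by (simp add: m lc_coeff_sum)
    then show ?thesis using N[of n q] N[of m q] m that by linarith
  qed
  then show ?thesis unfolding eventually_sequentially by blast
qed

lemma weak_sums_const:
  "weak_sums (\<lambda>k. (if k = 0 then c else 0) * (x - x\<^sub>0) ^ k) c"
proof -
  have "(\<Sum>k\<le>K. (if k = 0 then c else 0) * (x - x\<^sub>0) ^ k) = c" for K
  proof -
    have "(\<Sum>k\<le>K. (if k = 0 then c else 0) * (x - x\<^sub>0) ^ k) = (\<Sum>k\<in>{0}. (if k = 0 then c else 0) * (x - x\<^sub>0) ^ k)"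
      by (rule sum.mono_neutral_right) auto
    then show ?thesis by simp
  qed
  then show ?thesis by (simp add: weak_sums_def)
qed

lemma vge_finite: "finite S \<Longrightarrow> \<exists>L. \<forall>k\<in>S. vge (f k) L"
proof (induction S rule: finite_induct)
  case (insert k S)
  then obtain L where "\<forall>k\<in>S. vge (f k) L" by blast
  moreover obtain M where "vge (f k) M" using vge_ex by blast
  ultimately show ?case by (intro exI[of _ "min L M"]) (auto intro: vge_weaken)
qed auto

lemma coeff_power_unit: "vge A 0 \<Longrightarrow> lc_coeff A 0 = 1 \<Longrightarrow> lc_coeff (A ^ n) 0 = 1"
proof (induction n)
  case (Suc n)
  then show ?case using coeff_times_lead[of A 0 "A ^ n" 0] vge_power0[of A n] by simp
qed (simp add: lc_coeff_one)

lemma vge_1 [simp]: "vge 1 0"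
  by (simp add: vge_def lc_coeff_one)

text \<open>
  A gliding hump: if the coefficients had unbounded valuations, one could build term by term a point
  \<open>1 + u\<close>, with very large real coefficients in \<open>u\<close>, at which infinitely many terms of the series
  have a coefficient \<open>1\<close> at a negative exponent.
\<close>

lemma power_series_coeffs_bounded:
  assumes "0 < R"
    and T: "\<And>u. vge u R \<Longrightarrow> \<forall>\<^sub>F k in sequentially. \<forall>q\<le>0. \<bar>lc_coeff (b k * (1 + u) ^ k) q\<bar> < 1"
  shows "\<exists>L. \<forall>k. vge (b k) L"
proof (rule ccontr)
  assume neg: "\<not> ?thesis"
  have inf: "\<exists>k\<ge>N. \<not> vge (b k) L" for N L
  proof (rule ccontr)
    assume a: "\<not> (\<exists>k\<ge>N. \<not> vge (b k) L)"
    obtain M where M: "\<forall>k\<in>{..<N}. vge (b k) M" using vge_finite[of "{..<N}" b] by auto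
    have "vge (b k) (min L M)" for k
      using a M by (cases "k < N") (auto intro: vge_weaken simp: not_less)
    then show False using neg by blast
  qed
  \<comment> \<open>The correction number i sits at exponent \<open>r i\<close>. As these exponents
    tend to infinity, the corrections sum strongly, and later ones leave the coefficient at
    \<open>r i\<close> alone.\<close>
  define r where "r i = R + of_nat i" for i
  \<comment> \<open>\<open>Suc i\<close> makes the indices unbounded and also positive, so that
    \<open>tt\<close> may divide by them.\<close>
  have "\<forall>i. \<exists>k. k \<ge> Suc i \<and> \<not> vge (b k) (- r i)" using inf by blast
  then obtain kap where kap: "\<And>i. kap i \<ge> Suc i" "\<And>i. \<not> vge (b (kap i)) (- r i)" by metis
  have nz: "b (kap i) \<noteq> 0" for i using kap(2)[of i] by auto
  define v where "v i = lc_val (b (kap i))" for i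
  have v: "v i < - r i" for i using kap(2)[of i] vge_val_iff[OF nz[of i]] by (simp add: v_def)
  define lam where "lam i = lc_coeff (b (kap i)) (v i)" for i
  have lam: "lam i \<noteq> 0" for i unfolding lam_def v_def using lc_coeff_val(1)[OF nz] .
  \<comment> \<open>A monomial with coefficient \<open>tt i u\<close> at exponent \<open>r i\<close>
    moves the coefficient at \<open>v i + r i\<close> by
    \<open>lam i * real (kap i) * tt i u\<close>, the linear term of the power; the value is chosen
    to make the result 1.\<close>
  define tt where "tt i u = (1 - lc_coeff (b (kap i) * (1 + u) ^ kap i) (v i + r i)) / (lam i * real (kap i))" for i u
  define U where "U = rec_nat 0 (\<lambda>i u. u + lc_monom (tt i u) (r i))"
  have U0: "U 0 = 0" and US: "U (Suc i) = U i + lc_monom (tt i (U i)) (r i)" for i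
    by (simp_all add: U_def)
  have Usum: "U n = (\<Sum>i<n. lc_monom (tt i (U i)) (r i))" for n
    by (induction n) (simp_all add: U0 US)
  have Udiff: "vge (U (j + n) - U j) (r j)" for j n
  proof (induction n)
    case (Suc n)
    have "vge (lc_monom (tt (j+n) (U (j+n))) (r (j+n))) (r j)" by (rule vge_monom) (simp add: r_def)
    from vge_add[OF Suc this] show ?case by (simp add: US algebra_simps)
  qed simp
  have "strong_lim (\<lambda>i. lc_monom (tt i (U i)) (r i)) 0" unfolding strong_lim_vge
  proof
    fix Q :: rat
    obtain N where N: "Q - R < of_nat N" using reals_Archimedean2 by blast
    have "vge (lc_monom (tt i (U i)) (r i) - 0) Q" if "i \<ge> N" for i
    proof -
      have "(of_nat N :: rat) \<le> of_nat i" using that by simp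
      then have "Q \<le> r i" using N unfolding r_def by linarith
      then show ?thesis by (simp add: vge_monom)
    qed
    then show "\<forall>\<^sub>F i in sequentially. vge (lc_monom (tt i (U i)) (r i) - 0) Q"
      unfolding eventually_sequentially by blast
  qed
  then obtain u where "strong_sums (\<lambda>i. lc_monom (tt i (U i)) (r i)) u" using null_strong_sums by blast
  then have Ulim: "strong_lim U u" by (simp add: strong_sums_def Usum[symmetric])
  have uU: "vge (u - U j) (r j)" for j
  proof -
    have "\<forall>\<^sub>F n in sequentially. vge (U n - u) (r j)" using Ulim by (simp add: strong_lim_vge)
    then obtain N where N: "\<And>n. n \<ge> N \<Longrightarrow> vge (U n - u) (r j)" by (auto simp: eventually_sequentially)
    from vge_diff[OF Udiff[of j N] N[of "j + N"]] show ?thesis by simp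
  qed
  have cu: "lc_coeff (u - U i) (r i) = tt i (U i)" for i
  proof -
    have "lc_coeff (u - U (Suc i)) (r i) = 0" using uU[of "Suc i"] by (rule vgeD) (simp add: r_def)
    then show ?thesis by (simp add: US lc_coeff_monom)
  qed
  have vu: "vge u R" using uU[of 0] by (simp add: U0 r_def)
  have one: "lc_coeff (b (kap i) * (1 + u) ^ kap i) (v i + r i) = 1" for i
  proof -
    let ?k = "kap i" and ?A = "1 + U i"
    have vU: "vge (U i) R" using Udiff[of 0 i] by (simp add: U0 r_def)
    have A: "vge ?A 0" "lc_coeff ?A 0 = 1" using vU \<open>0 < R\<close> vge_weaken[OF vU, of 0]
      by (auto intro!: vge_add simp: lc_coeff_one vgeD)
    have B: "vge (1 + u) 0" "lc_coeff (1 + u) 0 = 1" using vu \<open>0 < R\<close> vge_weaken[OF vu, of 0]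
      by (auto intro!: vge_add simp: lc_coeff_one vgeD)
    \<comment> \<open>S is the quotient of the difference of the two powers by
      \<open>u - U i\<close>. Its terms all have coefficient 1 at exponent 0, so its leading
      coefficient is \<open>?k\<close>, and at \<open>v i + r i\<close> only the leading part of
      \<open>u - U i\<close> enters.\<close>
    define S where "S = (\<Sum>j<?k. ?A ^ (?k - Suc j) * (1 + u) ^ j)"
    have vS: "vge S 0" unfolding S_def
      by (intro vge_sum) (use vge_mult[OF vge_power0[OF A(1)] vge_power0[OF B(1)]] in simp)
    have cS: "lc_coeff S 0 = real ?k"
    proof -
      have "lc_coeff (?A ^ m * (1 + u) ^ j) 0 = 1" for m j
        using coeff_times_lead[OF vge_power0[OF A(1)] vge_power0[OF B(1)], of m j]
          coeff_power_unit[OF A] coeff_power_unit[OF B] by simp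
      then show ?thesis by (simp add: S_def lc_coeff_sum)
    qed
    have "(1 + u) ^ ?k - ?A ^ ?k = (1 + u - ?A) * S" unfolding S_def by (rule power_diff_sumr2)
    then have "(1 + u) ^ ?k = ?A ^ ?k + (u - U i) * S" by (simp add: algebra_simps)
    then have e: "b ?k * (1 + u) ^ ?k = b ?k * ?A ^ ?k + b ?k * ((u - U i) * S)"
      by (simp only: distrib_left)
    have "lc_coeff ((u - U i) * S) (r i + 0) = tt i (U i) * real ?k"
      using coeff_times_lead[OF uU vS] cu cS by simp
    moreover have "vge ((u - U i) * S) (r i + 0)" by (rule vge_mult[OF uU vS])
    moreover have "vge (b ?k) (v i)" unfolding v_def by (rule vge_val[OF nz])
    ultimately have "lc_coeff (b ?k * ((u - U i) * S)) (v i + r i) = lam i * (tt i (U i) * real ?k)"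
      using coeff_times_lead[of "b ?k" "v i" "(u - U i) * S" "r i"] by (simp add: lam_def)
    also have "\<dots> = 1 - lc_coeff (b ?k * ?A ^ ?k) (v i + r i)"
      using lam[of i] kap(1)[of i] by (simp add: tt_def)
    finally show ?thesis by (simp add: e)
  qed
  obtain N where N: "\<And>k q. k \<ge> N \<Longrightarrow> q \<le> 0 \<Longrightarrow> \<bar>lc_coeff (b k * (1 + u) ^ k) q\<bar> < 1"
    using T[OF vu] unfolding eventually_sequentially by blast
  have "kap N \<ge> N" "v N + r N \<le> 0" using kap(1)[of N] v[of N] by auto
  from N[OF this] one[of N] show False by simp
qed

text \<open>After scaling by w, the coefficients have a common bound on their valuations and the
  variable is bounded by 2. The bound comes from \<open>power_series_coeffs_bounded\<close> at an
  interior point \<open>z\<^sub>0\<close>: multiplying \<open>z\<^sub>0 - x\<^sub>0\<close> by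
  \<open>1 + u\<close> with u small stays inside the interval.\<close>

lemma power_series_normal_form:
  assumes "x < y" and S: "\<And>z. z \<in> {x..y} \<Longrightarrow> weak_sums (\<lambda>k. a k * (z - x\<^sub>0) ^ k) (f z)"
  obtains w L where "0 < w" "\<And>k. vge (a k * w ^ k) L" "\<And>z. z \<in> {x..y} \<Longrightarrow> \<bar>z - x\<^sub>0\<bar> \<le> 2 * w"
proof -
  define e where "e = (y - x) / 4"
  have "4 * e = y - x" by (simp add: e_def)
  then have e: "0 < e" "y = x + 4 * e" using assms(1) by (auto simp: e_def algebra_simps)
  \<comment> \<open>The point is one quarter of the length away from the endpoint farther from
    \<open>x\<^sub>0\<close>. That endpoint has distance at least \<open>2 * e\<close> from
    \<open>x\<^sub>0\<close>, so moving in by e at most halves the distance; hence the factor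
    2.\<close>
  define z\<^sub>0 where "z\<^sub>0 = (if \<bar>x - x\<^sub>0\<bar> \<le> \<bar>y - x\<^sub>0\<bar> then y - e else x + e)"
  define W where "W = z\<^sub>0 - x\<^sub>0"
  have W: "0 < \<bar>W\<bar>" "\<bar>x - x\<^sub>0\<bar> \<le> 2 * \<bar>W\<bar>" "\<bar>y - x\<^sub>0\<bar> \<le> 2 * \<bar>W\<bar>"
    using e unfolding W_def z\<^sub>0_def by (auto simp: abs_if split: if_splits)
  obtain R where R: "\<And>u. vge u R \<Longrightarrow> \<bar>u\<bar> < e / \<bar>W\<bar>" using eps_vge[of "e / \<bar>W\<bar>"] e W(1) by auto
  define R' where "R' = max R 1"
  have "\<exists>L. \<forall>k. vge (a k * W ^ k) L"
  proof (rule power_series_coeffs_bounded[where R = R'])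
    fix u assume "vge u R'"
    then have "vge u R" by (rule vge_weaken) (simp add: R'_def)
    then have "\<bar>u\<bar> * \<bar>W\<bar> < e" using R[of u] W(1) by (simp add: field_simps)
    then have "\<bar>W * u\<bar> < e" by (simp add: abs_mult mult.commute)
    then have "x\<^sub>0 + W * (1 + u) \<in> {x..y}"
      using e unfolding W_def z\<^sub>0_def by (auto simp: algebra_simps abs_less_iff split: if_splits)
    from weak_sums_terms[OF S[OF this], of 1 0]
    show "\<forall>\<^sub>F k in sequentially. \<forall>q\<le>0. \<bar>lc_coeff (a k * W ^ k * (1 + u) ^ k) q\<bar> < 1"
      by (simp add: power_mult_distrib mult.assoc)
  qed (simp add: R'_def)
  then obtain L where L: "\<And>k. vge (a k * W ^ k) L" by blast
  show ?thesis
  proof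
    show "0 < \<bar>W\<bar>" by (rule W(1))
    fix k
    have "\<bar>a k * \<bar>W\<bar> ^ k\<bar> = \<bar>a k * W ^ k\<bar>" by (simp add: abs_mult power_abs)
    then show "vge (a k * \<bar>W\<bar> ^ k) L" using L[of k] by (metis vge_abs)
  next
    fix z assume "z \<in> {x..y}"
    then show "\<bar>z - x\<^sub>0\<bar> \<le> 2 * \<bar>W\<bar>" using W(2,3) by (auto simp: abs_le_iff)
  qed
qed

lemma vge_real [simp]: "vge (lc_real c) 0"
  by (rule vge_monom) simp

lemma vge_0_bounded: "\<bar>c\<bar> \<le> of_nat n \<Longrightarrow> vge c 0"
  by (rule vge_mono[of _ "of_nat n"]) (auto simp: of_nat_lc)

lemma vge_weak_lim: "weak_lim u l \<Longrightarrow> (\<And>n. vge (u n) L) \<Longrightarrow> vge l L"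
  unfolding vge_def
proof (intro allI impI)
  fix q assume a: "weak_lim u l" "\<And>n. \<forall>q<L. lc_coeff (u n) q = 0" "q < L"
  from weak_lim_coeff[OF a(1), of q] a(2,3) show "lc_coeff l q = 0" by (simp add: LIMSEQ_const_iff)
qed

lemma vge_power_diff: "vge c 0 \<Longrightarrow> vge d 0 \<Longrightarrow> vge (c - d) r \<Longrightarrow> vge (c ^ k - d ^ k) r"
proof -
  assume a: "vge c 0" "vge d 0" "vge (c - d) r"
  have "vge (\<Sum>i<k. d ^ (k - Suc i) * c ^ i) 0"
    using vge_mult[OF vge_power0[OF a(2)] vge_power0[OF a(1)]] by (intro vge_sum) simp
  from vge_mult[OF a(3) this] show ?thesis by (simp add: power_diff_sumr2)
qed

lemma weak_sums_diff_vge: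
  assumes "weak_sums u s" "weak_sums v t" "\<And>k. vge (u k - v k) L" shows "vge (s - t) L"
  unfolding vge_def
proof (intro allI impI)
  fix q assume q: "q < L"
  have "(\<lambda>K. lc_coeff (\<Sum>k\<le>K. u k) q - lc_coeff (\<Sum>k\<le>K. v k) q) \<longlonglongrightarrow> lc_coeff s q - lc_coeff t q"
    using assms(1,2) by (intro tendsto_diff weak_lim_coeff) (auto simp: weak_sums_def)
  moreover have "lc_coeff (\<Sum>k\<le>K. u k) q - lc_coeff (\<Sum>k\<le>K. v k) q = 0" for K
    using assms(3) q by (simp add: lc_coeff_sum vge_def flip: sum_subtractf)
  ultimately show "lc_coeff (s - t) q = 0" by (simp add: LIMSEQ_const_iff)
qed

text \<open>In the normalised variable a difference of k-th powers has at least the valuation of the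
  difference of the bases, for all k at once. With the bound L on the coefficients all terms change
  by a valuation of at least R, and the weak sums inherit this.\<close>

lemma simple_uniformly_continuous:
  assumes "x < y" "simple_on I f" "{x..y} \<subseteq> I" "0 < \<epsilon>"
  obtains \<delta> where "0 < \<delta>" "\<And>z z'. z \<in> {x..y} \<Longrightarrow> z' \<in> {x..y} \<Longrightarrow> \<bar>z - z'\<bar> < \<delta> \<Longrightarrow> \<bar>f z - f z'\<bar> < \<epsilon>"
proof -
  obtain x\<^sub>0 a where S: "\<And>z. z \<in> {x..y} \<Longrightarrow> weak_sums (\<lambda>k. a k * (z - x\<^sub>0) ^ k) (f z)"
    using assms(2,3) unfolding simple_on_def by blast
  obtain w L where w: "0 < w" and L: "\<And>k. vge (a k * w ^ k) L"
    and b: "\<And>z. z \<in> {x..y} \<Longrightarrow> \<bar>z - x\<^sub>0\<bar> \<le> 2 * w"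
    using power_series_normal_form[OF assms(1) S] by blast
  have c: "vge ((z - x\<^sub>0) / w) 0" if "z \<in> {x..y}" for z
    by (rule vge_0_bounded[of _ 2]) (use b[OF that] w in \<open>simp add: field_simps\<close>)
  obtain R where R: "\<And>u. vge u R \<Longrightarrow> \<bar>u\<bar> < \<epsilon>" using eps_vge[OF assms(4)] by blast
  show ?thesis
  proof
    show "0 < w * lc_monom 1 (R - L)" using w by simp
    fix z z' assume z: "z \<in> {x..y}" "z' \<in> {x..y}" "\<bar>z - z'\<bar> < w * lc_monom 1 (R - L)"
    then have "\<bar>(z - z') / w\<bar> < lc_monom 1 (R - L)" using w by (simp add: field_simps)
    then have "vge ((z - z') / w) (R - L)" by (rule less_monom_vge)
    then have "vge ((z - x\<^sub>0) / w - (z' - x\<^sub>0) / w) (R - L)" by (simp add: diff_divide_distrib)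
    from vge_power_diff[OF c[OF z(1)] c[OF z(2)] this]
    have "vge (a k * w ^ k * (((z - x\<^sub>0) / w) ^ k - ((z' - x\<^sub>0) / w) ^ k)) (L + (R - L))" for k
      using L by (intro vge_mult)
    then have "vge (a k * (z - x\<^sub>0) ^ k - a k * (z' - x\<^sub>0) ^ k) R" for k
      using w by (simp add: power_divide right_diff_distrib)
    then show "\<bar>f z - f z'\<bar> < \<epsilon>" using weak_sums_diff_vge[OF S[OF z(1)] S[OF z(2)]] R by blast
  qed
qed

section \<open>Real power series and polynomials\<close>

lemma real_strict_increase:
  fixes \<phi> :: "real \<Rightarrow> real"
  assumes "continuous_on {a..b} \<phi>"
    and d: "\<And>t. a < t \<Longrightarrow> t < b \<Longrightarrow> (\<phi> has_real_derivative \<psi> t) (at t)"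
    and n: "\<And>t. a < t \<Longrightarrow> t < b \<Longrightarrow> 0 \<le> \<psi> t"
    and s: "a < s" "s < b" "0 < \<psi> s"
  shows "\<phi> a < \<phi> b"
proof -
  have mono: "\<phi> u \<le> \<phi> v" if "a \<le> u" "u \<le> v" "v \<le> b" for u v
  proof (rule DERIV_nonneg_imp_increasing_open[OF that(2)])
    fix t assume "u < t" "t < v"
    then have "a < t" "t < b" using that by auto
    then show "\<exists>y. (\<phi> has_real_derivative y) (at t) \<and> 0 \<le> y" using d n by blast
  next
    show "continuous_on {u..v} \<phi>" using assms(1) by (rule continuous_on_subset) (use that in auto)
  qed
  obtain e where e: "e > 0" "\<And>h. 0 < h \<Longrightarrow> h < e \<Longrightarrow> \<phi> s < \<phi> (s + h)"
    using DERIV_pos_inc_right[OF d[OF s(1,2)] s(3)] by blast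
  define h where "h = min (e / 2) (b - s)"
  have h: "0 < h" "h < e" "s + h \<le> b" using e s by (auto simp: h_def min_def)
  have "\<phi> a \<le> \<phi> s" "\<phi> (s + h) \<le> \<phi> b" using mono[of a s] mono[of "s + h" b] s h by auto
  then show ?thesis using e(2)[OF h(1,2)] by linarith
qed

text \<open>Summation by parts. The induction carries a sharper estimate, for the distance to the
  unweighted sum times \<open>s ^ n\<close>, because its bounds
  \<open>C * (s ^ n - s ^ Suc n)\<close> telescope.\<close>

lemma real_abel_bound:
  fixes \<gamma> :: "nat \<Rightarrow> real"
  assumes C: "\<And>n. \<bar>\<Sum>k<n. \<gamma> k\<bar> \<le> C" and s: "0 \<le> s" "s \<le> 1"
  shows "\<bar>\<Sum>k<n. \<gamma> k * s ^ k\<bar> \<le> C"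
proof -
  have "\<bar>(\<Sum>k<n. \<gamma> k * s ^ k) - (\<Sum>k<n. \<gamma> k) * s ^ n\<bar> \<le> C * (1 - s ^ n)"
  proof (induction n)
    case (Suc n)
    have "\<bar>(\<Sum>k<Suc n. \<gamma> k) * (s ^ n - s ^ Suc n)\<bar> \<le> C * (s ^ n - s ^ Suc n)"
      unfolding abs_mult using s power_decreasing[of n "Suc n" s] C[of "Suc n"]
      by (intro mult_mono) auto
    moreover have "(\<Sum>k<Suc n. \<gamma> k * s ^ k) - (\<Sum>k<Suc n. \<gamma> k) * s ^ Suc n =
        ((\<Sum>k<n. \<gamma> k * s ^ k) - (\<Sum>k<n. \<gamma> k) * s ^ n) + (\<Sum>k<Suc n. \<gamma> k) * (s ^ n - s ^ Suc n)"
      by (simp add: algebra_simps)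
    moreover have "C * (1 - s ^ Suc n) = C * (1 - s ^ n) + C * (s ^ n - s ^ Suc n)"
      by (simp add: algebra_simps)
    ultimately show ?case using Suc by linarith
  qed simp
  moreover have "\<bar>(\<Sum>k<n. \<gamma> k) * s ^ n\<bar> \<le> C * s ^ n"
    unfolding abs_mult using C[of n] s by (intro mult_mono) auto
  ultimately show ?thesis by (simp add: algebra_simps)
qed

lemma real_abel_continuous:
  fixes \<gamma> :: "nat \<Rightarrow> real"
  assumes "summable (\<lambda>k. \<gamma> k * e ^ k)"
  shows "continuous_on (closed_segment 0 e) (\<lambda>s. \<Sum>k. \<gamma> k * s ^ k)"
proof (cases "e = 0")
  case False
  \<comment> \<open>The endpoint e is scaled to 1. Convergence there may be conditional, but
    \<open>real_abel_bound\<close> turns small tails at 1 into uniformly small tails on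
    [0, 1].\<close>
  define f where "f n s = (\<Sum>k<n. (\<gamma> k * e ^ k) * s ^ k)" for n s
  have "uniformly_Cauchy_on {0..1} f"
  proof (rule uniformly_Cauchy_onI')
    fix \<epsilon> :: real assume \<epsilon>: "0 < \<epsilon>"
    then have "0 < \<epsilon> / 2" by simp
    then obtain M where M: "\<And>m n. m \<ge> M \<Longrightarrow> \<bar>\<Sum>k\<in>{m..<n}. \<gamma> k * e ^ k\<bar> < \<epsilon> / 2"
      using assms unfolding summable_Cauchy real_norm_def by blast
    have "dist (f m s) (f n s) < \<epsilon>" if s: "s \<in> {0..1}" and mn: "m \<ge> M" "n > m" for s m n
    proof -
      have shift: "(\<Sum>k\<in>{m..<m + i}. h k) = (\<Sum>k<i. h (k + m))" for h :: "nat \<Rightarrow> real" and i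
        using sum.shift_bounds_nat_ivl[of h 0 m i] by (simp add: lessThan_atLeast0 add.commute)
      have "f n s - f m s = (\<Sum>k\<in>{m..<m + (n - m)}. (\<gamma> k * e ^ k) * s ^ k)"
        using mn(2) by (simp add: f_def lessThan_atLeast0 sum_diff_nat_ivl)
      also have "\<dots> = s ^ m * (\<Sum>k<n - m. (\<gamma> (k + m) * e ^ (k + m)) * s ^ k)"
        unfolding shift by (simp add: sum_distrib_left power_add mult_ac)
      finally have "\<bar>f n s - f m s\<bar> = s ^ m * \<bar>\<Sum>k<n - m. (\<gamma> (k + m) * e ^ (k + m)) * s ^ k\<bar>"
        using s by (simp add: abs_mult)
      also have "\<dots> \<le> 1 * (\<epsilon> / 2)"
      proof (intro mult_mono real_abel_bound)
        show "\<bar>\<Sum>k<i. \<gamma> (k + m) * e ^ (k + m)\<bar> \<le> \<epsilon> / 2" for i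
          using M[OF mn(1), of "m + i"] unfolding shift by simp
      qed (use s in \<open>auto intro: power_le_one\<close>)
      finally show ?thesis using \<epsilon> by (simp add: dist_real_def abs_minus_commute)
    qed
    then show "\<exists>M. \<forall>x\<in>{0..1}. \<forall>m\<ge>M. \<forall>n>m. dist (f m x) (f n x) < \<epsilon>" by blast
  qed
  then have "uniform_limit {0..1} f (\<lambda>s. lim (\<lambda>n. f n s)) sequentially"
    using Cauchy_uniformly_convergent uniformly_convergent_uniform_limit_iff by blast
  then have c: "continuous_on {0..1} (\<lambda>s. lim (\<lambda>n. f n s))"
    by (rule uniform_limit_theorem[rotated])
      (auto simp: f_def intro!: always_eventually continuous_intros)
  have "continuous_on (closed_segment 0 e) (\<lambda>s. lim (\<lambda>n. f n (s / e)))"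
  proof (rule continuous_on_compose2[OF c])
    show "continuous_on (closed_segment 0 e) (\<lambda>s. s / e)" by (intro continuous_intros) (use False in auto)
    show "(\<lambda>s. s / e) ` closed_segment 0 e \<subseteq> {0..1}"
      using False by (auto simp: closed_segment_def)
  qed
  moreover have "lim (\<lambda>n. f n (s / e)) = (\<Sum>k. \<gamma> k * s ^ k)" for s
    using False by (simp add: f_def power_divide suminf_eq_lim)
  ultimately show ?thesis by simp
qed simp

lemma real_powser_continuous_on_interval:
  fixes \<gamma> :: "nat \<Rightarrow> real"
  assumes "a < b" "summable (\<lambda>k. \<gamma> k * a ^ k)" "summable (\<lambda>k. \<gamma> k * b ^ k)"
  shows "continuous_on {a..b} (\<lambda>s. \<Sum>k. \<gamma> k * s ^ k)"
proof -
  have "{a..b} \<subseteq> closed_segment 0 a \<union> closed_segment 0 b"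
    by (auto simp: closed_segment_eq_real_ivl)
  then show ?thesis
    using continuous_on_closed_Un[OF closed_segment closed_segment
        real_abel_continuous[OF assms(2)] real_abel_continuous[OF assms(3)]] continuous_on_subset by blast
qed

lemma real_powser_antiderivative_less:
  fixes \<beta> :: "nat \<Rightarrow> real"
  assumes "a < b"
    and Sa: "(\<lambda>k. \<beta> k / real (Suc k) * a ^ Suc k) sums A" and Sb: "(\<lambda>k. \<beta> k / real (Suc k) * b ^ Suc k) sums B"
    and n: "\<And>s. a < s \<Longrightarrow> s < b \<Longrightarrow> 0 \<le> (\<Sum>k. \<beta> k * s ^ k)"
    and s: "a < s" "s < b" "0 < (\<Sum>k. \<beta> k * s ^ k)"
  shows "A < B"
proof -
  \<comment> \<open>The antiderivative as a power series without index shift, so that its formal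
    derivative \<open>diffs \<gamma>\<close> is \<beta>.\<close>
  define \<gamma> where "\<gamma> k = (if k = 0 then 0 else \<beta> (k - 1) / real k)" for k
  have ss: "(\<lambda>k. \<gamma> k * c ^ k) sums C" if "(\<lambda>k. \<beta> k / real (Suc k) * c ^ Suc k) sums C" for c C
    using sums_Suc_iff[of "\<lambda>k. \<gamma> k * c ^ k" C] that by (simp add: \<gamma>_def)
  note SA = ss[OF Sa] and SB = ss[OF Sb]
  \<comment> \<open>Convergence at the endpoint of larger modulus makes the series differentiable at
    every point strictly between a and b.\<close>
  define K where "K = (if \<bar>a\<bar> \<le> \<bar>b\<bar> then b else a)"
  have K: "summable (\<lambda>k. \<gamma> k * K ^ k)" "\<bar>a\<bar> \<le> \<bar>K\<bar>" "\<bar>b\<bar> \<le> \<bar>K\<bar>"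
    using SA SB sums_summable by (auto simp: K_def)
  have "diffs \<gamma> = \<beta>" by (auto simp: diffs_def \<gamma>_def fun_eq_iff)
  then have d: "((\<lambda>s. \<Sum>k. \<gamma> k * s ^ k) has_real_derivative (\<Sum>k. \<beta> k * t ^ k)) (at t)" if "a < t" "t < b" for t
    using termdiffs_strong[OF K(1), of t] that K(2,3) by (auto simp: abs_if split: if_splits)
  have "(\<Sum>k. \<gamma> k * a ^ k) < (\<Sum>k. \<gamma> k * b ^ k)"
    by (rule real_strict_increase[OF _ d n s])
       (rule real_powser_continuous_on_interval[OF assms(1) sums_summable[OF SA] sums_summable[OF SB]])
  then show ?thesis using SA SB by (simp add: sums_iff)
qed

text \<open>Identity theorem: infinitely many zeros in a compact disc force the complex series to be
  constant, hence 0, and then all its coefficients vanish.\<close>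

lemma real_powser_finite_zeros:
  fixes \<beta> :: "nat \<Rightarrow> real"
  assumes S: "\<And>s. \<bar>s\<bar> < R \<Longrightarrow> summable (\<lambda>k. \<beta> k * s ^ k)" and nz: "\<exists>k. \<beta> k \<noteq> 0" and r: "r < R"
  shows "finite {s. \<bar>s\<bar> \<le> r \<and> (\<Sum>k. \<beta> k * s ^ k) = 0}" (is "finite ?Z")
proof (rule ccontr)
  assume inf: "infinite ?Z"
  then obtain s\<^sub>0 where s\<^sub>0: "s\<^sub>0 \<in> ?Z" by (metis equals0I finite.emptyI)
  then have R: "0 < R" using r by auto
  define H where "H z = (\<Sum>k. complex_of_real (\<beta> k) * z ^ k)" for z
  have sums: "(\<lambda>k. complex_of_real (\<beta> k) * (z - 0) ^ k) sums H z" if "z \<in> ball 0 R" for z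
  proof -
    have "cmod z < R" using that by simp
    then obtain s where s: "cmod z < s" "s < R" using dense by blast
    then have "0 \<le> s" using norm_ge_zero[of z] by linarith
    have "summable (\<lambda>k. complex_of_real (\<beta> k * s ^ k))"
      using S[of s] s \<open>0 \<le> s\<close> by (intro summable_of_real) auto
    then have "summable (\<lambda>k. complex_of_real (\<beta> k) * z ^ k)"
      using powser_inside[of "\<lambda>k. complex_of_real (\<beta> k)" "complex_of_real s" z] s \<open>0 \<le> s\<close> by simp
    then show ?thesis by (simp add: H_def summable_sums)
  qed
  have re: "H (of_real s) = of_real (\<Sum>k. \<beta> k * s ^ k)" if "\<bar>s\<bar> \<le> r" for s
    unfolding H_def using suminf_of_real[OF S, of s, where ?'a = complex] that r by simp
  have "complex_of_real ` ?Z \<subseteq> {z \<in> cball 0 r. H z = 0}" using re by auto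
  moreover have "infinite (complex_of_real ` ?Z)" using inf by (simp add: finite_image_iff inj_on_def)
  ultimately have "infinite {z \<in> cball 0 r. H z = 0}" using finite_subset by blast
  moreover have "cball 0 r \<subseteq> ball 0 R" using r by auto
  ultimately have "H constant_on ball 0 R"
    using holomorphic_compact_finite_zeros[OF power_series_holomorphic[OF sums] open_ball connected_ball compact_cball] by blast
  then obtain c where c: "\<And>z. z \<in> ball 0 R \<Longrightarrow> H z = c" unfolding constant_on_def by blast
  have "c = 0" using c[of "of_real s\<^sub>0"] re[of s\<^sub>0] s\<^sub>0 r by simp
  have "complex_of_real (\<beta> 0) = 0" using c[of 0] R \<open>c = 0\<close> powser_zero[of "\<lambda>k. complex_of_real (\<beta> k)"] by (simp add: H_def)
  then obtain m where "m > 0" "complex_of_real (\<beta> m) \<noteq> 0" using nz by (metis gr0I of_real_eq_0_iff)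
  moreover have "(\<lambda>k. complex_of_real (\<beta> k) * (z - 0) ^ k) sums 0" if "norm (z - 0) < R" for z
    using sums[of z] c[of z] \<open>c = 0\<close> that by simp
  \<comment> \<open>\<open>powser_0_nonzero\<close> is applied to the zero function as sum of a
    series with a nonzero coefficient of positive index; its conclusion is absurd at any point of
    the punctured ball.\<close>
  ultimately obtain e where "0 < e" "\<And>z. z \<in> cball (0::complex) e - {0} \<Longrightarrow> (0::complex) \<noteq> 0"
    using powser_0_nonzero[OF R, where f = "\<lambda>_. 0" and \<xi> = 0 and a = "\<lambda>k. complex_of_real (\<beta> k)" and m = m] by auto
  moreover have "complex_of_real e \<in> cball 0 e - {0}" using \<open>0 < e\<close> by simp
  ultimately show False by blast
qed

text \<open>There are only countably many exponents, so finite exceptional sets, one for each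
  exponent, cannot fill an interval of reals.\<close>

lemma real_interval_avoiding:
  assumes "a < b" and fin: "\<And>q::rat. q \<in> N \<Longrightarrow> finite (Z q)"
  shows "\<exists>t::real. a < t \<and> t < b \<and> (\<forall>q\<in>N. t \<notin> Z q)"
proof -
  have "countable (\<Union>q\<in>N. Z q)" by (intro countable_UN countableI_type countable_finite fin)
  moreover have "uncountable {a<..<b}" using assms(1) by (simp add: uncountable_open_interval)
  ultimately have "\<not> {a<..<b} \<subseteq> (\<Union>q\<in>N. Z q)" using countable_subset by blast
  then show ?thesis by auto
qed

section \<open>Pointwise limits of polynomials of bounded degree\<close>

lemma pderiv_sum_poly: "pderiv (\<Sum>i\<in>S. f i) = (\<Sum>i\<in>S. pderiv (f i))"
  by (induction S rule: infinite_finite_induct) (auto simp: pderiv_add)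

text \<open>Lagrange interpolation at \<open>J + 1\<close> fixed nodes of [0, 1] writes every
  \<open>P K\<close> in one fixed basis with its values at the nodes as coefficients. Convergence at
  the nodes thus gives a polynomial limit and convergence of the derivatives.\<close>

lemma poly_pointwise_limit:
  fixes P :: "nat \<Rightarrow> real poly"
  assumes deg: "\<And>K. degree (P K) \<le> J"
    and lim: "\<And>t. 0 \<le> t \<Longrightarrow> t \<le> 1 \<Longrightarrow> (\<lambda>K. poly (P K) t) \<longlonglongrightarrow> \<phi> t"
  obtains p where "\<And>t. 0 \<le> t \<Longrightarrow> t \<le> 1 \<Longrightarrow> \<phi> t = poly p t"
    and "\<And>t. (\<lambda>K. poly (pderiv (P K)) t) \<longlonglongrightarrow> poly (pderiv p) t"
proof -
  define \<tau> where "\<tau> i = real i / real (Suc J)" for i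
  have \<tau>: "0 \<le> \<tau> i" "\<tau> i \<le> 1" if "i \<le> J" for i using that by (auto simp: \<tau>_def field_simps)
  have inj: "\<tau> i = \<tau> j \<longleftrightarrow> i = j" for i j by (simp add: \<tau>_def del: of_nat_Suc)
  define l where "l i = (\<Prod>j\<in>{..J} - {i}. smult (1 / (\<tau> i - \<tau> j)) [:- \<tau> j, 1:])" for i
  have ldeg: "degree (l i) \<le> J" if "i \<le> J" for i
  proof -
    have "degree (l i) \<le> (\<Sum>j\<in>{..J} - {i}. degree (smult (1 / (\<tau> i - \<tau> j)) [:- \<tau> j, 1:]))"
      unfolding l_def by (rule order_trans[OF degree_prod_sum_le]) (simp_all only: finite_Diff finite_atMost o_def order_refl)
    also have "\<dots> \<le> (\<Sum>j\<in>{..J} - {i}. 1)" by (intro sum_mono order_trans[OF degree_smult_le]) auto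
    also have "\<dots> = J" using that by simp
    finally show ?thesis .
  qed
  have lval: "poly (l i) (\<tau> m) = (if i = m then 1 else 0)" if "i \<le> J" "m \<le> J" for i m
  proof (cases "i = m")
    case True
    have "poly (smult (1 / (\<tau> m - \<tau> j)) [:- \<tau> j, 1:]) (\<tau> m) = 1" if "j \<in> {..J} - {m}" for j
    proof -
      have "\<tau> m - \<tau> j \<noteq> 0" using that by (simp add: inj)
      then show ?thesis by (simp flip: diff_divide_distrib)
    qed
    then have "(\<Prod>j\<in>{..J} - {m}. poly (smult (1 / (\<tau> m - \<tau> j)) [:- \<tau> j, 1:]) (\<tau> m)) = 1"
      by (intro prod.neutral ballI)
    then show ?thesis using True by (simp only: l_def poly_prod if_True refl)
  next
    case False
    then have "m \<in> {..J} - {i}" using that by auto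
    then show ?thesis using False by (auto simp: l_def poly_prod)
  qed
  have rep: "P K = (\<Sum>i\<le>J. smult (poly (P K) (\<tau> i)) (l i))" for K
  proof (rule poly_eqI_degree[where A = "\<tau> ` {..J}"])
    have "card (\<tau> ` {..J}) = Suc J" by (subst card_image) (auto simp: inj_on_def inj)
    then show "degree (P K) < card (\<tau> ` {..J})" "degree (\<Sum>i\<le>J. smult (poly (P K) (\<tau> i)) (l i)) < card (\<tau> ` {..J})"
      using deg[of K] degree_sum_le[of "{..J}" "\<lambda>i. smult (poly (P K) (\<tau> i)) (l i)" J] ldeg
      by (auto simp: less_Suc_eq_le intro: order_trans[OF degree_smult_le])
    fix x assume "x \<in> \<tau> ` {..J}"
    then obtain m where m: "m \<le> J" "x = \<tau> m" by auto
    have "(\<Sum>i\<le>J. poly (P K) (\<tau> i) * poly (l i) (\<tau> m)) = (\<Sum>i\<le>J. if i = m then poly (P K) (\<tau> i) else 0)"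
      using lval m by (intro sum.cong) auto
    then show "poly (P K) x = poly (\<Sum>i\<le>J. smult (poly (P K) (\<tau> i)) (l i)) x"
      using m by (simp add: poly_sum)
  qed
  define p where "p = (\<Sum>i\<le>J. smult (\<phi> (\<tau> i)) (l i))"
  show ?thesis
  proof
    fix t :: real assume t: "0 \<le> t" "t \<le> 1"
    have "(\<lambda>K. poly (\<Sum>i\<le>J. smult (poly (P K) (\<tau> i)) (l i)) t) \<longlonglongrightarrow> poly p t"
      unfolding poly_sum poly_smult p_def by (intro tendsto_sum tendsto_mult lim \<tau> tendsto_const) auto
    then have "(\<lambda>K. poly (P K) t) \<longlonglongrightarrow> poly p t" using rep by simp
    from LIMSEQ_unique[OF lim[OF t] this] show "\<phi> t = poly p t" .
  next
    fix t :: real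
    have "(\<lambda>K. poly (pderiv (\<Sum>i\<le>J. smult (poly (P K) (\<tau> i)) (l i))) t) \<longlonglongrightarrow> poly (pderiv p) t"
      unfolding poly_sum pderiv_sum_poly pderiv_smult poly_smult p_def
      by (intro tendsto_sum tendsto_mult lim \<tau> tendsto_const) auto
    then show "(\<lambda>K. poly (pderiv (P K)) t) \<longlonglongrightarrow> poly (pderiv p) t" using rep by simp
  qed
qed

section \<open>Antiderivatives of nonnegative power series\<close>

text \<open>The common bound M lets one finite set \<open>?S\<close> of exponents of c account for
  the product for all n, so the limit passes through a finite sum.\<close>

lemma coeff_times_limit:
  assumes "weak_lim u l" "\<And>n. vge (u n) M"
  shows "(\<lambda>n. lc_coeff (c * u n) q) \<longlonglongrightarrow> lc_coeff (c * l) q"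
proof -
  let ?S = "{a. a \<le> q - M \<and> lc_coeff c a \<noteq> 0}"
  have fin: "finite ?S" by (rule lf_coeff)
  have e: "lc_coeff (c * v) q = (\<Sum>a\<in>?S. lc_coeff c a * lc_coeff v (q - a))" if "vge v M" for v
  proof (rule lc_coeff_times_superset[OF fin])
    fix a assume "lc_coeff c a \<noteq> 0" "lc_coeff v (q - a) \<noteq> 0"
    moreover from this have "\<not> q - a < M" using that by (auto simp: vge_def)
    ultimately show "a \<in> ?S" by auto
  qed
  have "(\<lambda>n. \<Sum>a\<in>?S. lc_coeff c a * lc_coeff (u n) (q - a)) \<longlonglongrightarrow> (\<Sum>a\<in>?S. lc_coeff c a * lc_coeff l (q - a))"
    by (intro tendsto_sum tendsto_mult tendsto_const weak_lim_coeff assms(1))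
  then show ?thesis using e[OF assms(2)] e[OF vge_weak_lim[OF assms]] by simp
qed

text \<open>In the binomial expansion the term of degree j in t has valuation at least
  \<open>M + j * r\<close>, so it cannot reach exponent q once j exceeds \<open>(q - M) / r\<close>.
  This degree bound does not depend on k, as \<open>poly_pointwise_limit\<close> requires.\<close>

lemma coeff_line_poly:
  assumes "vge B M" "vge A 0" "vge \<eta> r" "0 < r"
  shows "\<exists>P. (\<forall>t. poly P t = lc_coeff (B * (A + lc_real t * \<eta>) ^ k) q) \<and> degree P \<le> nat \<lceil>(q - M) / r\<rceil>"
proof -
  let ?J = "nat \<lceil>(q - M) / r\<rceil>"
  define d where "d j = lc_coeff (of_nat (k choose j) * (B * \<eta> ^ j * A ^ (k - j))) q" for j
  have d0: "d j = 0" if "?J < j" for j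
  proof -
    have "vge (B * \<eta> ^ j * A ^ (k - j)) (M + of_nat j * r + 0)"
      by (intro vge_mult assms vge_power vge_power0)
    moreover have "(q - M) / r < of_nat j" using that by linarith
    then have "q < M + of_nat j * r + 0" using assms(4) by (simp add: field_simps)
    ultimately have "lc_coeff (B * \<eta> ^ j * A ^ (k - j)) q = 0" by (rule vgeD)
    then show ?thesis by (simp add: d_def lc_coeff_of_nat_times)
  qed
  define P where "P = (\<Sum>j\<in>{..k} \<inter> {..?J}. monom (d j) j)"
  have "poly P t = lc_coeff (B * (A + lc_real t * \<eta>) ^ k) q" for t
  proof -
    have "B * (A + lc_real t * \<eta>) ^ k = (\<Sum>j\<le>k. lc_real (t ^ j) * (of_nat (k choose j) * (B * \<eta> ^ j * A ^ (k - j))))"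
      by (subst add.commute, subst binomial_ring)
         (simp add: sum_distrib_left power_mult_distrib lc_monom_power mult_ac)
    then have "lc_coeff (B * (A + lc_real t * \<eta>) ^ k) q = (\<Sum>j\<le>k. t ^ j * d j)"
      by (simp add: lc_coeff_sum lc_coeff_real_times d_def)
    also have "\<dots> = (\<Sum>j\<in>{..k} \<inter> {..?J}. t ^ j * d j)"
      by (rule sum.mono_neutral_right) (auto simp: d0)
    finally show ?thesis by (simp add: P_def poly_sum poly_monom mult.commute)
  qed
  moreover have "degree P \<le> ?J" unfolding P_def
    by (rule degree_sum_le) (auto intro: order_trans[OF degree_monom_le])
  ultimately show ?thesis by blast
qed

text \<open>Induction by splitting off one factor \<open>A + lc_real t * \<eta>\<close>; B is kept
  arbitrary because it absorbs A or \<eta>.\<close>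

lemma coeff_line_derivative:
  "((\<lambda>t. lc_coeff (B * (A + lc_real t * \<eta>) ^ Suc k) q) has_real_derivative
     lc_coeff (of_nat (Suc k) * (B * \<eta> * (A + lc_real t * \<eta>) ^ k)) q) (at t)"
proof (induction k arbitrary: B)
  case 0
  have "lc_coeff (B * (A + lc_real t * \<eta>)) q = lc_coeff (B * A) q + t * lc_coeff (B * \<eta>) q" for t
    by (simp add: distrib_left mult.left_commute[of B] lc_coeff_real_times)
  moreover have "((\<lambda>t. lc_coeff (B * A) q + t * lc_coeff (B * \<eta>) q) has_real_derivative lc_coeff (B * \<eta>) q) (at t)"
    by (auto intro!: derivative_eq_intros)
  ultimately show ?case by simp
next
  case (Suc k)
  let ?X = "\<lambda>t. A + lc_real t * \<eta>"
  have "B * ?X t ^ Suc (Suc k) = B * A * ?X t ^ Suc k + lc_real t * (B * \<eta> * ?X t ^ Suc k)" for t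
    by (simp add: algebra_simps)
  then have e: "lc_coeff (B * ?X t ^ Suc (Suc k)) q
      = lc_coeff (B * A * ?X t ^ Suc k) q + t * lc_coeff (B * \<eta> * ?X t ^ Suc k) q" for t
    by (simp only: lc_coeff_plus lc_coeff_real_times)
  note d1 = Suc[of "B * A"] and d2 = Suc[of "B * \<eta>"]
  have d3: "((\<lambda>t. t * lc_coeff (B * \<eta> * ?X t ^ Suc k) q) has_real_derivative
     (1 * lc_coeff (B * \<eta> * ?X t ^ Suc k) q + lc_coeff (of_nat (Suc k) * (B * \<eta> * \<eta> * ?X t ^ k)) q * t)) (at t)"
    using DERIV_mult[OF DERIV_ident d2] .
  note DERIV_add[OF d1 d3]
  moreover have "lc_coeff (of_nat (Suc k) * (B * A * \<eta> * ?X t ^ k)) q +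
     (1 * lc_coeff (B * \<eta> * ?X t ^ Suc k) q + lc_coeff (of_nat (Suc k) * (B * \<eta> * \<eta> * ?X t ^ k)) q * t)
    = lc_coeff (of_nat (Suc (Suc k)) * (B * \<eta> * ?X t ^ Suc k)) q"
  proof -
    have "of_nat (Suc (Suc k)) * (B * \<eta> * ?X t ^ Suc k) = of_nat (Suc k) * (B * A * \<eta> * ?X t ^ k) +
      (B * \<eta> * ?X t ^ Suc k + lc_real t * (of_nat (Suc k) * (B * \<eta> * \<eta> * ?X t ^ k)))"
      by (simp add: algebra_simps)
    then show ?thesis by (simp only: lc_coeff_plus lc_coeff_real_times) simp
  qed
  ultimately show ?case unfolding e by simp
qed

text \<open>
  Along the segment from \<open>x\<close> to \<open>y\<close>, parametrised by real \<open>t\<close>, every coefficient of \<open>F\<close> is a polynomial in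
  \<open>t\<close> and the corresponding coefficient of \<open>(y - x) f\<close> is its derivative. At a \<open>t\<close> that is a root of none of
  the countably many nonzero derivatives, the least exponent of \<open>f\<close> is the least one for the whole
  segment; its coefficient is nonnegative since \<open>f\<close> is, so the leading variation of \<open>F\<close> is an increase.
\<close>

lemma antiderivative_mono_infinitesimal:
  assumes xy: "x < y"
    and f: "\<And>z. z \<in> {x..y} \<Longrightarrow> weak_sums (\<lambda>k. a k * (z - x\<^sub>0) ^ k) (f z)"
    and F: "\<And>z. z \<in> {x..y} \<Longrightarrow> weak_sums (\<lambda>k. a k / of_nat (Suc k) * (z - x\<^sub>0) ^ Suc k) (F z)"
    and n: "\<And>z. z \<in> {x..y} \<Longrightarrow> 0 \<le> f z"
    and w: "0 < w" and L: "\<And>k. vge (a k * w ^ k) L"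
    and c: "vge ((x - x\<^sub>0) / w) 0" and \<eta>: "vge ((y - x) / w) r" "0 < r"
  shows "F x \<le> F y"
proof -
  define z where "z t = x + lc_real t * (y - x)" for t
  have z: "z t \<in> {x..y}" if "0 \<le> t" "t \<le> 1" for t
  proof -
    have "0 \<le> lc_real t" "lc_real t \<le> 1" using that lc_monom_le[of 0 0 t] lc_monom_le[of t 0 1] by auto
    then have "0 \<le> lc_real t * (y - x)" "lc_real t * (y - x) \<le> 1 * (y - x)"
      using xy mult_right_mono[of "lc_real t" 1 "y - x"] by simp_all
    then show ?thesis by (simp add: z_def)
  qed
  let ?A = "(x - x\<^sub>0) / w" and ?\<eta> = "(y - x) / w"
  have zw: "?A + lc_real t * ?\<eta> = (z t - x\<^sub>0) / w" for t
    using w by (simp add: z_def field_simps)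
  \<comment> \<open>The coefficients of the antiderivative in the normalised variable;
    \<open>termF\<close> below confirms this.\<close>
  define B where "B k = w * (a k * w ^ k) / of_nat (Suc k)" for k
  obtain \<omega> where \<omega>: "vge w \<omega>" using vge_ex by blast
  have vB: "vge (B k) (\<omega> + L)" for k
  proof -
    have "vge (w * (a k * w ^ k)) (\<omega> + L)" by (intro vge_mult \<omega> L)
    then show ?thesis by (simp add: vge_def B_def lc_coeff_divide_of_nat del: of_nat_Suc)
  qed
  have termF: "B k * (?A + lc_real t * ?\<eta>) ^ Suc k = a k / of_nat (Suc k) * (z t - x\<^sub>0) ^ Suc k" for k t
    unfolding zw using w by (simp add: B_def field_simps del: of_nat_Suc)
  have dB: "of_nat (Suc k) * (B k * ?\<eta> * (?A + lc_real t * ?\<eta>) ^ k) = (y - x) * (a k * (z t - x\<^sub>0) ^ k)" for k t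
  proof -
    have "of_nat (Suc k) * B k = w * (a k * w ^ k)"
      by (simp add: B_def del: of_nat_Suc)
    then have "of_nat (Suc k) * (B k * ?\<eta> * (?A + lc_real t * ?\<eta>) ^ k)
        = w * (a k * w ^ k) * (?\<eta> * ((z t - x\<^sub>0) / w) ^ k)" unfolding zw by (simp only: mult.assoc[symmetric])
    also have "\<dots> = (w * ?\<eta>) * (a k * (w * ((z t - x\<^sub>0) / w)) ^ k)"
      by (simp only: power_mult_distrib mult_ac)
    also have "w * ?\<eta> = y - x" using w by simp
    also have "w * ((z t - x\<^sub>0) / w) = z t - x\<^sub>0" using w by simp
    finally show ?thesis .
  qed
  \<comment> \<open>What the derivative of \<open>F (z t)\<close> in t should be by the chain
    rule.\<close>
  define G where "G t = (y - x) * f (z t)" for t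
  have "\<exists>p. (\<forall>t. 0 \<le> t \<longrightarrow> t \<le> 1 \<longrightarrow> lc_coeff (F (z t)) q = poly p t) \<and>
      (\<forall>t. 0 \<le> t \<longrightarrow> t \<le> 1 \<longrightarrow> lc_coeff (G t) q = poly (pderiv p) t)" for q
  proof -
    define J where "J = nat \<lceil>(q - (\<omega> + L)) / r\<rceil>"
    have "\<exists>P. (\<forall>t. poly P t = lc_coeff (B k * (?A + lc_real t * ?\<eta>) ^ Suc k) q) \<and> degree P \<le> J" for k
      unfolding J_def using coeff_line_poly[OF vB c \<eta>] .
    then obtain P where P: "\<And>k t. poly (P k) t = lc_coeff (B k * (?A + lc_real t * ?\<eta>) ^ Suc k) q"
      and degP: "\<And>k. degree (P k) \<le> J" by metis
    define S where "S K = (\<Sum>k\<le>K. P k)" for K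
    have degS: "degree (S K) \<le> J" for K unfolding S_def by (rule degree_sum_le) (auto simp: degP)
    have S: "poly (S K) t = lc_coeff (\<Sum>k\<le>K. a k / of_nat (Suc k) * (z t - x\<^sub>0) ^ Suc k) q" for K t
      by (simp only: S_def poly_sum P termF lc_coeff_sum)
    have lim: "(\<lambda>K. poly (S K) t) \<longlonglongrightarrow> lc_coeff (F (z t)) q" if "0 \<le> t" "t \<le> 1" for t
      unfolding S using F[OF z[OF that]] unfolding weak_sums_def by (rule weak_lim_coeff)
    obtain p where p: "\<And>t. 0 \<le> t \<Longrightarrow> t \<le> 1 \<Longrightarrow> lc_coeff (F (z t)) q = poly p t"
      and p': "\<And>t. (\<lambda>K. poly (pderiv (S K)) t) \<longlonglongrightarrow> poly (pderiv p) t"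
    proof (rule poly_pointwise_limit)
      show "degree (S K) \<le> J" for K by (rule degS)
      show "(\<lambda>K. poly (S K) t) \<longlonglongrightarrow> lc_coeff (F (z t)) q" if "0 \<le> t" "t \<le> 1" for t
        using that by (rule lim)
    qed (rule that)
    have dP: "poly (pderiv (P k)) t = lc_coeff ((y - x) * (a k * (z t - x\<^sub>0) ^ k)) q" for k t
    proof (rule DERIV_unique[OF poly_DERIV[of "P k" t]])
      show "(poly (P k) has_real_derivative lc_coeff ((y - x) * (a k * (z t - x\<^sub>0) ^ k)) q) (at t)"
        using coeff_line_derivative[of "B k" ?A ?\<eta> k q t] unfolding dB by (simp only: P[symmetric])
    qed
    have "lc_coeff (G t) q = poly (pderiv p) t" if t: "0 \<le> t" "t \<le> 1" for t
    proof -
      have v: "vge (\<Sum>k\<le>K. a k * (z t - x\<^sub>0) ^ k) L" for K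
      proof (rule vge_sum)
        fix k
        have "vge ?\<eta> 0" using \<eta> by (auto intro: vge_weaken)
        then have "vge ((z t - x\<^sub>0) / w) 0" unfolding zw[symmetric]
          using c vge_mult[of "lc_real t" 0 ?\<eta> 0] by (intro vge_add) auto
        from vge_mult[OF L vge_power0[OF this], of k k]
        show "vge (a k * (z t - x\<^sub>0) ^ k) L" using w by (simp add: power_divide)
      qed
      have "(\<lambda>K. lc_coeff ((y - x) * (\<Sum>k\<le>K. a k * (z t - x\<^sub>0) ^ k)) q) \<longlonglongrightarrow> lc_coeff (G t) q"
        unfolding G_def by (rule coeff_times_limit[OF _ v]) (use f[OF z[OF t]] in \<open>simp add: weak_sums_def\<close>)
      moreover have "lc_coeff ((y - x) * (\<Sum>k\<le>K. a k * (z t - x\<^sub>0) ^ k)) q = poly (pderiv (S K)) t" for K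
        by (simp only: S_def pderiv_sum_poly poly_sum dP sum_distrib_left lc_coeff_sum)
      ultimately show ?thesis using p'[of t] LIMSEQ_unique by simp
    qed
    then show ?thesis using p by (intro exI[of _ p]) simp
  qed
  then obtain p where p: "\<And>q t. 0 \<le> t \<Longrightarrow> t \<le> 1 \<Longrightarrow> lc_coeff (F (z t)) q = poly (p q) t"
    and p': "\<And>q t. 0 \<le> t \<Longrightarrow> t \<le> 1 \<Longrightarrow> lc_coeff (G t) q = poly (pderiv (p q)) t"
    by metis
  have G0: "0 \<le> G t" if "0 \<le> t" "t \<le> 1" for t using n[OF z[OF that]] xy by (simp add: G_def)
  have "\<exists>t. 0 < t \<and> t < 1 \<and> (\<forall>q\<in>{q. pderiv (p q) \<noteq> 0}. t \<notin> {t. poly (pderiv (p q)) t = 0})"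
    by (rule real_interval_avoiding) (auto intro: poly_roots_finite)
  then obtain t where t: "0 < t" "t < 1" and gen: "\<And>q. pderiv (p q) \<noteq> 0 \<Longrightarrow> poly (pderiv (p q)) t \<noteq> 0"
    by blast
  have zxy: "z 0 = x" "z 1 = y" by (simp_all add: z_def)
  \<comment> \<open>At the generic t a coefficient of G vanishes only if the whole derivative
    polynomial does, and then this coefficient of F is the same at both ends.\<close>
  have const: "lc_coeff (F x) q = lc_coeff (F y) q" if "lc_coeff (G t) q = 0" for q
  proof -
    have "pderiv (p q) = 0" using gen[of q] p'[of t q] t that by auto
    then obtain h where "p q = [:h:]" by (metis pderiv_iszero)
    then show ?thesis using p[of 0 q] p[of 1 q] zxy by simp
  qed
  show ?thesis
  proof (cases "G t = 0")
    case True
    then have "F x = F y" by (intro lc_eqI const) simp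
    then show ?thesis by simp
  next
    case False
    define q where "q = lc_val (G t)"
    have q: "lc_coeff (G t) q \<noteq> 0" "\<And>r. r < q \<Longrightarrow> lc_coeff (G t) r = 0"
      unfolding q_def using lc_coeff_val[OF False] by auto
    have v: "vge (G s) q" if "0 \<le> s" "s \<le> 1" for s
      unfolding vge_def
    proof (intro allI impI)
      fix q' assume "q' < q"
      then have "pderiv (p q') = 0" using gen[of q'] p'[of t q'] t q(2) by auto
      then show "lc_coeff (G s) q' = 0" using p'[of s q'] that by simp
    qed
    have nn: "0 \<le> poly (pderiv (p q)) s" if "0 < s" "s < 1" for s
      using lc_nonneg_lead[OF G0 v, of s] p'[of s q] that by simp
    have "poly (p q) 0 < poly (p q) 1"
    proof (rule real_strict_increase[where \<phi> = "poly (p q)" and \<psi> = "poly (pderiv (p q))" and s = t])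
      show "0 < poly (pderiv (p q)) t" using nn[of t] q(1) p'[of t q] t by simp
      show "continuous_on {0..1} (poly (p q))" by (intro continuous_intros)
    qed (use nn t poly_DERIV in auto)
    then have "lc_coeff (F x) q < lc_coeff (F y) q" using p[of 0 q] p[of 1 q] zxy by simp
    then have "F x < F y" unfolding less_iff_coeff using const q(2) by blast
    then show ?thesis by simp
  qed
qed

text \<open>
  The same argument with points \<open>x\<^sub>0 + s w\<close>, \<open>s\<close> real, where the coefficients are real power series in \<open>s\<close>.
  At \<open>x\<close> and \<open>y\<close> these may converge only conditionally, hence the need for Abel's theorem.
\<close>

lemma antiderivative_mono_finite:
  assumes xy: "x < y"
    and f: "\<And>z. z \<in> {x..y} \<Longrightarrow> weak_sums (\<lambda>k. a k * (z - x\<^sub>0) ^ k) (f z)"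
    and F: "\<And>z. z \<in> {x..y} \<Longrightarrow> weak_sums (\<lambda>k. a k / of_nat (Suc k) * (z - x\<^sub>0) ^ Suc k) (F z)"
    and n: "\<And>z. z \<in> {x..y} \<Longrightarrow> 0 \<le> f z"
    and w: "0 < w"
    and cx: "vge ((x - x\<^sub>0) / w) 0" and cy: "vge ((y - x\<^sub>0) / w) 0"
    and sxy: "lc_coeff ((x - x\<^sub>0) / w) 0 < lc_coeff ((y - x\<^sub>0) / w) 0"
  shows "F x \<le> F y"
proof -
  define sx where "sx = lc_coeff ((x - x\<^sub>0) / w) 0"
  define sy where "sy = lc_coeff ((y - x\<^sub>0) / w) 0"
  have s: "sx < sy" using sxy by (simp add: sx_def sy_def)
  define b where "b k = a k * w ^ k" for k
  define z where "z s = x\<^sub>0 + w * lc_real s" for s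
  \<comment> \<open>The inequalities are strict because sx and sy are only the standard parts of the
    normalised endpoints, which may differ from them by infinitesimals of either sign.\<close>
  have z: "z s \<in> {x..y}" if "sx < s" "s < sy" for s
  proof -
    have "(x - x\<^sub>0) / w < lc_real s" unfolding less_iff_coeff
      by (rule exI[of _ 0]) (use cx that in \<open>auto simp: lc_coeff_monom sx_def vge_def\<close>)
    moreover have "lc_real s < (y - x\<^sub>0) / w" unfolding less_iff_coeff
      by (rule exI[of _ 0]) (use cy that in \<open>auto simp: lc_coeff_monom sy_def vge_def\<close>)
    ultimately have "x - x\<^sub>0 < w * lc_real s" "w * lc_real s < y - x\<^sub>0"
      using w by (simp_all add: field_simps)
    then show ?thesis by (simp add: z_def less_imp_le algebra_simps)
  qed
  define \<beta> where "\<beta> q k = lc_coeff (b k) q" for q k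
  have \<beta>: "(\<lambda>k. \<beta> q k * s ^ k) sums lc_coeff (f (z s)) q" if "sx < s" "s < sy" for s q
  proof -
    have e: "a k * (z s - x\<^sub>0) ^ k = lc_real (s ^ k) * b k" for k
      by (simp add: z_def b_def power_mult_distrib lc_monom_power mult_ac)
    have "(\<lambda>K. lc_coeff (\<Sum>k\<le>K. a k * (z s - x\<^sub>0) ^ k) q) \<longlonglongrightarrow> lc_coeff (f (z s)) q"
      using f[OF z[OF that]] unfolding weak_sums_def by (rule weak_lim_coeff)
    then have "(\<lambda>K. \<Sum>k\<le>K. s ^ k * \<beta> q k) \<longlonglongrightarrow> lc_coeff (f (z s)) q"
      by (simp only: e lc_coeff_sum lc_coeff_real_times \<beta>_def)
    then show ?thesis by (simp add: sums_def_le mult.commute)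
  qed
  define R where "R = max \<bar>sx\<bar> \<bar>sy\<bar>"
  have R: "0 < R" using s by (auto simp: R_def)
  have summ: "summable (\<lambda>k. \<beta> q k * t ^ k)" if tR: "\<bar>t\<bar> < R" for t q
  proof -
    \<comment> \<open>Near the endpoint of larger modulus there are interior s with modulus above
      that of t, and convergence at s gives convergence at t.\<close>
    obtain s where s': "sx < s" "s < sy" "\<bar>t\<bar> < \<bar>s\<bar>"
    proof (cases "\<bar>sx\<bar> \<le> \<bar>sy\<bar>")
      case True
      then have "max sx \<bar>t\<bar> < sy" using tR s by (auto simp: R_def abs_if split: if_splits)
      then obtain s where "max sx \<bar>t\<bar> < s" "s < sy" using dense by blast
      then show ?thesis using that[of s] by auto
    next
      case False
      then have "sx < min sy (- \<bar>t\<bar>)" using tR s by (auto simp: R_def abs_if split: if_splits)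
      then obtain s where "sx < s" "s < min sy (- \<bar>t\<bar>)" using dense by blast
      then show ?thesis using that[of s] by auto
    qed
    show ?thesis using powser_inside[OF sums_summable[OF \<beta>[OF s'(1,2)]], of t] s'(3) by simp
  qed
  define N where "N = {q. \<exists>k. \<beta> q k \<noteq> 0}"
  \<comment> \<open>\<open>s\<^sub>1\<close> and \<open>s\<^sub>2\<close> confine the generic point
    to \<open>\<bar>t\<bar> \<le> ?r\<close> with \<open>?r < R\<close>, where every nonzero
    coefficient series has only finitely many zeros.\<close>
  obtain s\<^sub>1 where s1: "sx < s\<^sub>1" "s\<^sub>1 < sy" using dense s by blast
  obtain s\<^sub>2 where s2: "s\<^sub>1 < s\<^sub>2" "s\<^sub>2 < sy" using dense s1 by blast
  let ?r = "max \<bar>s\<^sub>1\<bar> \<bar>s\<^sub>2\<bar>"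
  have rR: "?r < R" using s1 s2 by (auto simp: R_def abs_if)
  have "\<exists>t. s\<^sub>1 < t \<and> t < s\<^sub>2 \<and> (\<forall>q\<in>N. t \<notin> {t. \<bar>t\<bar> \<le> ?r \<and> (\<Sum>k. \<beta> q k * t ^ k) = 0})"
  proof (rule real_interval_avoiding[OF s2(1)])
    fix q assume "q \<in> N"
    then show "finite {t. \<bar>t\<bar> \<le> ?r \<and> (\<Sum>k. \<beta> q k * t ^ k) = 0}"
      by (intro real_powser_finite_zeros[OF summ _ rR]) (auto simp: N_def)
  qed
  then obtain t where tZ: "s\<^sub>1 < t" "t < s\<^sub>2" "\<And>q. q \<in> N \<Longrightarrow> t \<notin> {t. \<bar>t\<bar> \<le> ?r \<and> (\<Sum>k. \<beta> q k * t ^ k) = 0}"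
    by blast
  then have t: "sx < t" "t < sy" "\<bar>t\<bar> \<le> ?r" using s1 s2 by (auto simp: abs_if)
  have gen: "lc_coeff (f (z t)) q \<noteq> 0" if "\<beta> q k \<noteq> 0" for q k
  proof -
    have "q \<in> N" using that by (auto simp: N_def)
    then show ?thesis using t(3) tZ(3)[of q] \<beta>[OF t(1,2), of q] by (auto simp: sums_iff)
  qed
  have Fterm: "a k / of_nat (Suc k) * (v - x\<^sub>0) ^ Suc k = w * (b k * ((v - x\<^sub>0) / w) ^ Suc k) / of_nat (Suc k)" for k v
    using w by (simp add: b_def power_divide del: of_nat_Suc)
  show ?thesis
  proof (cases "f (z t) = 0")
    case True
    then have "b k = 0" for k using gen by (intro lc_eqI) (auto simp: \<beta>_def)
    then have w0: "weak_sums (\<lambda>k. 0) (F x)" "weak_sums (\<lambda>k. 0) (F y)"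
      using F[of x] F[of y] xy unfolding Fterm by simp_all
    have "v = 0" if "weak_sums (\<lambda>k. 0) v" for v
    proof (rule lc_eqI)
      fix q
      show "lc_coeff v q = lc_coeff 0 q"
        using weak_lim_coeff[OF that[unfolded weak_sums_def], of q] by (simp add: LIMSEQ_const_iff)
    qed
    from this[OF w0(1)] this[OF w0(2)] show ?thesis by simp
  next
    case False
    define q where "q = lc_val (f (z t))"
    have q: "lc_coeff (f (z t)) q \<noteq> 0" "\<And>r. r < q \<Longrightarrow> lc_coeff (f (z t)) r = 0"
      unfolding q_def using lc_coeff_val[OF False] by auto
    have vb: "vge (b k) q" for k using gen q(2) by (auto simp: vge_def \<beta>_def)
    have vf: "vge (f (z s)) q" if "sx < s" "s < sy" for s
      unfolding vge_def
    proof (intro allI impI)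
      fix r assume "r < q"
      then have "(\<lambda>k. \<beta> r k * s ^ k) = (\<lambda>k. 0)" using vb by (auto simp: \<beta>_def vge_def)
      then show "lc_coeff (f (z s)) r = 0" using \<beta>[OF that, of r] sums_unique2[OF sums_zero] by auto
    qed
    have nn: "0 \<le> (\<Sum>k. \<beta> q k * s ^ k)" if "sx < s" "s < sy" for s
      using lc_nonneg_lead[OF n[OF z[OF that]] vf[OF that]] \<beta>[OF that, of q] by (simp add: sums_iff)
    have tp: "0 < (\<Sum>k. \<beta> q k * t ^ k)" using nn[OF t(1,2)] q(1) \<beta>[OF t(1,2), of q] by (simp add: sums_iff)
    define \<omega> where "\<omega> = lc_val w"
    have \<omega>: "vge w \<omega>" "0 < lc_coeff w \<omega>"
      using w vge_val[of w] lc_coeff_val(1)[of w] lc_nonneg_lead[of w \<omega>] by (auto simp: \<omega>_def less_le)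
    \<comment> \<open>At exponent \<open>\<omega> + q\<close> only products of leading coefficients
      enter. So this coefficient of \<open>F v\<close> depends on v through the standard part s
      alone: it is \<open>lc_coeff w \<omega>\<close> times a real power series in s.\<close>
    have Fv: "vge (F v) (\<omega> + q)" and
      Fs: "(\<lambda>k. \<beta> q k / real (Suc k) * s ^ Suc k) sums (lc_coeff (F v) (\<omega> + q) / lc_coeff w \<omega>)"
      if v: "v \<in> {x..y}" "vge ((v - x\<^sub>0) / w) 0" "s = lc_coeff ((v - x\<^sub>0) / w) 0" for v s
    proof -
      have p: "vge (((v - x\<^sub>0) / w) ^ j) 0 \<and> lc_coeff (((v - x\<^sub>0) / w) ^ j) 0 = s ^ j" for j
      proof (induction j)
        case (Suc j)
        then show ?case using coeff_times_lead[OF v(2), of "((v - x\<^sub>0) / w) ^ j" 0] vge_mult[OF v(2), of "((v - x\<^sub>0) / w) ^ j" 0] v(3)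
          by simp
      qed (simp add: lc_coeff_one)
      have vt: "vge (b k * ((v - x\<^sub>0) / w) ^ Suc k) (q + 0)" for k using p[of "Suc k"] vb by (intro vge_mult) auto
      have "vge (w * (b k * ((v - x\<^sub>0) / w) ^ Suc k)) (\<omega> + (q + 0))" for k by (intro vge_mult \<omega>(1) vt)
      then have v1: "vge (a k / of_nat (Suc k) * (v - x\<^sub>0) ^ Suc k) (\<omega> + q)" for k
        unfolding Fterm by (simp add: vge_def lc_coeff_divide_of_nat del: of_nat_Suc power_Suc)
      have "lc_coeff (w * (b k * ((v - x\<^sub>0) / w) ^ Suc k)) (\<omega> + (q + 0)) = lc_coeff w \<omega> * (\<beta> q k * s ^ Suc k)" for k
        using coeff_times_lead[OF \<omega>(1) vt[of k]] coeff_times_lead[of "b k" q "((v - x\<^sub>0) / w) ^ Suc k" 0] p[of "Suc k"] vb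
        by (simp add: \<beta>_def del: power_Suc)
      then have c1: "lc_coeff (a k / of_nat (Suc k) * (v - x\<^sub>0) ^ Suc k) (\<omega> + q)
          = lc_coeff w \<omega> * (\<beta> q k / real (Suc k) * s ^ Suc k)" for k
        unfolding Fterm by (simp add: lc_coeff_divide_of_nat del: of_nat_Suc power_Suc)
      note wl = F[OF v(1), unfolded weak_sums_def]
      show "vge (F v) (\<omega> + q)" by (rule vge_weak_lim[OF wl]) (intro vge_sum v1)
      have "(\<lambda>k. lc_coeff w \<omega> * (\<beta> q k / real (Suc k) * s ^ Suc k)) sums lc_coeff (F v) (\<omega> + q)"
        using weak_lim_coeff[OF wl, of "\<omega> + q"] by (simp only: sums_def_le lc_coeff_sum c1)
      then show "(\<lambda>k. \<beta> q k / real (Suc k) * s ^ Suc k) sums (lc_coeff (F v) (\<omega> + q) / lc_coeff w \<omega>)"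
        using sums_divide[of _ _ "lc_coeff w \<omega>"] \<omega>(2) by (fastforce simp del: of_nat_Suc power_Suc)
    qed
    have xx: "x \<in> {x..y}" "y \<in> {x..y}" using xy by auto
    have "lc_coeff (F x) (\<omega> + q) / lc_coeff w \<omega> < lc_coeff (F y) (\<omega> + q) / lc_coeff w \<omega>"
      by (rule real_powser_antiderivative_less[OF s Fs[OF xx(1) cx sx_def] Fs[OF xx(2) cy sy_def] nn t(1,2) tp])
    then have "lc_coeff (F x) (\<omega> + q) < lc_coeff (F y) (\<omega> + q)" using \<omega>(2) by (simp add: divide_less_cancel)
    then have "F x < F y" unfolding less_iff_coeff
      using Fv[OF xx(1) cx sx_def] Fv[OF xx(2) cy sy_def] by (intro exI[of _ "\<omega> + q"]) (auto simp: vge_def)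
    then show ?thesis by simp
  qed
qed

text \<open>In units of the scale w, the length \<open>y - x\<close> is finite. It is either
  infinitesimal or has positive standard part, and the two preceding lemmas treat these
  cases.\<close>

lemma antiderivative_mono:
  assumes xy: "x \<le> y"
    and f: "\<And>z. z \<in> {x..y} \<Longrightarrow> weak_sums (\<lambda>k. a k * (z - x\<^sub>0) ^ k) (f z)"
    and F: "\<And>z. z \<in> {x..y} \<Longrightarrow> weak_sums (\<lambda>k. a k / of_nat (Suc k) * (z - x\<^sub>0) ^ Suc k) (F z)"
    and n: "\<And>z. z \<in> {x..y} \<Longrightarrow> 0 \<le> f z"
  shows "F x \<le> F y"
proof (cases "x = y")
  case False
  then have lt: "x < y" using xy by simp
  obtain w L where w: "0 < w" and L: "\<And>k. vge (a k * w ^ k) L"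
    and b: "\<And>z. z \<in> {x..y} \<Longrightarrow> \<bar>z - x\<^sub>0\<bar> \<le> 2 * w"
    using power_series_normal_form[OF lt f] by blast
  have c: "vge ((z - x\<^sub>0) / w) 0" if "z \<in> {x..y}" for z
    by (rule vge_0_bounded[of _ 2]) (use b[OF that] w in \<open>simp add: field_simps\<close>)
  have cx: "vge ((x - x\<^sub>0) / w) 0" and cy: "vge ((y - x\<^sub>0) / w) 0" using c lt by auto
  define \<eta> where "\<eta> = (y - x) / w"
  have e: "\<eta> = (y - x\<^sub>0) / w - (x - x\<^sub>0) / w" by (simp add: \<eta>_def diff_divide_distrib)
  have \<eta>: "0 < \<eta>" "vge \<eta> 0" using lt w vge_diff[OF cy cx] by (auto simp: e[symmetric]) (simp add: \<eta>_def)
  show ?thesis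
  proof (cases "lc_coeff \<eta> 0 = 0")
    case True
    have "0 < lc_val \<eta>"
      using True \<eta> lc_coeff_val(1)[of \<eta>] vge_val_iff[of \<eta> 0] by (cases "lc_val \<eta> = 0") auto
    moreover have "vge \<eta> (lc_val \<eta>)" using \<eta> by (intro vge_val) auto
    ultimately show ?thesis
      using antiderivative_mono_infinitesimal[OF lt f F n w L cx] unfolding \<eta>_def by blast
  next
    case False
    then have "0 < lc_coeff \<eta> 0" using lc_nonneg_lead[of \<eta> 0] \<eta> by (simp add: less_le)
    then have "lc_coeff ((x - x\<^sub>0) / w) 0 < lc_coeff ((y - x\<^sub>0) / w) 0" by (simp add: e)
    from antiderivative_mono_finite[OF lt f F n w cx cy this] show ?thesis by blast
  qed
qed simp

section \<open>Lengths of intervals\<close>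

text \<open>The length of the intersection of two intervals, expressed by endpoints so that it
  ignores which endpoints belong to them.\<close>

definition overlap :: "levi_civita \<Rightarrow> levi_civita \<Rightarrow> levi_civita \<Rightarrow> levi_civita \<Rightarrow> levi_civita" where
  "overlap a b u v = max 0 (min b v - max a u)"

lemma overlap_nonneg [simp]: "0 \<le> overlap a b u v"
  by (simp add: overlap_def)

lemma overlap_le_length: "a \<le> b \<Longrightarrow> overlap a b u v \<le> b - a"
  by (auto simp: overlap_def max_def min_def)

lemma overlap_mono: "u \<le> u' \<Longrightarrow> v' \<le> v \<Longrightarrow> overlap a b u' v' \<le> overlap a b u v"
  by (auto simp: overlap_def max_def min_def)

lemma overlap_split:
  assumes "c \<le> d"
  shows "overlap a b u (min v c) + overlap a b (max u d) v \<le> overlap a b u v"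
proof -
  have *: "max 0 (min q c - p) + max 0 (q - max p d) \<le> max 0 (q - p)" for p q :: levi_civita
    using assms by (auto simp: max_def min_def)
  show ?thesis using *[of "min b v" "max a u"] by (simp add: overlap_def min.assoc max.assoc)
qed

lemma length_split:
  assumes "a \<le> b" "u \<le> v"
  shows "max 0 (min v a - u) + overlap a b u v + max 0 (v - max u b) = v - u"
  using assms by (auto simp: overlap_def max_def min_def)

text \<open>The lengths have to tend to 0, for the field is not spherically complete. They dominate
  the increments of the left endpoints, which therefore converge by
  \<open>null_strong_sums\<close>.\<close>

lemma nested_intervals:
  assumes "\<And>m. u m \<le> u (Suc m)" "\<And>m. v (Suc m) \<le> v m" "\<And>m. u m \<le> v m"
    and "strong_lim (\<lambda>m. v m - u m) 0"
  shows "\<exists>p. \<forall>m. u m \<le> p \<and> p \<le> v m"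
proof -
  have iu: "incseq u" using assms(1) by (rule incseq_SucI)
  have dv: "decseq v" using assms(2) by (rule decseq_SucI)
  have uv: "u m \<le> v n" for m n
  proof -
    have "u m \<le> u (max m n)" using incseqD[OF iu] by simp
    also have "\<dots> \<le> v (max m n)" by (rule assms(3))
    also have "\<dots> \<le> v n" using decseqD[OF dv] by simp
    finally show ?thesis .
  qed
  have "strong_lim (\<lambda>m. u (Suc m) - u m) 0"
  proof (rule strong_lim_dominated[OF assms(4)])
    fix m show "\<bar>u (Suc m) - u m\<bar> \<le> \<bar>v m - u m\<bar>" using uv[of "Suc m" m] assms(1)[of m] uv[of m m] by simp
  qed
  then obtain s where "strong_sums (\<lambda>m. u (Suc m) - u m) s" using null_strong_sums by blast
  then have "strong_lim (\<lambda>m. u m - u 0) s" by (simp add: strong_sums_def sum_lessThan_telescope)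
  from strong_lim_add[OF this strong_lim_const[of "u 0"]]
  have lim: "strong_lim u (s + u 0)" by simp
  show ?thesis
  proof (intro exI allI conjI)
    fix m
    show "u m \<le> s + u 0" using lim
      by (rule strong_lim_ge) (use incseqD[OF iu] in \<open>auto simp: eventually_sequentially\<close>)
    show "s + u 0 \<le> v m" using lim by (rule strong_lim_le) (simp add: uv)
  qed
qed

text \<open>
  There is no compactness to appeal to: a point outside all \<open>[a\<^sub>n, b\<^sub>n]\<close> is found in a nested sequence
  of intervals, each avoiding one more \<open>[a\<^sub>n, b\<^sub>n]\<close> and not filled by the remaining ones.
\<close>

lemma covered_interval_length:
  assumes ab: "\<And>n. a n \<le> b n" and t: "strong_sums (\<lambda>n. b n - a n) t"
    and o: "strong_sums (\<lambda>n. overlap (a n) (b n) u v) o'"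
    and cov: "{u..v} \<subseteq> (\<Union>n. {a n..b n})"
  shows "v - u \<le> o'"
proof (rule ccontr)
  assume neg: "\<not> v - u \<le> o'"
  let ?ov = "\<lambda>n. overlap (a n) (b n)"
  \<comment> \<open>The intervals with index at least m do not fill \<open>x\<close>: one slack
    \<theta> serves all partial sums, which avoids speaking of the value of the infinite
    sum.\<close>
  define good where "good m x \<longleftrightarrow> fst x < snd x \<and>
    (\<exists>\<theta>>0. \<forall>M. (\<Sum>n\<in>{m..<M}. ?ov n (fst x) (snd x)) + \<theta> \<le> snd x - fst x)" for m x
  define \<tau> where "\<tau> m = t - (\<Sum>n<m. b n - a n)" for m
  have tail: "(\<Sum>n\<in>{m..<M}. b n - a n) \<le> \<tau> m" for m M
  proof -
    have "(\<Sum>n<m. b n - a n) + (\<Sum>n\<in>{m..<M}. b n - a n) = (\<Sum>n<max m M. b n - a n)"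
      by (subst sum.union_disjoint[symmetric]) (auto intro!: sum.cong)
    then show ?thesis using strong_sums_ge_partial[OF t, of "max m M"] ab by (simp add: \<tau>_def)
  qed
  have \<tau>0: "0 \<le> \<tau> m" for m using tail[of m m] by simp
  have \<tau>lim: "strong_lim \<tau> 0"
    using strong_lim_diff[OF strong_lim_const[of t] t[unfolded strong_sums_def]] by (simp add: \<tau>_def[abs_def])
  \<comment> \<open>A bound for the length of the next interval. It tends to 0, as
    \<open>nested_intervals\<close> demands, yet exceeds the total length of all later intervals by
    at least \<open>dpow m\<close>, so that an interval cut down to this length is still
    good.\<close>
  define e where "e m = 2 * \<tau> (Suc m) + dpow m" for m
  have e0: "0 < e m" for m unfolding e_def using \<tau>0[of "Suc m"] by (intro add_nonneg_pos) auto
  define refines where "refines m x y \<longleftrightarrow> fst x \<le> fst y \<and> snd y \<le> snd x \<and>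
      {fst y..snd y} \<inter> {a m..b m} = {} \<and> snd y - fst y \<le> e m" for m x y
  have step: "\<exists>y. good (Suc m) y \<and> refines m x y" if "good m x" for x m
  proof -
    have uv: "fst x < snd x"
      and "\<exists>\<theta>>0. \<forall>M. (\<Sum>n\<in>{m..<M}. ?ov n (fst x) (snd x)) + \<theta> \<le> snd x - fst x"
      using that unfolding good_def by simp_all
    then obtain \<theta> where \<theta>: "0 < \<theta>" "\<And>M. (\<Sum>n\<in>{m..<M}. ?ov n (fst x) (snd x)) + \<theta> \<le> snd x - fst x"
      by auto
    define l\<^sub>1 where "l\<^sub>1 = min (snd x) (a m)"
    define r\<^sub>1 where "r\<^sub>1 = max (fst x) (b m)"
    \<comment> \<open>The parts to the left and right of \<open>{a m..b m}\<close> share the slack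
      \<theta>, so one of them has at least half of it. \<open>max 0\<close> covers an empty
      part.\<close>
    have S: "(\<Sum>n\<in>{Suc m..<M}. ?ov n (fst x) l\<^sub>1) + (\<Sum>n\<in>{Suc m..<M}. ?ov n r\<^sub>1 (snd x)) + \<theta>
        \<le> max 0 (l\<^sub>1 - fst x) + max 0 (snd x - r\<^sub>1)" for M
    proof -
      have "(\<Sum>n\<in>{Suc m..<M}. ?ov n (fst x) l\<^sub>1) + (\<Sum>n\<in>{Suc m..<M}. ?ov n r\<^sub>1 (snd x))
          \<le> (\<Sum>n\<in>{Suc m..<M}. ?ov n (fst x) (snd x))"
        unfolding l\<^sub>1_def r\<^sub>1_def sum.distrib[symmetric] by (intro sum_mono overlap_split ab)
      moreover have "(\<Sum>n\<in>{Suc m..<M}. ?ov n (fst x) (snd x)) + ?ov m (fst x) (snd x)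
          = (\<Sum>n\<in>{m..<max M (Suc m)}. ?ov n (fst x) (snd x))"
      proof -
        have "{m..<max M (Suc m)} = insert m {Suc m..<M}" by auto
        then show ?thesis by (simp add: add.commute)
      qed
      moreover note \<theta>(2)[of "max M (Suc m)"]
      moreover have "max 0 (l\<^sub>1 - fst x) + ?ov m (fst x) (snd x) + max 0 (snd x - r\<^sub>1) = snd x - fst x"
        unfolding l\<^sub>1_def r\<^sub>1_def using ab uv by (intro length_split) auto
      ultimately show ?thesis by linarith
    qed
    have mono: "(\<Sum>n\<in>{Suc m..<M}. ?ov n p q) \<le> (\<Sum>n\<in>{Suc m..<M'}. ?ov n p q)" if "M \<le> M'" for M M' p q
      using that by (intro sum_mono2) auto
    have "(\<forall>M. (\<Sum>n\<in>{Suc m..<M}. ?ov n (fst x) l\<^sub>1) + \<theta> / 2 \<le> max 0 (l\<^sub>1 - fst x)) \<or>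
       (\<forall>M. (\<Sum>n\<in>{Suc m..<M}. ?ov n r\<^sub>1 (snd x)) + \<theta> / 2 \<le> max 0 (snd x - r\<^sub>1))"
    proof (rule ccontr)
      assume "\<not> ?thesis"
      then obtain M M' where M: "max 0 (l\<^sub>1 - fst x) < (\<Sum>n\<in>{Suc m..<M}. ?ov n (fst x) l\<^sub>1) + \<theta> / 2"
        "max 0 (snd x - r\<^sub>1) < (\<Sum>n\<in>{Suc m..<M'}. ?ov n r\<^sub>1 (snd x)) + \<theta> / 2" by (auto simp: not_le)
      have "\<theta> = \<theta> / 2 + \<theta> / 2" by simp
      then show False using M S[of "max M M'"] mono[of M "max M M'" "fst x" l\<^sub>1] mono[of M' "max M M'" r\<^sub>1 "snd x"]
        by linarith
    qed
    then obtain p q where pq: "\<And>M. (\<Sum>n\<in>{Suc m..<M}. ?ov n p q) + \<theta> / 2 \<le> max 0 (q - p)"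
      and sub: "fst x \<le> p" "q \<le> snd x" "q \<le> a m \<or> b m \<le> p"
    proof
      assume h: "\<forall>M. (\<Sum>n\<in>{Suc m..<M}. ?ov n (fst x) l\<^sub>1) + \<theta> / 2 \<le> max 0 (l\<^sub>1 - fst x)"
      show ?thesis by (rule that[of "fst x" l\<^sub>1]) (use h in \<open>auto simp: l\<^sub>1_def\<close>)
    next
      assume h: "\<forall>M. (\<Sum>n\<in>{Suc m..<M}. ?ov n r\<^sub>1 (snd x)) + \<theta> / 2 \<le> max 0 (snd x - r\<^sub>1)"
      show ?thesis by (rule that[of r\<^sub>1 "snd x"]) (use h in \<open>auto simp: r\<^sub>1_def\<close>)
    qed
    \<comment> \<open>The slack \<open>\<theta> / 2\<close> is \<open>4 * \<kappa>\<close>. Moving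
      both ends in by \<kappa> makes the closed interval miss \<open>{a m..b m}\<close> and leaves a
      slack of \<open>2 * \<kappa>\<close>.\<close>
    define \<kappa> where "\<kappa> = \<theta> / 8"
    have \<kappa>: "0 < \<kappa>" "\<theta> / 2 = 4 * \<kappa>" using \<theta>(1) by (auto simp: \<kappa>_def)
    have len: "4 * \<kappa> \<le> q - p" using pq[of 0] \<kappa> by (auto simp: max_def split: if_splits)
    then have pq': "(\<Sum>n\<in>{Suc m..<M}. ?ov n p q) + 4 * \<kappa> \<le> q - p" for M
      using pq[of M] \<kappa> by (auto simp: max_def split: if_splits)
    define p' where "p' = p + \<kappa>"
    define q' where "q' = q - \<kappa>"
    define q'' where "q'' = min q' (p' + e m)"
    have dis: "{p'..q'} \<inter> {a m..b m} = {}" using sub(3) \<kappa>(1) by (auto simp: p'_def q'_def)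
    have le: "p < p'" "q' < q" "p' < q'" using \<kappa>(1) len by (auto simp: p'_def q'_def)
    have g: "good (Suc m) (p', q'')"
    proof (cases "q' \<le> p' + e m")
      case True
      have "(\<Sum>n\<in>{Suc m..<M}. ?ov n p' q') + 2 * \<kappa> \<le> q' - p'" for M
      proof -
        have "(\<Sum>n\<in>{Suc m..<M}. ?ov n p' q') \<le> (\<Sum>n\<in>{Suc m..<M}. ?ov n p q)"
          using le by (intro sum_mono overlap_mono) auto
        then show ?thesis using pq'[of M] by (simp add: p'_def q'_def)
      qed
      then show ?thesis using True le \<kappa>(1) unfolding good_def q''_def
        by (auto simp: min_def intro!: exI[of _ "2 * \<kappa>"])
    next
      case False
      then have q: "q'' = p' + e m" by (simp add: q''_def min_def)
      have "(\<Sum>n\<in>{Suc m..<M}. ?ov n p' q'') + dpow m \<le> q'' - p'" for M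
      proof -
        have "(\<Sum>n\<in>{Suc m..<M}. ?ov n p' q'') \<le> (\<Sum>n\<in>{Suc m..<M}. b n - a n)"
          by (intro sum_mono overlap_le_length ab)
        also have "\<dots> \<le> \<tau> (Suc m)" by (rule tail)
        finally show ?thesis using \<tau>0[of "Suc m"] unfolding q e_def by simp
      qed
      then show ?thesis using e0[of m] unfolding good_def
        by (auto simp: q intro!: exI[of _ "dpow m"])
    qed
    have "q'' \<le> q'" "q'' \<le> p' + e m" by (simp_all add: q''_def)
    moreover from this have "{p'..q''} \<inter> {a m..b m} = {}" using dis by fastforce
    ultimately show ?thesis using g le sub by (intro exI[of _ "(p', q'')"]) (auto simp: refines_def algebra_simps)
  qed
  have "good 0 (u, v)"
  proof -
    have "0 \<le> o'" using strong_sums_nonneg[OF o] by simp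
    moreover have "(\<Sum>n\<in>{0..<M}. ?ov n u v) \<le> o'" for M
      using strong_sums_ge_partial[OF o, of M] by (simp add: lessThan_atLeast0)
    ultimately show ?thesis unfolding good_def using neg
      by (auto intro!: exI[of _ "v - u - o'"])
  qed
  then have "\<exists>x. \<forall>n. (good n (x n) \<and> (n = 0 \<longrightarrow> x n = (u, v))) \<and> refines n (x n) (x (Suc n))"
    using step by (intro dependent_nat_choice[where P = "\<lambda>n x. good n x \<and> (n = 0 \<longrightarrow> x = (u, v))"]) auto
  then obtain x where x0: "x 0 = (u, v)" and good: "\<And>m. good m (x m)"
    and inc: "\<And>m. fst (x m) \<le> fst (x (Suc m))" "\<And>m. snd (x (Suc m)) \<le> snd (x m)"
    and dis: "\<And>m. {fst (x (Suc m))..snd (x (Suc m))} \<inter> {a m..b m} = {}"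
    and len: "\<And>m. snd (x (Suc m)) - fst (x (Suc m)) \<le> e m" unfolding refines_def by blast
  have le: "fst (x m) \<le> snd (x m)" for m using good[of m] unfolding good_def by simp
  have "strong_lim (\<lambda>m. \<tau> (Suc m)) 0" by (rule strong_lim_subseq[OF \<tau>lim filterlim_Suc])
  from strong_lim_add[OF strong_lim_cmult[OF this, of 2] strong_lim_monom[of 1]]
  have "strong_lim e 0" by (simp add: e_def[abs_def])
  then have "strong_lim (\<lambda>m. snd (x (Suc m)) - fst (x (Suc m))) 0"
  proof (rule strong_lim_dominated)
    fix m show "\<bar>snd (x (Suc m)) - fst (x (Suc m))\<bar> \<le> \<bar>e m\<bar>"
      using len[of m] e0[of m] le[of "Suc m"] by simp
  qed
  from nested_intervals[of "\<lambda>m. fst (x (Suc m))" "\<lambda>m. snd (x (Suc m))", OF inc(1) inc(2) le this]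
  obtain p where "\<forall>m. fst (x (Suc m)) \<le> p \<and> p \<le> snd (x (Suc m))" by (rule exE)
  then have p: "fst (x (Suc m)) \<le> p \<and> p \<le> snd (x (Suc m))" for m by (rule spec)
  have "p \<in> {u..v}" using p[of 0] inc[of 0] x0 by auto
  then obtain n where "p \<in> {a n..b n}" using cov by blast
  moreover have "p \<in> {fst (x (Suc n))..snd (x (Suc n))}" using p[of n] by auto
  ultimately show False using dis[of n] by blast
qed

text \<open>Any one of the intervals divides the others into those on its left and those on its
  right, and the induction treats both sides.\<close>

lemma separated_intervals_length:
  fixes a b :: "'i \<Rightarrow> levi_civita"
  assumes "finite S" "u \<le> v"
    and "\<And>i. i \<in> S \<Longrightarrow> a i < b i \<and> u \<le> a i \<and> b i \<le> v"
    and "\<And>i j. i \<in> S \<Longrightarrow> j \<in> S \<Longrightarrow> i \<noteq> j \<Longrightarrow> b i \<le> a j \<or> b j \<le> a i"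
  shows "(\<Sum>i\<in>S. b i - a i) \<le> v - u"
  using assms
proof (induction "card S" arbitrary: S u v rule: less_induct)
  case less
  show ?case
  proof (cases "S = {}")
    case False
    then obtain i where i: "i \<in> S" by blast
    define P where "P = {j \<in> S - {i}. b j \<le> a i}"
    define Q where "Q = {j \<in> S - {i}. b i \<le> a j}"
    have S: "S = insert i (P \<union> Q)" using less.prems(4)[of i] i by (auto simp: P_def Q_def)
    have ai: "a i < b i" "u \<le> a i" "b i \<le> v" using less.prems(3)[OF i] by auto
    have PQ: "P \<inter> Q = {}" "i \<notin> P" "i \<notin> Q" "finite P" "finite Q"
      using less.prems(3) less.prems(1) ai by (fastforce simp: P_def Q_def)+
    have "card P < card S" "card Q < card S"
      by (rule psubset_card_mono[OF less.prems(1)]; use i in \<open>auto simp: P_def Q_def\<close>)+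
    then have "(\<Sum>i\<in>P. b i - a i) \<le> a i - u" "(\<Sum>i\<in>Q. b i - a i) \<le> v - b i"
      using less.prems(3,4) ai PQ by (auto intro!: less.hyps simp: P_def Q_def)
    moreover have "(\<Sum>i\<in>S. b i - a i) = b i - a i + ((\<Sum>i\<in>P. b i - a i) + (\<Sum>i\<in>Q. b i - a i))"
      unfolding S using PQ by (simp add: sum.union_disjoint)
    ultimately show ?thesis by simp
  qed (use less.prems(2) in simp)
qed

section \<open>Disjoint families of intervals, inner and outer sums\<close>

lemma intervals_le: "X \<in> intervals a b \<Longrightarrow> a \<le> b"
  by (auto simp: intervals_def split: if_splits)

lemma intervals_hull: "X \<in> intervals a b \<Longrightarrow> X \<subseteq> {a..b}"
  by (auto simp: intervals_def split: if_splits)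

lemma intervals_interior: "X \<in> intervals a b \<Longrightarrow> {a<..<b} \<subseteq> X"
  by (auto simp: intervals_def split: if_splits)

lemma disjoint_intervals_separated:
  assumes "X \<in> intervals a b" "Y \<in> intervals c d" "X \<inter> Y = {}" "a < b" "c < d"
  shows "b \<le> c \<or> d \<le> a"
proof (rule ccontr)
  assume "\<not> ?thesis"
  then have "max a c < min b d" using assms by auto
  then obtain z where "max a c < z" "z < min b d" using dense by blast
  then have "z \<in> X" "z \<in> Y" using intervals_interior[OF assms(1)] intervals_interior[OF assms(2)] by auto
  then show False using assms(3) by blast
qed

lemma disjoint_intervals_overlap:
  assumes "finite S" "\<And>i. i \<in> S \<Longrightarrow> X i \<in> intervals (a i) (b i)" "disjoint_family_on X S" "u \<le> v"
  shows "(\<Sum>i\<in>S. overlap u v (a i) (b i)) \<le> v - u"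
proof -
  \<comment> \<open>\<open>disjoint_intervals_separated\<close> speaks of nondegenerate intervals
    only; vanishing overlaps are dropped first.\<close>
  define S' where "S' = {i \<in> S. 0 < overlap u v (a i) (b i)}"
  have S': "max u (a i) < min v (b i)" "overlap u v (a i) (b i) = min v (b i) - max u (a i)" if "i \<in> S'" for i
    using that by (auto simp: S'_def overlap_def max_def split: if_splits)
  have "(\<Sum>i\<in>S. overlap u v (a i) (b i)) = (\<Sum>i\<in>S'. overlap u v (a i) (b i))"
    using assms(1) by (intro sum.mono_neutral_right) (auto simp: S'_def less_le)
  also have "\<dots> = (\<Sum>i\<in>S'. min v (b i) - max u (a i))" by (intro sum.cong) (auto simp: S')
  also have "\<dots> \<le> v - u"
  proof (rule separated_intervals_length)
    fix i j assume ij: "i \<in> S'" "j \<in> S'" "i \<noteq> j"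
    then have "i \<in> S" "j \<in> S" by (auto simp: S'_def)
    then have "X i \<inter> X j = {}" using assms(3) ij(3) by (auto simp: disjoint_family_on_def)
    then have "b i \<le> a j \<or> b j \<le> a i"
      using disjoint_intervals_separated[OF assms(2)[OF \<open>i \<in> S\<close>] assms(2)[OF \<open>j \<in> S\<close>]] S'(1)[OF ij(1)] S'(1)[OF ij(2)] by auto
    then show "min v (b i) \<le> max u (a j) \<or> min v (b j) \<le> max u (a i)" by (auto simp: min_def max_def)
  next
    show "finite S'" using assms(1) by (simp add: S'_def)
    show "u \<le> v" by (rule assms(4))
    show "max u (a i) < min v (b i) \<and> u \<le> max u (a i) \<and> min v (b i) \<le> v" if "i \<in> S'" for i
      using S'(1)[OF that] by simp
  qed
  finally show ?thesis .
qed

lemma covered_open_interval_length: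
  assumes ab: "\<And>n. a n \<le> b n" and t: "strong_sums (\<lambda>n. b n - a n) t"
    and o: "strong_sums (\<lambda>n. overlap (a n) (b n) u v) o'"
    and cov: "{u<..<v} \<subseteq> (\<Union>n. {a n..b n})"
  shows "v - u \<le> o'"
proof (rule ccontr)
  assume neg: "\<not> v - u \<le> o'"
  \<comment> \<open>Passing to a closed interval inside costs \<open>2 * \<kappa>\<close>, half of
    the supposed excess.\<close>
  define \<kappa> where "\<kappa> = (v - u - o') / 4"
  have \<kappa>: "0 < \<kappa>" "4 * \<kappa> = v - u - o'" using neg by (auto simp: \<kappa>_def)
  obtain o'' where o'': "strong_sums (\<lambda>n. overlap (a n) (b n) (u + \<kappa>) (v - \<kappa>)) o''"
    using strong_sums_comparison[OF t, of "\<lambda>n. overlap (a n) (b n) (u + \<kappa>) (v - \<kappa>)"] overlap_le_length[OF ab] by auto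
  have "(v - \<kappa>) - (u + \<kappa>) \<le> o''"
    by (rule covered_interval_length[OF ab t o'']) (use cov \<kappa>(1) in force)
  also have "o'' \<le> o'" by (rule strong_sums_le[OF o'' o]) (use \<kappa>(1) in \<open>auto intro: overlap_mono\<close>)
  finally show False using \<kappa> by (simp add: algebra_simps)
qed

text \<open>Each \<open>I i\<close> is at most as long as its overlaps with all \<open>J n\<close>
  together. Summing over finitely many i and exchanging the sums, the overlaps with one
  \<open>J n\<close> add up to at most its length, because the \<open>I i\<close> are
  disjoint.\<close>

lemma interval_sums_mono:
  assumes I: "interval_seq I a b" and J: "interval_seq J c d" and sub: "(\<Union>n. I n) \<subseteq> (\<Union>n. J n)"
    and s: "strong_sums (\<lambda>n. b n - a n) s" and t: "strong_sums (\<lambda>n. d n - c n) t"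
  shows "s \<le> t"
proof -
  have Ii: "I n \<in> intervals (a n) (b n)" and Ji: "J n \<in> intervals (c n) (d n)" for n
    using I J by (auto simp: interval_seq_def)
  have cd: "c n \<le> d n" for n using Ji intervals_le by blast
  have "\<exists>o'. strong_sums (\<lambda>n. overlap (c n) (d n) u v) o'" for u v
    using strong_sums_comparison[OF t, of "\<lambda>n. overlap (c n) (d n) u v"] overlap_le_length[OF cd] by auto
  then obtain O' where O': "\<And>u v. strong_sums (\<lambda>n. overlap (c n) (d n) u v) (O' u v)" by metis
  have le: "b i - a i \<le> O' (a i) (b i)" for i
  proof (rule covered_open_interval_length[OF cd t O'])
    show "{a i<..<b i} \<subseteq> (\<Union>n. {c n..d n})"
      using intervals_interior[OF Ii, of i] sub intervals_hull[OF Ji] by blast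
  qed
  have "(\<Sum>i<N. b i - a i) \<le> t" for N
  proof -
    have "(\<Sum>i<N. b i - a i) \<le> (\<Sum>i<N. O' (a i) (b i))" by (intro sum_mono le)
    also have "\<dots> \<le> t"
    proof (rule strong_sums_le[OF strong_sums_sum[OF O'] t])
      fix n
      have "disjoint_family_on I {..<N}" using I by (auto simp: interval_seq_def disjoint_family_on_def)
      then show "(\<Sum>i<N. overlap (c n) (d n) (a i) (b i)) \<le> d n - c n"
        by (intro disjoint_intervals_overlap[where X = I] Ii cd) auto
    qed
    finally show ?thesis .
  qed
  then show ?thesis using s unfolding strong_sums_def by (intro strong_lim_le[of _ s t]) auto
qed

lemma inner_le_outer:
  assumes "s \<in> inner_sums A" "t \<in> outer_sums A" shows "s \<le> t"
proof -
  obtain I a b where I: "interval_seq I a b" "(\<Union>n. I n) \<subseteq> A" "strong_sums (\<lambda>n. b n - a n) s"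
    using assms(1) by (auto simp: inner_sums_def)
  obtain J c d where J: "interval_seq J c d" "A \<subseteq> (\<Union>n. J n)" "strong_sums (\<lambda>n. d n - c n) t"
    using assms(2) by (auto simp: outer_sums_def)
  show ?thesis using I(2) J(2) by (intro interval_sums_mono[OF I(1) J(1) _ I(3) J(3)]) (rule order_trans)
qed

text \<open>The supremum is constructed as a strong limit. Inner sums \<open>s n\<close> within
  \<open>dpow n\<close> of outer sums have increments tending to 0, since every inner sum lies below
  every outer sum.\<close>

lemma lc_measure_isLub:
  assumes "lc_measurable A" shows "isLub UNIV (inner_sums A) (lc_measure A)"
proof -
  let ?e = "\<lambda>n. dpow n"
  have "\<forall>n. \<exists>s\<in>inner_sums A. \<exists>t\<in>outer_sums A. t - s \<le> ?e n"
    using assms unfolding lc_measurable_def by simp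
  then obtain s t where s: "\<And>n. s n \<in> inner_sums A" and t: "\<And>n. t n \<in> outer_sums A" and st: "\<And>n. t n - s n \<le> ?e n"
    by metis
  have le: "s m \<le> t n" for m n using inner_le_outer[OF s t] .
  have e: "\<bar>s (Suc n) - s n\<bar> \<le> \<bar>?e n\<bar>" for n
  proof -
    have "s (Suc n) - s n \<le> ?e n" using le[of "Suc n" n] st[of n] by linarith
    moreover have "s n - s (Suc n) \<le> ?e (Suc n)" using le[of n "Suc n"] st[of "Suc n"] by linarith
    moreover have "?e (Suc n) < ?e n"
      using vge_less_monom[of "?e (Suc n)" "of_nat (Suc n)" "of_nat n" 1] vge_monom by simp
    ultimately show ?thesis by (auto simp: abs_if)
  qed
  have "strong_lim (\<lambda>n. s (Suc n) - s n) 0"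
    by (rule strong_lim_dominated[OF strong_lim_monom[of 1] e]) simp
  then obtain z where "strong_sums (\<lambda>n. s (Suc n) - s n) z" using null_strong_sums by blast
  then have "strong_lim (\<lambda>n. s n - s 0) z" by (simp add: strong_sums_def sum_lessThan_telescope)
  from strong_lim_add[OF this strong_lim_const[of "s 0"]] have lim: "strong_lim s (z + s 0)" by simp
  from strong_lim_add[OF this strong_lim_monom[of 1]] have lim': "strong_lim (\<lambda>n. s n + ?e n) (z + s 0)" by simp
  have L: "isLub UNIV (inner_sums A) (z + s 0)"
  proof (intro isLubI2 isUbI setleI setgeI ballI)
    fix x assume x: "x \<in> inner_sums A"
    show "x \<le> z + s 0" using lim'
    proof (rule strong_lim_ge)
      have "x \<le> s n + ?e n" for n using inner_le_outer[OF x t[of n]] st[of n] by linarith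
      then show "\<forall>\<^sub>F n in sequentially. x \<le> s n + ?e n" by simp
    qed
  next
    fix x assume "x \<in> Collect (isUb UNIV (inner_sums A))"
    then have "isUb UNIV (inner_sums A) x" by simp
    then have "s n \<le> x" for n using s isUbD by blast
    then show "z + s 0 \<le> x" by (intro strong_lim_le[OF lim]) simp
  qed simp
  show ?thesis unfolding lc_measure_def
    by (rule theI[where P = "isLub UNIV (inner_sums A)"], rule L) (rule isLub_unique[OF _ L])
qed

lemma inner_sums_le_measure: "lc_measurable A \<Longrightarrow> s \<in> inner_sums A \<Longrightarrow> s \<le> lc_measure A"
  using lc_measure_isLub isLubD2 by blast

lemma measure_approx:
  assumes "lc_measurable A" "0 < \<epsilon>"
  obtains s where "s \<in> inner_sums A" "lc_measure A - s < \<epsilon>"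
proof (rule ccontr)
  assume a: "\<not> thesis"
  note thes = that
  have "s \<le> lc_measure A - \<epsilon>" if s: "s \<in> inner_sums A" for s
  proof (rule ccontr)
    assume "\<not> s \<le> lc_measure A - \<epsilon>"
    then have "lc_measure A - s < \<epsilon>" by (simp add: not_le algebra_simps)
    from thes[OF s this] a show False by contradiction
  qed
  then have "isUb UNIV (inner_sums A) (lc_measure A - \<epsilon>)" by (auto intro!: isUbI setleI)
  from isLub_le_isUb[OF lc_measure_isLub[OF assms(1)] this] assms(2) show False by simp
qed

section \<open>Cutting and replacing intervals\<close>

text \<open>The new right endpoint is u clamped to [a, b], so an empty piece counts as a degenerate
  interval of length 0.\<close>

lemma intervals_inter_less:
  assumes "X \<in> intervals a b" shows "X \<inter> {..<u} \<in> intervals a (max a (min b u))"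
proof -
  have ab: "a \<le> b" using assms by (rule intervals_le)
  consider "u \<le> a" | "b < u" | "a < u" "u \<le> b" by linarith
  then show ?thesis
  proof cases
    case 1
    then have "X \<inter> {..<u} = {}" using intervals_hull[OF assms] by fastforce
    moreover have "{} = {a<..<a}" by simp
    ultimately show ?thesis using 1 ab by (simp add: intervals_def)
  next
    case 2
    then have "X \<inter> {..<u} = X" using intervals_hull[OF assms] by fastforce
    then show ?thesis using 2 ab assms by simp
  next
    case 3
    have "X \<inter> {..<u} = {a..<u} \<or> X \<inter> {..<u} = {a<..<u}"
      using assms 3 ab by (auto simp: intervals_def)
    then show ?thesis using 3 by (auto simp: intervals_def)
  qed
qed

lemma intervals_inter_ge:
  assumes "X \<in> intervals a b" shows "X \<inter> {v..} \<in> intervals (min b (max a v)) b"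
proof -
  have ab: "a \<le> b" using assms by (rule intervals_le)
  consider "v \<le> a" | "b < v" | "v = b" "a < v" | "a < v" "v < b" by linarith
  then show ?thesis
  proof cases
    case 1
    then have "X \<inter> {v..} = X" using intervals_hull[OF assms] by fastforce
    then show ?thesis using 1 ab assms by simp
  next
    case 2
    then have "X \<inter> {v..} = {}" using intervals_hull[OF assms] by fastforce
    moreover have "{} = {b<..<b}" by simp
    ultimately show ?thesis using 2 ab by (simp add: intervals_def)
  next
    case 3
    then have "X \<inter> {v..} = {b} \<or> X \<inter> {v..} = {}"
      using assms ab by (auto simp: intervals_def)
    moreover have "{b} \<in> intervals b b" "{} \<in> intervals b b" by (simp_all add: intervals_def)
    moreover have "min b (max a v) = b" using 3 by simp
    ultimately show ?thesis by (elim disjE) simp_all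
  next
    case 4
    then have "X \<inter> {v..} = {v..b} \<or> X \<inter> {v..} = {v..<b}"
      using assms ab by (auto simp: intervals_def)
    then show ?thesis using 4 by (auto simp: intervals_def)
  qed
qed

lemma overlap_complement:
  assumes "a \<le> b" "u \<le> v"
  shows "(max a (min b u) - a) + (b - min b (max a v)) = (b - a) - overlap a b u v"
  using assms by (auto simp: overlap_def max_def min_def)

text \<open>\<open>interval_seq\<close> describes a single sequence, so families of intervals are
  merged term by term.\<close>

definition interleave :: "(nat \<Rightarrow> 'a) \<Rightarrow> (nat \<Rightarrow> 'a) \<Rightarrow> nat \<Rightarrow> 'a" where
  "interleave X Y n = (if even n then X (n div 2) else Y (n div 2))"

lemma strong_sums_interleave:
  assumes "strong_sums u s" "strong_sums v t" shows "strong_sums (interleave u v) (s + t)"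
proof -
  have e: "(\<Sum>k<n. interleave u v k) = (\<Sum>k<Suc n div 2. u k) + (\<Sum>k<n div 2. v k)" for n
  proof (induction n)
    case (Suc n)
    then show ?case
      by (cases "even n") (auto simp: interleave_def algebra_simps elim!: evenE oddE)
  qed simp
  have f: "filterlim (\<lambda>n::nat. (n + c) div 2) at_top sequentially" for c
    unfolding filterlim_at_top eventually_sequentially
  proof (intro allI exI impI)
    fix Z n :: nat assume "2 * Z \<le> n" then show "Z \<le> (n + c) div 2" by simp
  qed
  show ?thesis unfolding strong_sums_def e
    by (rule strong_lim_add[OF strong_lim_subseq[OF assms(1)[unfolded strong_sums_def] f[of 1, simplified]]
          strong_lim_subseq[OF assms(2)[unfolded strong_sums_def] f[of 0, simplified]]])
qed

lemma interleave_cases: "(\<exists>m. interleave X Y n = X m) \<or> (\<exists>m. interleave X Y n = Y m)"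
  by (auto simp: interleave_def)

lemma Union_interleave: "(\<Union>n. interleave X Y n) = (\<Union>n. X n) \<union> (\<Union>n. Y n)"
proof -
  have "X n = interleave X Y (2 * n)" "Y n = interleave X Y (Suc (2 * n))" for n
    by (simp_all add: interleave_def)
  then show ?thesis using interleave_cases[of X Y] by (intro equalityI subsetI) (fastforce | blast)+
qed

lemma interval_seq_interleave:
  assumes "interval_seq X a b" "interval_seq Y c d" "(\<Union>n. X n) \<inter> (\<Union>n. Y n) = {}"
  shows "interval_seq (interleave X Y) (interleave a c) (interleave b d)"
  unfolding interval_seq_def
proof (intro conjI allI)
  fix n
  show "interleave X Y n \<in> intervals (interleave a c n) (interleave b d n)"
    using assms(1,2) by (auto simp: interval_seq_def interleave_def)
  have X: "X m \<inter> X n = {}" "Y m \<inter> Y n = {}" if "m \<noteq> n" for m n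
    using assms(1,2) that by (auto simp: interval_seq_def disjoint_family_on_def)
  have XY: "X m \<inter> Y n = {}" "Y n \<inter> X m = {}" for m n using assms(3) by auto
  show "disjoint_family (interleave X Y)"
    unfolding disjoint_family_on_def
  proof (intro ballI impI)
    fix m n :: nat assume "m \<noteq> n"
    moreover from this have "m div 2 \<noteq> n div 2" if "even m = even n"
      using that by (metis dvd_mult_div_cancel odd_two_times_div_two_succ)
    ultimately show "interleave X Y m \<inter> interleave X Y n = {}"
      using X XY by (auto simp: interleave_def)
  qed
qed

lemma overlap_summable:
  assumes "interval_seq I a b" "strong_sums (\<lambda>n. b n - a n) s"
  shows "\<exists>o'. strong_sums (\<lambda>n. overlap (a n) (b n) u v) o'"
proof (rule strong_sums_comparison[OF assms(2)])
  fix n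
  have "a n \<le> b n" using assms(1) intervals_le unfolding interval_seq_def by blast
  then show "overlap (a n) (b n) u v \<le> b n - a n" by (rule overlap_le_length)
qed simp

text \<open>The surgery behind most measure estimates below: everything the family covers in [u, v)
  is cut out and the family E is put there. The half-open middle part makes the three pieces of the
  line disjoint.\<close>

lemma replace_intervals:
  assumes I: "interval_seq I a b" "(\<Union>n. I n) \<subseteq> A" "strong_sums (\<lambda>n. b n - a n) s"
    and uv: "u \<le> v" and o': "strong_sums (\<lambda>n. overlap (a n) (b n) u v) o'"
    and E: "interval_seq E c d" "(\<Union>n. E n) \<subseteq> A \<inter> {u..<v}" "strong_sums (\<lambda>n. d n - c n) e"
  shows "\<exists>I' a' b'. interval_seq I' a' b' \<and> (\<Union>n. I' n) \<subseteq> A \<and> strong_sums (\<lambda>n. b' n - a' n) (s - o' + e) \<and>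
    (\<forall>n. (\<exists>m. I' n \<subseteq> I m \<inter> {..<u}) \<or> (\<exists>m. I' n \<subseteq> I m \<inter> {v..}) \<or> (\<exists>m. I' n = E m))"
proof -
  have Ii: "I n \<in> intervals (a n) (b n)" for n using I(1) by (auto simp: interval_seq_def)
  have ab: "a n \<le> b n" for n using Ii intervals_le by blast
  have dis: "I m \<inter> I n = {}" if "m \<noteq> n" for m n
    using I(1) that by (auto simp: interval_seq_def disjoint_family_on_def)
  let ?P = "\<lambda>n. I n \<inter> {..<u}" and ?Q = "\<lambda>n. I n \<inter> {v..}"
  let ?bP = "\<lambda>n. max (a n) (min (b n) u)" and ?aQ = "\<lambda>n. min (b n) (max (a n) v)"
  have P: "interval_seq ?P a ?bP" unfolding interval_seq_def disjoint_family_on_def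
    using intervals_inter_less[OF Ii] dis by blast
  have Q: "interval_seq ?Q ?aQ b" unfolding interval_seq_def disjoint_family_on_def
    using intervals_inter_ge[OF Ii] dis by blast
  have PQ: "(\<Union>n. ?P n) \<inter> (\<Union>n. ?Q n) = {}" using uv by fastforce
  note PQi = interval_seq_interleave[OF P Q PQ]
  have R: "(\<Union>n. interleave ?P ?Q n) \<inter> (\<Union>n. E n) = {}"
    unfolding Union_interleave using E(2) by fastforce
  note Ri = interval_seq_interleave[OF PQi E(1) R]
  have "\<exists>p. strong_sums (\<lambda>n. ?bP n - a n) p"
    by (rule strong_sums_comparison[OF I(3)]) (use ab in \<open>auto simp: max_def min_def\<close>)
  then obtain p where p: "strong_sums (\<lambda>n. ?bP n - a n) p" by blast
  have "\<exists>q. strong_sums (\<lambda>n. b n - ?aQ n) q"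
    by (rule strong_sums_comparison[OF I(3)]) (use ab in \<open>auto simp: max_def min_def\<close>)
  then obtain q where q: "strong_sums (\<lambda>n. b n - ?aQ n) q" by blast
  have "strong_sums (\<lambda>n. (?bP n - a n) + (b n - ?aQ n)) (p + q)" using p q by (rule strong_sums_add)
  moreover have "strong_sums (\<lambda>n. (b n - a n) - overlap (a n) (b n) u v) (s - o')"
    using I(3) o' by (rule strong_sums_diff)
  ultimately have pq: "p + q = s - o'"
    using overlap_complement[OF ab uv] strong_sums_unique by simp
  have "strong_sums (interleave (interleave (\<lambda>n. ?bP n - a n) (\<lambda>n. b n - ?aQ n)) (\<lambda>n. d n - c n)) (p + q + e)"
    by (intro strong_sums_interleave p q E(3))
  moreover have "interleave (interleave (\<lambda>n. ?bP n - a n) (\<lambda>n. b n - ?aQ n)) (\<lambda>n. d n - c n)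
    = (\<lambda>n. interleave (interleave ?bP b) d n - interleave (interleave a ?aQ) c n)"
    by (auto simp: interleave_def fun_eq_iff)
  ultimately have S: "strong_sums (\<lambda>n. interleave (interleave ?bP b) d n - interleave (interleave a ?aQ) c n) (s - o' + e)"
    by (simp add: pq)
  have sub: "(\<Union>n. interleave (interleave ?P ?Q) E n) \<subseteq> A"
    unfolding Union_interleave using I(2) E(2) by blast
  have cas: "(\<exists>m. interleave (interleave ?P ?Q) E n \<subseteq> I m \<inter> {..<u}) \<or>
     (\<exists>m. interleave (interleave ?P ?Q) E n \<subseteq> I m \<inter> {v..}) \<or> (\<exists>m. interleave (interleave ?P ?Q) E n = E m)" for n
    unfolding interleave_def by auto
  show ?thesis using Ri sub S cas by blast
qed

lemma single_interval_seq:
  assumes "u \<le> v"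
  shows "interval_seq (\<lambda>n. if n = 0 then {u..<v} else {}) (\<lambda>n. u) (\<lambda>n. if n = 0 then v else u)"
    and "strong_sums (\<lambda>n. (if n = 0 then v else u) - u) (v - u)"
proof -
  have "({} :: levi_civita set) \<in> intervals u u" unfolding intervals_def by auto
  moreover have "{u..<v} \<in> intervals u v" using assms by (simp add: intervals_def)
  ultimately show "interval_seq (\<lambda>n. if n = 0 then {u..<v} else {}) (\<lambda>n. u) (\<lambda>n. if n = 0 then v else u)"
    by (auto simp: interval_seq_def disjoint_family_on_def)
  show "strong_sums (\<lambda>n. (if n = 0 then v else u) - u) (v - u)"
    using strong_sums_finite[of 1 "\<lambda>n. (if n = 0 then v else u) - u"] by simp
qed

text \<open>Replacing the covered part of [u, v) by the whole of it produces another inner sum of A,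
  which cannot exceed the measure.\<close>

lemma overlap_sum_lower:
  assumes A: "lc_measurable A" and I: "interval_seq I a b" "(\<Union>n. I n) \<subseteq> A" "strong_sums (\<lambda>n. b n - a n) s"
    and uv: "u \<le> v" "{u..<v} \<subseteq> A" and o': "strong_sums (\<lambda>n. overlap (a n) (b n) u v) o'"
  shows "(v - u) - (lc_measure A - s) \<le> o'"
proof -
  have "(\<Union>n. if n = 0 then {u..<v} else {}) \<subseteq> A \<inter> {u..<v}" for n :: nat
    using uv(2) by (auto split: if_splits)
  from replace_intervals[OF I uv(1) o' single_interval_seq(1)[OF uv(1)] this single_interval_seq(2)[OF uv(1)]]
  have "s - o' + (v - u) \<in> inner_sums A" unfolding inner_sums_def by blast
  from inner_sums_le_measure[OF A this] show ?thesis by (simp add: algebra_simps)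
qed

lemma overlap_sum_upper:
  assumes I: "interval_seq I a b" and uv: "u \<le> v"
    and o': "strong_sums (\<lambda>n. overlap (a n) (b n) u v) o'"
  shows "o' \<le> v - u"
proof -
  have "(\<Sum>n<N. overlap (a n) (b n) u v) \<le> v - u" for N
  proof -
    have "(\<Sum>n<N. overlap u v (a n) (b n)) \<le> v - u"
      by (rule disjoint_intervals_overlap[where X = I])
         (use I uv in \<open>auto simp: interval_seq_def disjoint_family_on_def\<close>)
    then show ?thesis by (simp add: overlap_def min.commute max.commute)
  qed
  then show ?thesis using o' unfolding strong_sums_def by (intro strong_lim_le[of _ o']) auto
qed

text \<open>An inner approximation of B has no overlap with [u, v), and
  \<open>overlap_sum_lower\<close> in A then keeps its sum below the measure of A by at least
  \<open>v - u\<close>.\<close>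

lemma measure_subset_avoiding:
  assumes A: "lc_measurable A" and uv: "u < v" "{u..<v} \<subseteq> A"
    and B: "lc_measurable B" "B \<subseteq> A" "B \<inter> {u..<v} = {}"
  shows "lc_measure B < lc_measure A"
proof -
  obtain s where s: "s \<in> inner_sums B" "lc_measure B - s < v - u"
    using measure_approx[OF B(1), of "v - u"] uv(1) by auto
  then obtain I a b where I: "interval_seq I a b" "(\<Union>n. I n) \<subseteq> B" "strong_sums (\<lambda>n. b n - a n) s"
    by (auto simp: inner_sums_def)
  have ov0: "overlap (a n) (b n) u v = 0" for n
  proof (rule ccontr)
    assume "overlap (a n) (b n) u v \<noteq> 0"
    then have "max (a n) u < min (b n) v" by (auto simp: overlap_def max_def split: if_splits)
    then obtain z where z: "max (a n) u < z" "z < min (b n) v" using dense by blast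
    have "I n \<in> intervals (a n) (b n)" using I(1) by (auto simp: interval_seq_def)
    from intervals_interior[OF this] z have "z \<in> I n" by auto
    then have "z \<in> B" using I(2) by blast
    moreover have "z \<in> {u..<v}" using z by auto
    ultimately show False using B(3) by blast
  qed
  have o0: "strong_sums (\<lambda>n. overlap (a n) (b n) u v) 0" by (simp add: ov0)
  have IA: "(\<Union>n. I n) \<subseteq> A" using I(2) B(2) by blast
  from overlap_sum_lower[OF A I(1) IA I(3) less_imp_le[OF uv(1)] uv(2) o0] s(2)
  show ?thesis by linarith
qed

lemma measure_pos_contains_interval:
  assumes A: "lc_measurable A" "0 < lc_measure A"
  obtains u v where "u < v" "{u..v} \<subseteq> A"
proof -
  obtain s where s: "s \<in> inner_sums A" "lc_measure A - s < lc_measure A"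
    using measure_approx[OF A(1) A(2)] by blast
  then obtain I a b where I: "interval_seq I a b" "(\<Union>n. I n) \<subseteq> A" "strong_sums (\<lambda>n. b n - a n) s"
    by (auto simp: inner_sums_def)
  have "\<exists>n. a n < b n"
  proof (rule ccontr)
    assume "\<nexists>n. a n < b n"
    then have "b n - a n \<le> 0" for n by (simp add: not_less)
    then have "s \<le> 0" by (intro strong_sums_le[OF I(3) strong_sums_zero])
    then show False using s(2) by simp
  qed
  then obtain n where n: "a n < b n" by blast
  define e where "e = (b n - a n) / 3"
  have "3 * e = b n - a n" by (simp add: e_def)
  then have e: "0 < e" "b n = a n + 3 * e" using n by (auto simp: e_def algebra_simps)
  have "I n \<in> intervals (a n) (b n)" using I(1) by (auto simp: interval_seq_def)
  from intervals_interior[OF this] e have "{a n + e..b n - e} \<subseteq> I n" by auto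
  then show ?thesis using that[of "a n + e" "b n - e"] I(2) e by auto
qed

section \<open>Roots and lower bounds for integrals\<close>

lemma vge_divide_of_nat: "n > 0 \<Longrightarrow> vge (x / of_nat n) L \<longleftrightarrow> vge x L"
  by (simp add: vge_def lc_coeff_divide_of_nat)

lemma vge_near_1: "vge (a - 1) r \<Longrightarrow> 0 \<le> r \<Longrightarrow> vge a 0"
  using vge_add[OF vge_weaken[of "a - 1" r 0] vge_1] by simp

lemma vge_power_minus_1: "vge (a - 1) r \<Longrightarrow> 0 \<le> r \<Longrightarrow> vge (a ^ m - 1) r"
  using vge_power_diff[OF vge_near_1 vge_1, of a r r m] by simp

text \<open>Newton's iteration with the constant derivative \<open>n\<close>.\<close>

lemma root_of_unit_exists:
  assumes "n > 0" "vge (A - 1) r" "0 < r"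
  shows "\<exists>Y. Y ^ n = A \<and> vge (Y - 1) r"
proof -
  define Y where "Y = rec_nat 1 (\<lambda>_ y. y - (y ^ n - A) / of_nat n)"
  have Y0: "Y 0 = 1" and YS: "Y (Suc k) = Y k - (Y k ^ n - A) / of_nat n" for k by (simp_all add: Y_def)
  have r: "0 \<le> r" using assms(3) by simp
  \<comment> \<open>Every step raises the bound on the valuation of the residual
    \<open>Y k ^ n - A\<close> by r.\<close>
  have inv: "vge (Y k - 1) r \<and> vge (Y k ^ n - A) (of_nat (Suc k) * r)" for k
  proof (induction k)
    case 0
    have "vge (- (A - 1)) r" using assms(2) by (simp only: vge_uminus)
    then show ?case by (simp add: Y0)
  next
    case (Suc k)
    define e where "e = Y k ^ n - A"
    have e: "vge e (of_nat (Suc k) * r)" using Suc by (simp add: e_def)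
    have "r \<le> of_nat (Suc k) * r" using r by (simp add: algebra_simps)
    then have "vge (e / of_nat n) r" using vge_weaken[OF e] vge_divide_of_nat[OF assms(1)] by blast
    then have Y1: "vge (Y (Suc k) - 1) r" using vge_diff[of "Y k - 1" r "e / of_nat n"] Suc
      by (simp add: YS e_def algebra_simps)
    \<comment> \<open>S is the divided difference of the n-th power. Both points are 1 up to
      valuation r, so S is n up to valuation r, and the new residual is
      \<open>e * (of_nat n - S) / of_nat n\<close>.\<close>
    define S where "S = (\<Sum>i<n. Y k ^ (n - Suc i) * Y (Suc k) ^ i)"
    have "vge (of_nat n - S) r"
    proof -
      have "vge (1 - Y k ^ m * Y (Suc k) ^ i) r" for m i
      proof -
        have P: "vge (Y k ^ m - 1) r" "vge (Y (Suc k) ^ i - 1) r"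
          using vge_power_minus_1 Suc Y1 r by blast+
        from vge_mult[OF P(1) vge_near_1[OF P(2) r]] have "vge ((Y k ^ m - 1) * Y (Suc k) ^ i) r" by simp
        from vge_add[OF this P(2)]
        have "vge (- (1 - Y k ^ m * Y (Suc k) ^ i)) r" by (simp add: algebra_simps)
        then show ?thesis by (simp only: vge_uminus)
      qed
      then have "vge (\<Sum>i<n. 1 - Y k ^ (n - Suc i) * Y (Suc k) ^ i) r" by (intro vge_sum)
      then show ?thesis by (simp add: S_def sum_subtractf)
    qed
    then have "vge (e * (of_nat n - S)) (of_nat (Suc k) * r + r)" by (intro vge_mult e)
    then have v: "vge (e * (of_nat n - S) / of_nat n) (of_nat (Suc (Suc k)) * r)"
      by (simp add: vge_divide_of_nat[OF assms(1)] algebra_simps)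
    have "Y (Suc k) ^ n - Y k ^ n = (Y (Suc k) - Y k) * S" unfolding S_def by (rule power_diff_sumr2)
    also have "Y (Suc k) - Y k = - (e / of_nat n)" by (simp add: YS e_def)
    finally have "Y (Suc k) ^ n = e + A - e / of_nat n * S" by (simp add: e_def algebra_simps)
    then have "Y (Suc k) ^ n - A = e * (of_nat n - S) / of_nat n" using assms(1) by (simp add: field_simps)
    then show ?case using v Y1 by simp
  qed
  have null: "strong_lim (\<lambda>k. Y k ^ n - A) 0" unfolding strong_lim_vge
  proof
    fix R
    obtain N where N: "R / r < of_nat N" using reals_Archimedean2 by blast
    have "vge (Y k ^ n - A - 0) R" if "k \<ge> N" for k
    proof -
      have "(of_nat N :: rat) \<le> of_nat (Suc k)" using that by (intro of_nat_mono) simp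
      then have "R / r < of_nat (Suc k)" using N by linarith
      then have "R \<le> of_nat (Suc k) * r" using assms(3) by (simp add: divide_less_eq less_imp_le)
      then show ?thesis using inv[of k] vge_weaken by auto
    qed
    then show "\<forall>\<^sub>F k in sequentially. vge (Y k ^ n - A - 0) R" unfolding eventually_sequentially by blast
  qed
  then have "strong_lim (\<lambda>k. (- 1 / of_nat n) * (Y k ^ n - A)) ((- 1 / of_nat n) * 0)" by (rule strong_lim_cmult)
  then have "strong_lim (\<lambda>k. Y (Suc k) - Y k) 0" by (simp add: YS)
  then obtain y where "strong_sums (\<lambda>k. Y (Suc k) - Y k) y" using null_strong_sums by blast
  then have "strong_lim (\<lambda>k. Y k - 1) y" by (simp add: strong_sums_def sum_lessThan_telescope Y0)
  from strong_lim_add[OF this strong_lim_const[of 1]] have lim: "strong_lim Y (y + 1)" by simp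
  have vy: "vge (y + 1 - 1) r"
  proof -
    obtain k where "vge (Y k - (y + 1)) r" using lim unfolding strong_lim_vge eventually_sequentially by blast
    from vge_diff[OF conjunct1[OF inv[of k]] this] show ?thesis by simp
  qed
  note v0 = vge_near_1[OF vy r]
  have vY: "vge (Y k) 0" for k using vge_near_1[OF conjunct1[OF inv[of k]] r] .
  have "vge ((y + 1) ^ n - A) R" for R
  proof -
    have "\<forall>\<^sub>F k in sequentially. vge (Y k - (y + 1)) R \<and> vge (Y k ^ n - A) R"
      using lim null unfolding strong_lim_vge by (intro eventually_conj) simp_all
    then obtain k where k: "vge (Y k - (y + 1)) R" "vge (Y k ^ n - A) R"
      unfolding eventually_sequentially by blast
    from vge_diff[OF k(2) vge_power_diff[OF vY v0 k(1), of n]] show ?thesis by simp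
  qed
  then have "lc_coeff ((y + 1) ^ n - A) q = 0" for q by (rule vgeD[of _ "q + 1"]) simp
  then have "(y + 1) ^ n = A" by (intro lc_eqI) simp
  then show ?thesis using vy by blast
qed

text \<open>Dividing by the leading monomial leaves 1 plus an infinitesimal, whose root exists by
  \<open>root_of_unit_exists\<close>; the monomial has a root because exponents are rational and its
  real coefficient is positive.\<close>

lemma nth_root_exists:
  fixes x :: levi_civita
  assumes "n > 0" "0 \<le> x" shows "\<exists>y\<ge>0. y ^ n = x"
proof (cases "x = 0")
  case True then show ?thesis using assms(1) by (intro exI[of _ 0]) simp
next
  case False
  then have "0 < x" using assms(2) by simp
  then obtain q where q: "0 < lc_coeff x q" "vge x q" by (auto simp: lc_pos_iff)
  define c where "c = lc_coeff x q"
  define A where "A = lc_monom (1 / c) (- q) * x"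
  have cA: "lc_coeff A p = lc_coeff x (p + q) / c" for p by (simp add: A_def lc_coeff_monom_times)
  have A1: "lc_coeff (A - 1) p = 0" if "p \<le> 0" for p
    using that q by (cases "p = 0") (auto simp: cA c_def lc_coeff_one vge_def)
  obtain r where r: "0 < r" "vge (A - 1) r"
  proof (cases "A - 1 = 0")
    case True then show ?thesis using that[of 1] by simp
  next
    case False
    then have "0 < lc_val (A - 1)" using A1 lc_coeff_val(1)[OF False] not_le by blast
    then show ?thesis using that vge_val[OF False] by blast
  qed
  obtain Y where Y: "Y ^ n = A" "vge (Y - 1) r" using root_of_unit_exists[OF assms(1) r(2,1)] by blast
  have "lc_coeff (Y - 1) 0 = 0" using Y(2) r(1) by (auto simp: vge_def)
  then have "lc_coeff Y 0 = 1" by (simp add: lc_coeff_one)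
  moreover have "vge Y 0" using vge_near_1[OF Y(2)] r(1) by simp
  ultimately have "0 < Y" unfolding lc_pos_iff by (intro exI[of _ 0]) simp
  define y where "y = lc_monom (root n c) (q / of_nat n) * Y"
  have "0 \<le> y" unfolding y_def using \<open>0 < Y\<close> q(1) assms(1)
    by (intro mult_nonneg_nonneg) (auto simp: c_def less_imp_le)
  moreover have "y ^ n = x"
    using q(1) assms(1)
    by (simp add: y_def power_mult_distrib lc_monom_power Y(1) A_def c_def lc_monom_times flip: mult.assoc)
  ultimately show ?thesis by blast
qed

section \<open>Rational powers\<close>

lemma lc_powr_spec:
  assumes "quotient_of p = (a, b)" "0 \<le> x"
  shows "0 \<le> lc_powr x p" and "lc_powr x p ^ nat b = x ^ nat a"
proof -
  have b: "nat b > 0" using quotient_of_denom_pos[OF assms(1)] by simp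
  obtain y where y: "0 \<le> y" "y ^ nat b = x ^ nat a" using nth_root_exists[OF b, of "x ^ nat a"] assms(2) by auto
  have "(THE y. 0 \<le> y \<and> y ^ nat b = \<bar>x\<bar> ^ nat a) = y"
  proof (rule the_equality)
    show "0 \<le> y \<and> y ^ nat b = \<bar>x\<bar> ^ nat a" using y assms(2) by simp
    fix z assume "0 \<le> z \<and> z ^ nat b = \<bar>x\<bar> ^ nat a"
    then show "z = y" using y assms(2) b power_eq_iff_eq_base[of "nat b" z y] by simp
  qed
  then have "lc_powr x p = y" using assms by (simp add: lc_powr_def)
  then show "0 \<le> lc_powr x p" "lc_powr x p ^ nat b = x ^ nat a" using y by auto
qed

lemma quotient_of_pos:
  assumes "0 < p" obtains a b where "quotient_of p = (a, b)" "0 < a" "0 < b" "quotient_of (1 / p) = (b, a)"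
proof -
  obtain a b where ab: "quotient_of p = (a, b)" by force
  have b: "0 < b" using quotient_of_denom_pos[OF ab] .
  have "p = of_int a / of_int b" using quotient_of_div[OF ab] .
  then have a: "0 < a" using assms b by (simp add: zero_less_divide_iff)
  have "quotient_of (1 / p) = (b, a)"
    using rat_inverse_code[of p] ab a by (simp add: inverse_eq_divide)
  then show ?thesis using that ab a b by blast
qed

lemma lc_powr_mono:
  assumes "0 < p" "0 \<le> x" "x \<le> y" shows "lc_powr x p \<le> lc_powr y p"
proof -
  obtain a b where ab: "quotient_of p = (a, b)" "0 < a" "0 < b" using quotient_of_pos[OF assms(1)] by blast
  have y: "0 \<le> y" using assms by simp
  show ?thesis
  proof (rule power_le_imp_le_base)
    have "lc_powr x p ^ nat b \<le> lc_powr y p ^ nat b"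
      using lc_powr_spec(2)[OF ab(1)] assms(2,3) y by (simp add: power_mono)
    then show "lc_powr x p ^ Suc (nat b - 1) \<le> lc_powr y p ^ Suc (nat b - 1)" using ab(3) by simp
    show "0 \<le> lc_powr y p" using lc_powr_spec(1)[OF ab(1) y] .
  qed
qed

lemma lc_powr_0: assumes "0 < p" shows "lc_powr 0 p = 0"
proof -
  obtain a b where ab: "quotient_of p = (a, b)" "0 < a" "0 < b" using quotient_of_pos[OF assms(1)] by blast
  have "lc_powr 0 p ^ nat b = 0" using lc_powr_spec(2)[OF ab(1), of 0] ab(2) by simp
  then show ?thesis by simp
qed

lemma lc_powr_pos: assumes "0 < p" "0 < x" shows "0 < lc_powr x p"
proof -
  obtain a b where ab: "quotient_of p = (a, b)" "0 < a" "0 < b" using quotient_of_pos[OF assms(1)] by blast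
  have "lc_powr x p ^ nat b \<noteq> 0" using lc_powr_spec(2)[OF ab(1), of x] assms(2) by simp
  then have "lc_powr x p \<noteq> 0" using ab(3) by auto
  then show ?thesis using lc_powr_spec(1)[OF ab(1), of x] assms(2) by simp
qed

section \<open>Integrals of simple functions and their lower bounds\<close>

lemma simple_on_const: "(\<And>x. x \<in> I \<Longrightarrow> f x = c) \<Longrightarrow> simple_on I f"
  unfolding simple_on_def using weak_sums_const[of c _ 0]
  by (intro exI[of _ 0] exI[of _ "\<lambda>k. if k = 0 then c else 0"]) auto

lemma intervals_convex: "X \<in> intervals a b \<Longrightarrow> x \<in> X \<Longrightarrow> y \<in> X \<Longrightarrow> {x..y} \<subseteq> X"
  by (auto simp: intervals_def split: if_splits)

lemma weak_sums_shift:
  assumes "weak_sums u s" shows "weak_sums (\<lambda>k. if k = 0 then u 0 + e else u k) (s + e)"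
proof -
  have "(\<Sum>k\<le>K. if k = 0 then u 0 + e else u k) = (\<Sum>k\<le>K. u k) + e" for K
    by (induction K) auto
  then show ?thesis using assms unfolding weak_sums_def by (simp add: weak_lim_add_const)
qed

lemma has_simple_integral_const:
  assumes "I \<in> intervals a b" "\<And>x. x \<in> I \<Longrightarrow> f x = c"
  shows "has_simple_integral f I a b (c * (b - a))"
proof (cases "a = b")
  case False
  define s where "s k = (if k = 0 then c else 0)" for k :: nat
  have f: "\<forall>x\<in>I. weak_sums (\<lambda>k. s k * (x - 0) ^ k) (f x)"
    using assms(2) weak_sums_const[of c _ 0] by (simp add: s_def)
  have F: "\<forall>x\<in>I. weak_sums (\<lambda>k. s k / of_nat (Suc k) * (x - 0) ^ Suc k) (c * x)"
  proof
    fix x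
    have "(\<Sum>k\<le>K. s k / of_nat (Suc k) * (x - 0) ^ Suc k) = c * x" for K
      by (induction K) (auto simp: s_def)
    then show "weak_sums (\<lambda>k. s k / of_nat (Suc k) * (x - 0) ^ Suc k) (c * x)"
      unfolding weak_sums_def by simp
  qed
  have lim: "lim_within I (\<lambda>x. c * x) z (c * z)" for z
    unfolding lim_within_def
  proof (intro allI impI)
    fix \<epsilon> :: levi_civita assume e: "0 < \<epsilon>"
    have p: "0 < \<bar>c\<bar> + 1" using abs_ge_zero[of c] by linarith
    show "\<exists>\<delta>>0. \<forall>x\<in>I. x \<noteq> z \<and> \<bar>x - z\<bar> < \<delta> \<longrightarrow> \<bar>c * x - c * z\<bar> < \<epsilon>"
    proof (intro exI[of _ "\<epsilon> / (\<bar>c\<bar> + 1)"] conjI ballI impI)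
      show "0 < \<epsilon> / (\<bar>c\<bar> + 1)" using e p by simp
      fix x assume "x \<noteq> z \<and> \<bar>x - z\<bar> < \<epsilon> / (\<bar>c\<bar> + 1)"
      then have "(\<bar>c\<bar> + 1) * \<bar>x - z\<bar> < \<epsilon>" using p by (simp add: pos_less_divide_eq mult.commute)
      moreover have "\<bar>c * x - c * z\<bar> = \<bar>c\<bar> * \<bar>x - z\<bar>" by (simp add: abs_mult flip: right_diff_distrib)
      ultimately show "\<bar>c * x - c * z\<bar> < \<epsilon>" using abs_ge_zero[of "x - z"] by (simp add: distrib_right)
    qed
  qed
  have "simple_on I f" using assms(2) by (rule simple_on_const)
  moreover have "c * (b - a) = c * b - c * a" by (rule right_diff_distrib)
  ultimately show ?thesis unfolding has_simple_integral_def if_not_P[OF False]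
    using assms(1) f F lim[of a] lim[of b] by blast
qed (use assms simple_on_const[OF assms(2)] in \<open>auto simp: has_simple_integral_def\<close>)

text \<open>The bound \<kappa> is known only between u and v. There
  \<open>antiderivative_mono\<close> is applied to \<open>f - \<kappa>\<close>; on the rest of I
  monotonicity of F itself loses nothing.\<close>

lemma simple_integral_lower_bound:
  assumes v: "has_simple_integral f I a b w" and n: "\<And>x. x \<in> I \<Longrightarrow> 0 \<le> f x"
    and k: "\<And>x. x \<in> I \<Longrightarrow> u \<le> x \<Longrightarrow> x < v \<Longrightarrow> \<kappa> \<le> f x"
  shows "\<kappa> * overlap a b u v \<le> w"
proof (cases "a = b")
  case True
  then have "overlap a b u v = 0" using overlap_le_length[of a b u v] overlap_nonneg[of a b u v]
    by (auto intro: antisym)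
  then show ?thesis using v True by (simp add: has_simple_integral_def)
next
  case False
  have I: "I \<in> intervals a b" using v by (simp add: has_simple_integral_def)
  then have ab: "a < b" using intervals_le False by fastforce
  have "\<exists>x\<^sub>0 c F l\<^sub>a l\<^sub>b. (\<forall>x\<in>I. weak_sums (\<lambda>k. c k * (x - x\<^sub>0) ^ k) (f x)) \<and>
      (\<forall>x\<in>I. weak_sums (\<lambda>k. c k / of_nat (Suc k) * (x - x\<^sub>0) ^ Suc k) (F x)) \<and>
      lim_within I F a l\<^sub>a \<and> lim_within I F b l\<^sub>b \<and> w = l\<^sub>b - l\<^sub>a"
    using v unfolding has_simple_integral_def if_not_P[OF False] by blast
  then obtain x\<^sub>0 c F la lb where f': "\<forall>x\<in>I. weak_sums (\<lambda>k. c k * (x - x\<^sub>0) ^ k) (f x)"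
    and F': "\<forall>x\<in>I. weak_sums (\<lambda>k. c k / of_nat (Suc k) * (x - x\<^sub>0) ^ Suc k) (F x)"
    and la: "lim_within I F a la" and lb: "lim_within I F b lb" and w: "w = lb - la"
    by (elim exE conjE)
  note f = f'[rule_format] and F = F'[rule_format]
  have int: "{a<..<b} \<subseteq> I" by (rule intervals_interior[OF I])
  have mono: "F x \<le> F y" if "x \<le> y" "x \<in> I" "y \<in> I" for x y
  proof (rule antiderivative_mono[where a = c and x\<^sub>0 = x\<^sub>0 and f = f, OF that(1)])
    fix z assume "z \<in> {x..y}"
    then have zI: "z \<in> I" using intervals_convex[OF I that(2,3)] by blast
    show "weak_sums (\<lambda>k. c k * (z - x\<^sub>0) ^ k) (f z)" by (rule f[OF zI])
    show "weak_sums (\<lambda>k. c k / of_nat (Suc k) * (z - x\<^sub>0) ^ Suc k) (F z)" by (rule F[OF zI])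
    show "0 \<le> f z" by (rule n[OF zI])
  qed
  have la': "la \<le> F x" if x: "a < x" "x < b" for x
  proof (rule ccontr)
    assume "\<not> la \<le> F x"
    then have "0 < la - F x" by simp
    then obtain \<delta> where \<delta>: "0 < \<delta>" "\<And>y. y \<in> I \<Longrightarrow> y \<noteq> a \<Longrightarrow> \<bar>y - a\<bar> < \<delta> \<Longrightarrow> \<bar>F y - la\<bar> < la - F x"
      using la unfolding lim_within_def by blast
    obtain y where y: "a < y" "y < min x (a + \<delta>)" using dense[of a "min x (a + \<delta>)"] x \<delta>(1) by auto
    then have "y \<in> I" "x \<in> I" using int x by auto
    then show False using \<delta>(2)[of y] mono[of y x] y by (auto simp: abs_less_iff)
  qed
  have lb': "F x \<le> lb" if x: "a < x" "x < b" for x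
  proof (rule ccontr)
    assume "\<not> F x \<le> lb"
    then have "0 < F x - lb" by simp
    then obtain \<delta> where \<delta>: "0 < \<delta>" "\<And>y. y \<in> I \<Longrightarrow> y \<noteq> b \<Longrightarrow> \<bar>y - b\<bar> < \<delta> \<Longrightarrow> \<bar>F y - lb\<bar> < F x - lb"
      using lb unfolding lim_within_def by blast
    obtain y where y: "max x (b - \<delta>) < y" "y < b" using dense[of "max x (b - \<delta>)" b] x \<delta>(1) by auto
    then have "y \<in> I" "x \<in> I" using int x by auto
    then show False using \<delta>(2)[of y] mono[of x y] y by (auto simp: abs_less_iff)
  qed
  show ?thesis
  proof (cases "max a u < min b v")
    case False
    then have "min b v - max a u \<le> 0" by (simp only: diff_le_0_iff_le not_less)
    then have "overlap a b u v = 0" unfolding overlap_def by (rule max_absorb1)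
    moreover obtain x where "a < x" "x < b" using dense ab by blast
    ultimately show ?thesis using la'[of x] lb'[of x] w by simp
  next
    case True
    define u' where "u' = max a u"
    define v' where "v' = min b v"
    have uv: "u' < v'" "overlap a b u v = v' - u'" using True by (auto simp: overlap_def u'_def v'_def max_def)
    have pq: "\<kappa> * (q - p) \<le> w" if "u' < p" "p \<le> q" "q < v'" for p q
    proof -
      have sub: "{p..q} \<subseteq> I" using int that by (auto simp: u'_def v'_def)
      \<comment> \<open>Subtracting \<kappa> from f alters only the coefficient of index 0, hence
        only the linear term of the antiderivative.\<close>
      define c' where "c' k = (if k = 0 then c 0 - \<kappa> else c k)" for k
      have "F p - \<kappa> * (p - x\<^sub>0) \<le> F q - \<kappa> * (q - x\<^sub>0)"
      proof (rule antiderivative_mono[where a = c' and f = "\<lambda>z. f z - \<kappa>" and x\<^sub>0 = x\<^sub>0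
            and F = "\<lambda>z. F z - \<kappa> * (z - x\<^sub>0)"])
        fix z assume z: "z \<in> {p..q}"
        then have zI: "z \<in> I" using sub by blast
        have "(\<lambda>k. c' k * (z - x\<^sub>0) ^ k) = (\<lambda>k. if k = 0 then c 0 * (z - x\<^sub>0) ^ 0 + (- \<kappa>) else c k * (z - x\<^sub>0) ^ k)"
          by (auto simp: c'_def)
        then show "weak_sums (\<lambda>k. c' k * (z - x\<^sub>0) ^ k) (f z - \<kappa>)"
          using weak_sums_shift[OF f[OF zI], of "- \<kappa>"] by simp
        have "(\<lambda>k. c' k / of_nat (Suc k) * (z - x\<^sub>0) ^ Suc k) =
          (\<lambda>k. if k = 0 then c 0 / of_nat (Suc 0) * (z - x\<^sub>0) ^ Suc 0 + (- \<kappa> * (z - x\<^sub>0)) else c k / of_nat (Suc k) * (z - x\<^sub>0) ^ Suc k)"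
        proof (rule ext)
          fix k show "c' k / of_nat (Suc k) * (z - x\<^sub>0) ^ Suc k =
            (if k = 0 then c 0 / of_nat (Suc 0) * (z - x\<^sub>0) ^ Suc 0 + (- \<kappa> * (z - x\<^sub>0)) else c k / of_nat (Suc k) * (z - x\<^sub>0) ^ Suc k)"
            by (cases "k = 0") (simp_all add: c'_def left_diff_distrib)
        qed
        then show "weak_sums (\<lambda>k. c' k / of_nat (Suc k) * (z - x\<^sub>0) ^ Suc k) (F z - \<kappa> * (z - x\<^sub>0))"
          using weak_sums_shift[OF F[OF zI], of "- \<kappa> * (z - x\<^sub>0)"] by simp
        show "0 \<le> f z - \<kappa>" using k[OF zI] z that by (simp add: u'_def v'_def)
      qed (rule that)
      then have "\<kappa> * (q - p) \<le> F q - F p" by (simp add: algebra_simps)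
      also have "\<dots> \<le> lb - la" using la'[of p] lb'[of q] that by (simp add: u'_def v'_def diff_mono)
      finally show ?thesis by (simp add: w)
    qed
    show ?thesis unfolding uv(2)
    proof (rule field_le_mult_one_interval)
      fix z :: levi_civita assume z: "0 < z" "z < 1"
      \<comment> \<open>\<open>pq\<close> needs points strictly inside the overlap. Moving both ends
        in by e leaves the fraction z of its length, and z may be arbitrarily close to 1.\<close>
      define e where "e = (1 - z) * (v' - u') / 2"
      have "2 * e = (1 - z) * (v' - u')" by (simp add: e_def)
      then have e: "z * (v' - u') = (v' - e) - (u' + e)" by (simp add: algebra_simps)
      have "0 < e" "0 < z * (v' - u')" using z uv(1) by (simp_all add: e_def)
      then have "\<kappa> * ((v' - e) - (u' + e)) \<le> w" unfolding e by (intro pq) simp_all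
      then show "z * (\<kappa> * (v' - u')) \<le> w" unfolding e[symmetric] by (simp add: mult_ac)
    qed
  qed
qed

lemma integral_lower_bound:
  assumes A: "lc_measurable A" and L: "lc_has_integral f A L"
    and uv: "u \<le> v" "{u..<v} \<subseteq> A" and n: "\<And>x. x \<in> A \<Longrightarrow> 0 \<le> f x"
    and k: "\<And>x. u \<le> x \<Longrightarrow> x < v \<Longrightarrow> \<kappa> \<le> f x" and k0: "0 \<le> \<kappa>"
  shows "\<kappa> * (v - u) \<le> L"
proof (rule ccontr)
  assume neg: "\<not> \<kappa> * (v - u) \<le> L"
  define \<epsilon> where "\<epsilon> = (\<kappa> * (v - u) - L) / 2"
  have e: "0 < \<epsilon>" "2 * \<epsilon> = \<kappa> * (v - u) - L" using neg by (auto simp: \<epsilon>_def)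
  from L[unfolded lc_has_integral_def, THEN conjunct2, THEN spec, THEN mp, OF e(1)]
  obtain \<delta> where \<delta>: "0 < \<delta>" and D: "\<forall>I a b s. interval_seq I a b \<and> (\<Union>n. I n) \<subseteq> A \<and> (\<forall>n. simple_on (I n) f) \<and>
        strong_sums (\<lambda>n. b n - a n) s \<and> lc_measure A - s < \<delta> \<longrightarrow>
        (\<exists>v t. (\<forall>n. has_simple_integral f (I n) (a n) (b n) (v n)) \<and> strong_sums v t \<and> \<bar>t - L\<bar> < \<epsilon>)"
    by (elim exE conjE)
  have kp: "0 < \<kappa> + 1" using k0 by simp
  \<comment> \<open>The intervals miss at most \<open>lc_measure A - s\<close> of the length of [u,
    v). The second bound keeps \<kappa> times this loss below \<epsilon>, also when \<kappa> is
    0.\<close>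
  define \<delta>' where "\<delta>' = min \<delta> (\<epsilon> / (\<kappa> + 1))"
  have \<delta>': "0 < \<delta>'" "\<delta>' \<le> \<delta>" "\<delta>' \<le> \<epsilon> / (\<kappa> + 1)"
    using \<delta> e(1) kp unfolding \<delta>'_def by (simp_all only: min.cobounded1 min.cobounded2 min_less_iff_conj divide_pos_pos)
  have "f \<in> measurable_funs A" using L by (simp add: lc_has_integral_def)
  from this[unfolded measurable_funs_def, THEN CollectD, THEN conjunct2, THEN spec, THEN mp, OF \<delta>'(1)]
  obtain I a b s where I: "interval_seq I a b" "(\<Union>n. I n) \<subseteq> A" "strong_sums (\<lambda>n. b n - a n) s"
     "lc_measure A - s < \<delta>'" "\<forall>n. simple_on (I n) f"
    by (elim exE conjE)
  have "lc_measure A - s < \<delta>" using I(4) \<delta>'(2) by simp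
  with I(1,2,3,5) D have "\<exists>v t. (\<forall>n. has_simple_integral f (I n) (a n) (b n) (v n)) \<and> strong_sums v t \<and> \<bar>t - L\<bar> < \<epsilon>"
    by blast
  then obtain V t where V': "\<forall>n. has_simple_integral f (I n) (a n) (b n) (V n)" and V: "strong_sums V t" "\<bar>t - L\<bar> < \<epsilon>"
    by (elim exE conjE)
  obtain o' where o': "strong_sums (\<lambda>n. overlap (a n) (b n) u v) o'" using overlap_summable[OF I(1,3)] by blast
  have "\<kappa> * o' \<le> t"
  proof (rule strong_sums_le[OF strong_sums_cmult[OF o'] V(1)])
    fix m show "\<kappa> * overlap (a m) (b m) u v \<le> V m"
      by (rule simple_integral_lower_bound[OF V'[rule_format]]) (use I(2) n k k0 in auto)
  qed
  moreover have "\<kappa> * ((v - u) - (lc_measure A - s)) \<le> \<kappa> * o'"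
    using overlap_sum_lower[OF A I(1,2,3) uv o'] k0 by (rule mult_left_mono)
  moreover have "\<kappa> * (lc_measure A - s) \<le> \<epsilon>"
  proof -
    have "\<kappa> * (lc_measure A - s) \<le> \<kappa> * \<delta>'" using I(4) k0 by (intro mult_left_mono) auto
    also have "\<dots> \<le> (\<kappa> + 1) * \<delta>'" using \<delta>'(1) by (intro mult_right_mono) auto
    also have "\<dots> \<le> \<epsilon>" using \<delta>'(3) kp by (simp add: pos_le_divide_eq mult.commute)
    finally show ?thesis .
  qed
  ultimately show False using V(2) e by (simp add: right_diff_distrib abs_less_iff)
qed

section \<open>Step functions\<close>

definition grid :: "levi_civita \<Rightarrow> levi_civita \<Rightarrow> nat \<Rightarrow> nat \<Rightarrow> levi_civita" where
  "grid \<alpha> h N j = \<alpha> + of_nat j * (h / of_nat N)"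

text \<open>The cells are closed on the left to match the jump sums, which count the grid points
  \<open>\<le> x\<close>.\<close>

definition step_function :: "levi_civita \<Rightarrow> levi_civita \<Rightarrow> nat \<Rightarrow> (levi_civita \<Rightarrow> levi_civita) \<Rightarrow> bool" where
  "step_function \<alpha> h N \<phi> \<longleftrightarrow> (\<forall>x. x < \<alpha> \<or> \<alpha> + h \<le> x \<longrightarrow> \<phi> x = 0) \<and>
     (\<forall>j<N. \<forall>x. grid \<alpha> h N j \<le> x \<and> x < grid \<alpha> h N (Suc j) \<longrightarrow> \<phi> x = \<phi> (grid \<alpha> h N j))"

lemma step_function_cell:
  "step_function \<alpha> h N \<phi> \<Longrightarrow> j < N \<Longrightarrow> grid \<alpha> h N j \<le> x \<Longrightarrow> x < grid \<alpha> h N (Suc j) \<Longrightarrow> \<phi> x = \<phi> (grid \<alpha> h N j)"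
  unfolding step_function_def by blast

lemma step_function_outside:
  "step_function \<alpha> h N \<phi> \<Longrightarrow> x < \<alpha> \<or> \<alpha> + h \<le> x \<Longrightarrow> \<phi> x = 0"
  unfolding step_function_def by blast

lemma grid_0 [simp]: "grid \<alpha> h N 0 = \<alpha>"
  by (simp add: grid_def)

lemma grid_N: "0 < N \<Longrightarrow> grid \<alpha> h N N = \<alpha> + h"
  by (simp add: grid_def)

lemma grid_Suc: "grid \<alpha> h N (Suc j) - grid \<alpha> h N j = h / of_nat N"
  by (simp add: grid_def algebra_simps flip: add_divide_distrib)

lemma grid_mono: "0 < h \<Longrightarrow> i \<le> j \<Longrightarrow> grid \<alpha> h N i \<le> grid \<alpha> h N j"
  unfolding grid_def by (intro add_left_mono mult_right_mono) auto

lemma grid_cell: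
  assumes "0 < N" "\<alpha> \<le> x" "x < \<alpha> + h"
  obtains j where "j < N" "grid \<alpha> h N j \<le> x" "x < grid \<alpha> h N (Suc j)"
proof -
  have "\<exists>k<N. (\<forall>i\<le>k. \<not> x < grid \<alpha> h N i) \<and> x < grid \<alpha> h N (Suc k)"
    by (rule ex_least_nat_less) (use assms in \<open>auto simp: grid_N not_less\<close>)
  then show ?thesis using that by (auto simp: not_less)
qed

lemma grid_cell_subset:
  assumes "0 < h" "j < N" shows "{grid \<alpha> h N j..<grid \<alpha> h N (Suc j)} \<subseteq> {\<alpha>..<\<alpha> + h}"
  using grid_mono[OF assms(1), of 0 j \<alpha> N] grid_mono[OF assms(1), of "Suc j" N \<alpha> N] assms(2) by (auto simp: grid_N)

lemma step_function_compose2: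
  assumes "step_function \<alpha> h N \<phi>" "step_function \<alpha> h N \<psi>" "G 0 0 = 0"
  shows "step_function \<alpha> h N (\<lambda>x. G (\<phi> x) (\<psi> x))"
  unfolding step_function_def
proof (intro conjI allI impI)
  fix x assume "x < \<alpha> \<or> \<alpha> + h \<le> x"
  then show "G (\<phi> x) (\<psi> x) = 0"
    by (simp only: step_function_outside[OF assms(1)] step_function_outside[OF assms(2)] assms(3))
next
  fix j x assume "j < N" and x: "grid \<alpha> h N j \<le> x \<and> x < grid \<alpha> h N (Suc j)"
  then show "G (\<phi> x) (\<psi> x) = G (\<phi> (grid \<alpha> h N j)) (\<psi> (grid \<alpha> h N j))"
    using step_function_cell[OF assms(1), of j x] step_function_cell[OF assms(2), of j x] by metis
qed

lemma overlap_adjacent: "u \<le> v \<Longrightarrow> v \<le> w \<Longrightarrow> overlap a b u v + overlap a b v w = overlap a b u w"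
  if "a \<le> b"
  using that by (auto simp: overlap_def max_def min_def)

lemma overlap_grid_sum:
  assumes "0 < h" "a \<le> b"
  shows "(\<Sum>j<n. overlap a b (grid \<alpha> h N j) (grid \<alpha> h N (Suc j))) = overlap a b \<alpha> (grid \<alpha> h N n)"
proof (induction n)
  case 0
  then show ?case using assms(2) by (auto simp: overlap_def max_def min_def)
next
  case (Suc n)
  have "\<alpha> \<le> grid \<alpha> h N n" using grid_mono[OF assms(1), of 0 n \<alpha> N] by simp
  then show ?case using Suc overlap_adjacent[OF assms(2), of \<alpha> "grid \<alpha> h N n" "grid \<alpha> h N (Suc n)"]
      grid_mono[OF assms(1), of n "Suc n" \<alpha> N] by simp
qed

section \<open>Integral and essential supremum of a step function\<close>

context
  fixes \<alpha> h :: levi_civita and N :: nat and \<phi> :: "levi_civita \<Rightarrow> levi_civita"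
  assumes S: "step_function \<alpha> h N \<phi>" and h: "0 < h" "0 < N"
begin

abbreviation "node \<equiv> grid \<alpha> h N"

lemma step_function_no_cut:
  assumes xy: "x < y"
    and cut: "\<And>j. j \<le> N \<Longrightarrow> x < node j \<Longrightarrow> y \<le> node j"
  shows "\<exists>\<kappa>. \<forall>z. x < z \<and> z < y \<longrightarrow> \<phi> z = \<kappa>"
proof (cases "y \<le> \<alpha> \<or> \<alpha> + h \<le> x")
  case True
  then have "\<phi> z = 0" if "x < z" "z < y" for z by (intro step_function_outside[OF S]) (use that in auto)
  then show ?thesis by blast
next
  case False
  then have "\<alpha> \<le> x" "x < \<alpha> + h" using cut[of 0] by (auto simp: not_le not_less[symmetric])
  then obtain j where j: "j < N" "node j \<le> x" "x < node (Suc j)" using grid_cell[OF h(2)] by blast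
  have "y \<le> node (Suc j)" using cut[of "Suc j"] j by simp
  then have "\<phi> z = \<phi> (node j)" if "x < z" "z < y" for z
    by (intro step_function_cell[OF S j(1)]) (use j that in auto)
  then show ?thesis by blast
qed

text \<open>The integral is a limit over all families on whose members the function is simple, and
  such a member may contain nodes. Simple functions are continuous, so there is no jump at those
  nodes. Induction on the number of nodes strictly between x and y.\<close>

lemma step_function_simple_eq:
  assumes I: "simple_on I \<phi>"
  shows "x < y \<Longrightarrow> {x..y} \<subseteq> I \<Longrightarrow> \<phi> x = \<phi> y"
proof (induction "card {j. j \<le> N \<and> x < node j \<and> node j < y}" arbitrary: x y rule: less_induct)
  case less
  let ?C = "\<lambda>x y. {j. j \<le> N \<and> x < node j \<and> node j < y}"
  have fin: "finite (?C x y)" for x y by simp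
  show ?case
  proof (cases "?C x y = {}")
    case False
    then obtain j where j: "j \<in> ?C x y" by blast
    let ?c = "node j"
    have c: "x < ?c" "?c < y" using j by auto
    have "?C x ?c \<subset> ?C x y" "?C ?c y \<subset> ?C x y" using j c by auto
    then have "card (?C x ?c) < card (?C x y)" "card (?C ?c y) < card (?C x y)"
      using psubset_card_mono[OF fin] by blast+
    moreover have "{x..?c} \<subseteq> {x..y}" "{?c..y} \<subseteq> {x..y}" using c by auto
    then have "{x..?c} \<subseteq> I" "{?c..y} \<subseteq> I" using less.prems(2) by (simp_all only: order_trans)
    ultimately have "\<phi> x = \<phi> ?c" "\<phi> ?c = \<phi> y"
      using less.hyps[of x ?c] less.hyps[of ?c y] c by auto
    then show ?thesis by simp
  next
    case True
    then have "\<And>j. j \<le> N \<Longrightarrow> x < node j \<Longrightarrow> y \<le> node j" by (auto simp: not_less)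
    from step_function_no_cut[OF less.prems(1) this]
    obtain \<kappa> where \<kappa>: "\<And>z. x < z \<Longrightarrow> z < y \<Longrightarrow> \<phi> z = \<kappa>" by auto
    \<comment> \<open>Without nodes inside, \<phi> is constant on the open interval, and continuity
      carries the value to the two ends.\<close>
    have near: "\<phi> e = \<kappa>" if e: "e \<in> {x..y}" "e = x \<or> e = y" for e
    proof (rule ccontr)
      assume "\<phi> e \<noteq> \<kappa>"
      then have "0 < \<bar>\<phi> e - \<kappa>\<bar>" by simp
      from simple_uniformly_continuous[OF less.prems(1) I less.prems(2) this]
      obtain \<delta> where \<delta>: "0 < \<delta>" "\<And>z z'. z \<in> {x..y} \<Longrightarrow> z' \<in> {x..y} \<Longrightarrow> \<bar>z - z'\<bar> < \<delta> \<Longrightarrow> \<bar>\<phi> z - \<phi> z'\<bar> < \<bar>\<phi> e - \<kappa>\<bar>"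
        by blast
      define d where "d = min (\<delta> / 2) ((y - x) / 2)"
      have "\<delta> / 2 < \<delta>" "(y - x) / 2 < y - x" "0 < \<delta> / 2" "0 < (y - x) / 2" using \<delta>(1) less.prems(1) by auto
      then have d: "0 < d" "d < \<delta>" "d < y - x" unfolding d_def by (auto simp del: less_divide_eq_numeral1 divide_less_eq_numeral1)
      define z where "z = (if e = x then x + d else y - d)"
      have z: "x < z" "z < y" using d by (auto simp: z_def algebra_simps)
      have "\<bar>e - z\<bar> < \<delta>" using d e(2) by (auto simp: z_def)
      then have "\<bar>\<phi> e - \<phi> z\<bar> < \<bar>\<phi> e - \<kappa>\<bar>" using \<delta>(2)[of e z] e(1) z by auto
      then show False using \<kappa>[OF z] by simp
    qed
    show ?thesis using near[of x] near[of y] less.prems(1) by simp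
  qed
qed

text \<open>On I the function is a constant, so the integral is this constant times the length. The
  form as a sum over cells is chosen because overlaps with a fixed cell can be summed strongly over
  a whole family.\<close>

lemma step_function_simple_integral:
  assumes I: "I \<in> intervals a b" "simple_on I \<phi>"
  shows "has_simple_integral \<phi> I a b
    (\<Sum>j<N. \<phi> (node j) * overlap a b (node j) (node (Suc j)))"
proof (cases "a = b")
  case True
  then have "overlap a b u v = 0" for u v
    using overlap_le_length[of a b u v] overlap_nonneg[of a b u v] by (auto intro: antisym)
  then show ?thesis using True I by (simp add: has_simple_integral_def)
next
  case False
  have ab: "a < b" using intervals_le[OF I(1)] False by simp
  obtain m where m: "a < m" "m < b" using dense ab by blast
  then have mI: "m \<in> I" using intervals_interior[OF I(1)] by auto
  define \<kappa> where "\<kappa> = \<phi> m"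
  have \<kappa>: "\<phi> x = \<kappa>" if "x \<in> I" for x
  proof (cases x m rule: linorder_cases)
    case less
    from step_function_simple_eq[OF I(2) less intervals_convex[OF I(1) that mI]]
    show ?thesis by (simp only: \<kappa>_def)
  next
    case greater
    from step_function_simple_eq[OF I(2) greater intervals_convex[OF I(1) mI that]]
    show ?thesis by (simp only: \<kappa>_def)
  qed (simp add: \<kappa>_def)
  have j: "\<phi> (node j) * overlap a b (node j) (node (Suc j)) = \<kappa> * overlap a b (node j) (node (Suc j))" if "j < N" for j
  proof (cases "overlap a b (node j) (node (Suc j)) = 0")
    case False
    then have "max a (node j) < min b (node (Suc j))" by (auto simp: overlap_def max_def split: if_splits)
    then obtain z where z: "max a (node j) < z" "z < min b (node (Suc j))" using dense by blast
    then have "\<phi> z = \<phi> (node j)" by (intro step_function_cell[OF S that]) simp_all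
    moreover have "\<phi> z = \<kappa>" using z intervals_interior[OF I(1)] by (intro \<kappa>) auto
    ultimately show ?thesis by simp
  qed simp
  have "(\<Sum>j<N. \<phi> (node j) * overlap a b (node j) (node (Suc j))) = \<kappa> * overlap a b \<alpha> (\<alpha> + h)"
    using overlap_grid_sum[OF h(1), of a b \<alpha> N N] ab by (simp add: j grid_N h(2) flip: sum_distrib_left)
  also have "\<dots> = \<kappa> * (b - a)"
  proof (cases "\<kappa> = 0")
    case nz: False
    \<comment> \<open>A nonzero constant value confines the interior of I to
      \<open>{\<alpha>..<\<alpha> + h}\<close>, so the overlap is the full length.\<close>
    have in_cell: "\<alpha> \<le> x \<and> x < \<alpha> + h" if "a < x" "x < b" for x
    proof -
      have "x \<in> I" using that intervals_interior[OF I(1)] by auto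
      then have "\<phi> x \<noteq> 0" using \<kappa> nz by simp
      then show ?thesis using step_function_outside[OF S, of x] by (auto simp: not_le[symmetric])
    qed
    have "\<alpha> \<le> a"
    proof (rule ccontr)
      assume "\<not> \<alpha> \<le> a"
      then have "a < min \<alpha> b" using ab by simp
      then obtain x where "a < x" "x < min \<alpha> b" using dense by blast
      then show False using in_cell[of x] by simp
    qed
    moreover have "b \<le> \<alpha> + h"
    proof (rule ccontr)
      assume "\<not> b \<le> \<alpha> + h"
      then have "max a (\<alpha> + h) < b" using ab by simp
      then obtain x where "max a (\<alpha> + h) < x" "x < b" using dense by blast
      then show False using in_cell[of x] by simp
    qed
    ultimately show ?thesis using ab by (simp add: overlap_def)
  qed simp
  finally show ?thesis using has_simple_integral_const[OF I(1) \<kappa>] by simp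
qed

text \<open>An inner approximation of A is recut: its part inside
  \<open>{\<alpha>..<\<alpha> + h}\<close>, of total length at most h, gives way to the cells, of
  total length h. The deficit does not grow, and on the rest \<phi> is 0.\<close>

lemma step_function_measurable:
  assumes A: "lc_measurable A" "{\<alpha>..<\<alpha> + h} \<subseteq> A"
  shows "\<phi> \<in> measurable_funs A"
  unfolding measurable_funs_def
proof (intro CollectI conjI A(1) allI impI)
  fix \<epsilon> :: levi_civita assume "0 < \<epsilon>"
  then obtain s where s: "s \<in> inner_sums A" "lc_measure A - s < \<epsilon>" using measure_approx[OF A(1)] by blast
  then obtain I a b where I: "interval_seq I a b" "(\<Union>n. I n) \<subseteq> A" "strong_sums (\<lambda>n. b n - a n) s"
    by (auto simp: inner_sums_def)
  have uv: "\<alpha> \<le> \<alpha> + h" using h by simp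
  obtain o' where o': "strong_sums (\<lambda>n. overlap (a n) (b n) \<alpha> (\<alpha> + h)) o'"
    using overlap_summable[OF I(1,3)] by blast
  have oh: "o' \<le> h" using overlap_sum_upper[OF I(1) uv o'] by simp
  define E where "E n = (if n < N then {node n..<node (Suc n)} else {})" for n
  define c where "c n = (if n < N then node n else \<alpha>)" for n
  define d where "d n = (if n < N then node (Suc n) else \<alpha>)" for n
  have le: "node n \<le> node (Suc n)" for n using grid_mono[OF h(1)] by simp
  have "disjoint_family E"
    unfolding disjoint_family_on_def
  proof (intro ballI impI)
    fix m n :: nat assume "m \<noteq> n"
    have *: "E m \<inter> E n = {}" if "m < n" for m n
      using grid_mono[OF h(1), of "Suc m" n \<alpha> N] that by (auto simp: E_def)
    show "E m \<inter> E n = {}" using *[of m n] *[of n m] \<open>m \<noteq> n\<close> by (cases m n rule: linorder_cases) auto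
  qed
  moreover have "E n \<in> intervals (c n) (d n)" for n
    using le[of n] by (simp add: E_def c_def d_def intervals_def)
  ultimately have Es: "interval_seq E c d" by (simp add: interval_seq_def)
  have Esub: "(\<Union>n. E n) \<subseteq> A \<inter> {\<alpha>..<\<alpha> + h}"
  proof
    fix x assume "x \<in> (\<Union>n. E n)"
    then obtain n where n: "n < N" "node n \<le> x" "x < node (Suc n)" by (auto simp: E_def split: if_splits)
    then show "x \<in> A \<inter> {\<alpha>..<\<alpha> + h}" using grid_cell_subset[OF h(1) n(1), of \<alpha>] A(2) by (auto simp: subset_iff)
  qed
  have "(\<Sum>n<N. d n - c n) = h"
    using h(2) by (simp add: c_def d_def grid_Suc)
  moreover have "strong_sums (\<lambda>n. d n - c n) (\<Sum>n<N. d n - c n)"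
    by (rule strong_sums_finite) (simp add: c_def d_def)
  ultimately have Esum: "strong_sums (\<lambda>n. d n - c n) h" by simp
  obtain I' a' b' where I': "interval_seq I' a' b'" "(\<Union>n. I' n) \<subseteq> A" "strong_sums (\<lambda>n. b' n - a' n) (s - o' + h)"
    and cas: "\<And>n. (\<exists>m. I' n \<subseteq> I m \<inter> {..<\<alpha>}) \<or> (\<exists>m. I' n \<subseteq> I m \<inter> {\<alpha> + h..}) \<or> (\<exists>m. I' n = E m)"
    using replace_intervals[OF I uv o' Es Esub Esum] by blast
  have simp: "simple_on (I' n) \<phi>" for n
    using cas[of n]
  proof (elim disjE exE)
    fix m assume "I' n \<subseteq> I m \<inter> {..<\<alpha>}"
    then show ?thesis by (intro simple_on_const[of _ _ 0] step_function_outside[OF S]) auto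
  next
    fix m assume "I' n \<subseteq> I m \<inter> {\<alpha> + h..}"
    then show ?thesis by (intro simple_on_const[of _ _ 0] step_function_outside[OF S]) auto
  next
    fix m assume m: "I' n = E m"
    show ?thesis
    proof (rule simple_on_const)
      fix x assume "x \<in> I' n"
      then have "m < N" "node m \<le> x" "x < node (Suc m)" using m by (auto simp: E_def split: if_splits)
      then show "\<phi> x = \<phi> (node m)" by (rule step_function_cell[OF S])
    qed
  qed
  have "lc_measure A - (s - o' + h) < \<epsilon>" using s(2) oh by (simp add: algebra_simps)
  then show "\<exists>I a b s. interval_seq I a b \<and> (\<Union>n. I n) \<subseteq> A \<and> strong_sums (\<lambda>n. b n - a n) s \<and>
      lc_measure A - s < \<epsilon> \<and> (\<forall>n. simple_on (I n) \<phi>)"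
    using I' simp by blast
qed

text \<open>For any admissible family, its total overlap \<open>\<sigma> j\<close> with a cell
  differs from the length of the cell by at most the deficit \<open>lc_measure A - s\<close>, so the
  error is at most M times the deficit.\<close>

lemma step_function_has_integral:
  assumes A: "lc_measurable A" "{\<alpha>..<\<alpha> + h} \<subseteq> A"
  shows "lc_has_integral \<phi> A (\<Sum>j<N. \<phi> (node j) * (h / of_nat N))"
  unfolding lc_has_integral_def
proof (intro conjI allI impI step_function_measurable[OF A])
  fix \<epsilon> :: levi_civita assume e: "0 < \<epsilon>"
  define M where "M = (\<Sum>j<N. \<bar>\<phi> (node j)\<bar>)"
  have M: "0 \<le> M" unfolding M_def by (intro sum_nonneg) simp
  show "\<exists>\<delta>>0. \<forall>I a b s. interval_seq I a b \<and> (\<Union>n. I n) \<subseteq> A \<and> (\<forall>n. simple_on (I n) \<phi>) \<and>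
        strong_sums (\<lambda>n. b n - a n) s \<and> lc_measure A - s < \<delta> \<longrightarrow>
        (\<exists>v t. (\<forall>n. has_simple_integral \<phi> (I n) (a n) (b n) (v n)) \<and> strong_sums v t \<and>
           \<bar>t - (\<Sum>j<N. \<phi> (node j) * (h / of_nat N))\<bar> < \<epsilon>)"
  proof (intro exI[of _ "\<epsilon> / (M + 1)"] conjI allI impI)
    have M1: "0 < M + 1" using M by simp
    then show "0 < \<epsilon> / (M + 1)" using e by simp
    fix I a b s assume a: "interval_seq I a b \<and> (\<Union>n. I n) \<subseteq> A \<and> (\<forall>n. simple_on (I n) \<phi>) \<and>
        strong_sums (\<lambda>n. b n - a n) s \<and> lc_measure A - s < \<epsilon> / (M + 1)"
    then have I: "interval_seq I a b" "(\<Union>n. I n) \<subseteq> A" "strong_sums (\<lambda>n. b n - a n) s"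
      and simp: "\<And>n. simple_on (I n) \<phi>" and ms: "lc_measure A - s < \<epsilon> / (M + 1)" by auto
    have ms0: "0 \<le> lc_measure A - s"
      using inner_sums_le_measure[OF A(1), of s] I unfolding inner_sums_def by auto
    let ?o = "\<lambda>j n. overlap (a n) (b n) (node j) (node (Suc j))"
    have "\<exists>r. strong_sums (?o j) r" for j using overlap_summable[OF I(1,3)] .
    then obtain \<sigma> where \<sigma>: "\<And>j. strong_sums (?o j) (\<sigma> j)" by metis
    have le: "node j \<le> node (Suc j)" for j using grid_mono[OF h(1)] by simp
    have dev: "\<bar>\<sigma> j - h / of_nat N\<bar> \<le> lc_measure A - s" if "j < N" for j
    proof -
      have sub: "{node j..<node (Suc j)} \<subseteq> A" using grid_cell_subset[OF h(1) that] A(2) by (rule order_trans)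
      show ?thesis using overlap_sum_lower[OF A(1) I le sub \<sigma>] overlap_sum_upper[OF I(1) le \<sigma>, of j] ms0
        unfolding grid_Suc by (simp add: abs_le_iff)
    qed
    define t where "t = (\<Sum>j<N. \<phi> (node j) * \<sigma> j)"
    have St: "strong_sums (\<lambda>n. \<Sum>j<N. \<phi> (node j) * ?o j n) t"
      unfolding t_def by (intro strong_sums_sum strong_sums_cmult \<sigma>)
    have V: "has_simple_integral \<phi> (I n) (a n) (b n) (\<Sum>j<N. \<phi> (node j) * ?o j n)" for n
      using I(1) by (intro step_function_simple_integral[OF _ simp]) (simp add: interval_seq_def)
    have "\<bar>t - (\<Sum>j<N. \<phi> (node j) * (h / of_nat N))\<bar> = \<bar>\<Sum>j<N. \<phi> (node j) * (\<sigma> j - h / of_nat N)\<bar>"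
      by (simp add: t_def right_diff_distrib sum_subtractf)
    also have "\<dots> \<le> (\<Sum>j<N. \<bar>\<phi> (node j) * (\<sigma> j - h / of_nat N)\<bar>)" by (rule sum_abs)
    also have "\<dots> \<le> (\<Sum>j<N. \<bar>\<phi> (node j)\<bar> * (lc_measure A - s))"
      unfolding abs_mult by (intro sum_mono mult_left_mono dev) auto
    also have "\<dots> = M * (lc_measure A - s)" by (simp add: M_def sum_distrib_right)
    also have "\<dots> \<le> (M + 1) * (lc_measure A - s)" using ms0 by (intro mult_right_mono) auto
    also have "\<dots> < \<epsilon>" using ms M1 by (simp add: pos_less_divide_eq mult.commute)
    finally show "\<exists>v t. (\<forall>n. has_simple_integral \<phi> (I n) (a n) (b n) (v n)) \<and> strong_sums v t \<and>
           \<bar>t - (\<Sum>j<N. \<phi> (node j) * (h / of_nat N))\<bar> < \<epsilon>"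
      using V St by (intro exI[of _ "\<lambda>n. \<Sum>j<N. \<phi> (node j) * ?o j n"] exI[of _ t] conjI allI)
  qed
qed

text \<open>Every value of a step function is taken on a whole interval.\<close>

lemma step_function_essential_sup:
  assumes A: "lc_measurable A" "{\<alpha>..<\<alpha> + h} \<subseteq> A"
    and pos: "\<And>x. 0 \<le> \<phi> x"
  shows "isGlb UNIV {c. lc_ae A (\<lambda>x. \<phi> x \<le> c)} (Max ((\<lambda>j. \<phi> (node j)) ` {..<N}))"
proof -
  let ?V = "(\<lambda>j. \<phi> (node j)) ` {..<N}"
  have V: "finite ?V" "?V \<noteq> {}" using h(2) by auto
  have le: "\<phi> x \<le> Max ?V" for x
  proof (cases "\<alpha> \<le> x \<and> x < \<alpha> + h")
    case True
    then obtain j where j: "j < N" "node j \<le> x" "x < node (Suc j)" using grid_cell[OF h(2)] by blast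
    have "\<phi> (node j) \<in> ?V" using j(1) by simp
    from Max_ge[OF V(1) this] show ?thesis by (simp only: step_function_cell[OF S j])
  next
    case False
    then have "\<phi> x = 0" by (intro step_function_outside[OF S]) (auto simp: not_le not_less)
    moreover have "0 \<le> Max ?V" using Max_in[OF V] pos by (elim imageE) simp
    ultimately show ?thesis by simp
  qed
  show ?thesis
  proof (intro isGlbI2 isLbI setleI setgeI ballI)
    fix c assume "c \<in> {c. lc_ae A (\<lambda>x. \<phi> x \<le> c)}"
    then have ae: "lc_measurable {x \<in> A. \<phi> x \<le> c}" "lc_measure {x \<in> A. \<phi> x \<le> c} = lc_measure A"
      by (auto simp: lc_ae_def)
    obtain j where j: "j < N" "Max ?V = \<phi> (node j)" using Max_in[OF V] by auto
    show "Max ?V \<le> c"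
    proof (rule ccontr)
      assume c: "\<not> Max ?V \<le> c"
      have sub: "{node j..<node (Suc j)} \<subseteq> A" using grid_cell_subset[OF h(1) j(1)] A(2) by (rule order_trans)
      have lt: "node j < node (Suc j)" using grid_Suc[of \<alpha> h N j] h by (metis diff_gt_0_iff_gt divide_pos_pos of_nat_0_less_iff)
      have "\<phi> x = Max ?V" if "x \<in> {node j..<node (Suc j)}" for x
        using step_function_cell[OF S j(1), of x] j(2) that by simp
      then have "{x \<in> A. \<phi> x \<le> c} \<inter> {node j..<node (Suc j)} = {}" using c by auto
      from measure_subset_avoiding[OF A(1) lt sub ae(1) _ this] ae(2) show False by auto
    qed
  next
    fix x assume "x \<in> Collect (isLb UNIV {c. lc_ae A (\<lambda>x. \<phi> x \<le> c)})"
    moreover have "{x \<in> A. \<phi> x \<le> Max ?V} = A" using le by auto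
    then have "lc_ae A (\<lambda>x. \<phi> x \<le> Max ?V)" unfolding lc_ae_def using A(1) by simp
    ultimately show "x \<le> Max ?V" by (auto simp: isLb_def setge_def)
  qed simp
qed

end

section \<open>A Cauchy sequence without limit\<close>

text \<open>Only interior grid points are counted. A point of level k occurs again at every higher
  level, where it receives further, infinitely smaller jumps.\<close>

definition jump_sum :: "levi_civita \<Rightarrow> levi_civita \<Rightarrow> nat \<Rightarrow> levi_civita \<Rightarrow> levi_civita" where
  "jump_sum \<alpha> h n x = (if \<alpha> \<le> x \<and> x < \<alpha> + h
     then \<Sum>k\<le>n. dpow k * (\<Sum>i\<in>{1..<2 ^ k}. if grid \<alpha> h (2 ^ k) i \<le> x then 1 else 0) else 0)"

lemma grid_refine:
  assumes "k \<le> M" shows "grid \<alpha> h (2 ^ k) i = grid \<alpha> h (2 ^ M) (i * 2 ^ (M - k))"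
proof -
  have "(2::levi_civita) ^ M = 2 ^ k * 2 ^ (M - k)" using assms by (simp flip: power_add)
  then show ?thesis by (simp add: grid_def)
qed

lemma grid_le_iff:
  assumes "0 < h" "grid \<alpha> h N j \<le> x" "x < grid \<alpha> h N (Suc j)"
  shows "grid \<alpha> h N i \<le> x \<longleftrightarrow> i \<le> j"
proof
  assume "grid \<alpha> h N i \<le> x"
  then show "i \<le> j" using assms(3) grid_mono[OF assms(1), of "Suc j" i \<alpha> N] by (metis le_less_trans not_less not_less_eq_eq order_trans)
next
  assume "i \<le> j"
  then show "grid \<alpha> h N i \<le> x" using grid_mono[OF assms(1), of i j \<alpha> N] assms(2) by simp
qed

lemma step_function_jump_sum:
  assumes h: "0 < h" and n: "n \<le> M" shows "step_function \<alpha> h (2 ^ M) (jump_sum \<alpha> h n)"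
  unfolding step_function_def
proof (intro conjI allI impI)
  fix x assume "x < \<alpha> \<or> \<alpha> + h \<le> x"
  then show "jump_sum \<alpha> h n x = 0" by (auto simp: jump_sum_def)
next
  let ?g = "grid \<alpha> h (2 ^ M)"
  fix j x assume j: "j < 2 ^ M" and x: "?g j \<le> x \<and> x < ?g (Suc j)"
  have lt: "?g j < ?g (Suc j)" using x by simp
  have in0: "\<alpha> \<le> ?g j" "?g (Suc j) \<le> \<alpha> + h"
    using grid_mono[OF h, of 0 j \<alpha> "2 ^ M"] grid_mono[OF h, of "Suc j" "2 ^ M" \<alpha> "2 ^ M"] j by (auto simp: grid_N)
  have "grid \<alpha> h (2 ^ k) i \<le> x \<longleftrightarrow> grid \<alpha> h (2 ^ k) i \<le> ?g j" if "k \<le> n" for k i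
    unfolding grid_refine[OF order_trans[OF that n]]
    using grid_le_iff[OF h, of \<alpha> "2 ^ M" j x] grid_le_iff[OF h, of \<alpha> "2 ^ M" j "?g j"] x lt by simp
  moreover have "\<alpha> \<le> x \<and> x < \<alpha> + h" "\<alpha> \<le> ?g j \<and> ?g j < \<alpha> + h" using x lt in0 by auto
  ultimately show "jump_sum \<alpha> h n x = jump_sum \<alpha> h n (?g j)" by (simp add: jump_sum_def)
qed

lemma jump_sum_mono:
  assumes "\<alpha> \<le> x" "x \<le> y" "y < \<alpha> + h" shows "jump_sum \<alpha> h n x \<le> jump_sum \<alpha> h n y"
  using assms unfolding jump_sum_def by (auto intro!: sum_mono mult_left_mono simp: less_imp_le)

text \<open>Between x and c every other count can only grow, so the jump of level k at c survives in
  full.\<close>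

lemma jump_sum_jump:
  assumes "\<alpha> \<le> x" "x < c" "c < \<alpha> + h" and c: "c = grid \<alpha> h (2 ^ k) i" "1 \<le> i" "i < 2 ^ k" "k \<le> n"
  shows "jump_sum \<alpha> h n x + dpow k \<le> jump_sum \<alpha> h n c"
proof -
  define ind where "ind k i z = (if grid \<alpha> h (2 ^ k) i \<le> z then 1 else 0 :: levi_civita)" for k i z
  have ind0: "0 \<le> ind k i c - ind k i x" for k i using assms(2) by (simp add: ind_def)
  define T where "T k = (\<Sum>i\<in>{1..<2 ^ k}. ind k i c - ind k i x)" for k :: nat
  have T0: "0 \<le> dpow k * T k" for k
    unfolding T_def by (intro mult_nonneg_nonneg sum_nonneg ind0) (simp add: less_imp_le)
  have "ind k i c - ind k i x \<le> T k" unfolding T_def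
    by (rule member_le_sum) (use c ind0 in auto)
  moreover have "ind k i c - ind k i x = 1" using assms(2) c(1) by (simp add: ind_def)
  ultimately have "dpow k * 1 \<le> dpow k * T k"
    by (intro mult_left_mono) (auto simp: less_imp_le)
  also have "\<dots> \<le> (\<Sum>k\<le>n. dpow k * T k)"
    by (rule member_le_sum) (use c T0 in auto)
  also have "\<dots> = jump_sum \<alpha> h n c - jump_sum \<alpha> h n x"
    using assms by (simp add: jump_sum_def T_def ind_def sum_subtractf right_diff_distrib)
  finally show ?thesis by (simp add: algebra_simps)
qed

text \<open>The counts are natural numbers and so have valuation at least 0, however large they are.
  The levels above m contribute valuation at least \<open>m + 1\<close>, which is infinitely smaller
  than \<open>dpow m\<close>.\<close>

lemma jump_sum_close: "\<bar>jump_sum \<alpha> h n x - jump_sum \<alpha> h m x\<bar> < dpow (min m n)"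
proof -
  have *: "\<bar>jump_sum \<alpha> h n x - jump_sum \<alpha> h m x\<bar> < dpow m" if "m \<le> n" for m n
  proof (cases "\<alpha> \<le> x \<and> x < \<alpha> + h")
    case True
    define T where "T k = (\<Sum>i\<in>{1..<2 ^ k}. if grid \<alpha> h (2 ^ k) i \<le> x then 1 else 0 :: levi_civita)" for k :: nat
    have "jump_sum \<alpha> h n x - jump_sum \<alpha> h m x = (\<Sum>k\<in>{..n} - {..m}. dpow k * T k)"
      using True that by (simp add: jump_sum_def T_def sum_diff)
    moreover have "vge (dpow k * T k) (of_nat (Suc m))" if "k \<in> {..n} - {..m}" for k
    proof -
      have "vge (T k) 0" unfolding T_def by (intro vge_sum) auto
      moreover have "(of_nat (Suc m) :: rat) \<le> of_nat k" using that by (intro of_nat_mono) auto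
      ultimately show ?thesis using vge_mult[of "dpow k" "of_nat (Suc m)" "T k" 0] vge_monom by simp
    qed
    ultimately have "vge (jump_sum \<alpha> h n x - jump_sum \<alpha> h m x) (of_nat (Suc m))" by (simp only: vge_sum)
    then show ?thesis by (rule vge_less_monom) auto
  next
    case False
    have "jump_sum \<alpha> h k x = 0" for k unfolding jump_sum_def using False by (rule if_not_P)
    then show ?thesis by simp
  qed
  show ?thesis
  proof (cases "m \<le> n")
    case False
    then show ?thesis using *[of n m] by (simp add: abs_minus_commute min_def)
  qed (use *[of m n] in simp)
qed

lemma monom_less_eventually:
  assumes "0 < \<epsilon>" shows "\<exists>N. \<forall>n>N. dpow n < \<epsilon>"
proof -
  have "\<forall>\<^sub>F n in sequentially. \<bar>dpow n - 0\<bar> < \<epsilon>"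
    using strong_lim_monom[of 1] assms unfolding strong_lim_def by auto
  then obtain N where "\<forall>n\<ge>N. \<bar>dpow n - 0\<bar> < \<epsilon>" unfolding eventually_sequentially by blast
  then have "dpow n < \<epsilon>" if "N < n" for n using that by (simp add: abs_less_iff)
  then show ?thesis by blast
qed

lemma lp_norm_bound_not_convergent:
  assumes "0 < \<epsilon>" and "\<And>n v. k \<le> n \<Longrightarrow> has_lp_norm p A (\<lambda>x. f n x - g x) v \<Longrightarrow> \<epsilon> \<le> \<bar>v\<bar>"
  shows "\<not> strongly_converges_lp p A f g"
proof
  assume "strongly_converges_lp p A f g"
  then obtain v where v: "strong_lim v 0"
    and nv: "\<forall>\<^sub>F n in sequentially. has_lp_norm p A (\<lambda>x. f n x - g x) (v n)"
    unfolding strongly_converges_lp_def by blast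
  have "\<forall>\<^sub>F n in sequentially. \<bar>v n - 0\<bar> < \<epsilon>" using v assms(1) unfolding strong_lim_def by blast
  with nv eventually_ge_at_top[of k] have "\<forall>\<^sub>F n in sequentially. False"
    by eventually_elim (use assms(2) in fastforce)
  then show False by simp
qed

section \<open>The jump sums as elements of the spaces\<close>

context
  fixes A :: "levi_civita set" and \<alpha> h :: levi_civita
  assumes A: "lc_measurable A" "{\<alpha>..<\<alpha> + h} \<subseteq> A" and h: "0 < h"
begin

abbreviation jump :: "nat \<Rightarrow> levi_civita \<Rightarrow> levi_civita" where
  "jump \<equiv> jump_sum \<alpha> h"

lemma jump_sum_far_from_measurable:
  assumes g: "g \<in> measurable_funs A"
  shows "\<exists>k e \<rho>. 0 < e \<and> 0 < \<rho> \<and> (\<forall>n\<ge>k. \<exists>u. {u..<u + \<rho>} \<subseteq> A \<and>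
    (\<forall>x. u \<le> x \<and> x < u + \<rho> \<longrightarrow> e \<le> \<bar>jump n x - g x\<bar>))"
proof -
  \<comment> \<open>A deficit below \<open>h / 2\<close> leaves the intervals on which g is simple
    with total overlap above \<open>h / 2\<close> in
    \<open>{\<alpha>..<\<alpha> + h}\<close>.\<close>
  have h2: "0 < h / 2" using h by simp
  from g[unfolded measurable_funs_def, THEN CollectD, THEN conjunct2, THEN spec, THEN mp, OF h2]
  obtain I a b s where I: "interval_seq I a b" "(\<Union>n. I n) \<subseteq> A" "strong_sums (\<lambda>n. b n - a n) s"
     "lc_measure A - s < h / 2" "\<forall>n. simple_on (I n) g"
    by (elim exE conjE)
  obtain o' where o': "strong_sums (\<lambda>n. overlap (a n) (b n) \<alpha> (\<alpha> + h)) o'"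
    using overlap_summable[OF I(1,3)] by blast
  have "\<alpha> \<le> \<alpha> + h" using h by simp
  from overlap_sum_lower[OF A(1) I(1-3) this A(2) o']
  have "h - (lc_measure A - s) \<le> o'" by simp
  moreover have "h = h / 2 + h / 2" by simp
  ultimately have o2: "h / 2 < o'" using I(4) by linarith
  have "\<exists>n. h / 2 < (\<Sum>k<n. overlap (a k) (b k) \<alpha> (\<alpha> + h))"
  proof (rule ccontr)
    assume "\<not> ?thesis"
    then have "(\<Sum>k<n. overlap (a k) (b k) \<alpha> (\<alpha> + h)) \<le> h / 2" for n by (simp add: not_less)
    then have "o' \<le> h / 2" using o' unfolding strong_sums_def by (intro strong_lim_le[of _ o']) auto
    then show False using o2 by simp
  qed
  then obtain N where N: "h / 2 < (\<Sum>k<N. overlap (a k) (b k) \<alpha> (\<alpha> + h))" by blast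
  have N0: "0 < N" using N h by (cases N) auto
  \<comment> \<open>Already N of the intervals overlap by more than \<open>h / 2\<close> in total,
    so one of them has more than the average. Its length is comparable to h.\<close>
  have "\<exists>n. h / (2 * of_nat N) < overlap (a n) (b n) \<alpha> (\<alpha> + h)"
  proof (rule ccontr)
    assume "\<not> ?thesis"
    then have "(\<Sum>k<N. overlap (a k) (b k) \<alpha> (\<alpha> + h)) \<le> (\<Sum>k<N. h / (2 * of_nat N))"
      by (intro sum_mono) (auto simp: not_less)
    also have "\<dots> = h / 2" using N0 by (simp add: field_simps)
    finally show False using N by simp
  qed
  then obtain n\<^sub>0 where n\<^sub>0: "h / (2 * of_nat N) < overlap (a n\<^sub>0) (b n\<^sub>0) \<alpha> (\<alpha> + h)" by blast
  define a' where "a' = max (a n\<^sub>0) \<alpha>"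
  define b' where "b' = min (b n\<^sub>0) (\<alpha> + h)"
  have "0 < h / (2 * of_nat N)" using h N0 by simp
  then have ab': "h / (2 * of_nat N) < b' - a'" "a' < b'"
    using n\<^sub>0 by (auto simp: overlap_def a'_def b'_def max_def split: if_splits)
  \<comment> \<open>As \<open>2 ^ k\<close> exceeds k, the cells of level k are shorter than
    \<open>b' - a'\<close>, and the first node c beyond \<open>a'\<close> lies before
    \<open>b'\<close>.\<close>
  define k where "k = 2 * N"
  have "k < 2 ^ k" by (rule less_exp)
  then have "of_nat k < (of_nat (2 ^ k) :: levi_civita)" by (simp only: of_nat_less_iff)
  then have "h / of_nat (2 ^ k) < h / of_nat k" using h N0 by (intro divide_strict_left_mono mult_pos_pos) (auto simp: k_def)
  then have hk: "h / of_nat (2 ^ k) < b' - a'" using ab'(1) by (simp add: k_def)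
  let ?g = "grid \<alpha> h (2 ^ k)"
  have aa: "\<alpha> \<le> a'" "b' \<le> \<alpha> + h" by (simp_all add: a'_def b'_def)
  then have "a' < \<alpha> + h" using ab'(2) by simp
  then obtain j where j: "j < 2 ^ k" "?g j \<le> a'" "a' < ?g (Suc j)"
    using grid_cell[of "2 ^ k" \<alpha> a' h] aa(1) by auto
  define c where "c = ?g (Suc j)"
  have "c - ?g j < b' - a'" using hk by (simp add: c_def grid_Suc)
  then have c: "a' < c" "c < b'" using j by (auto simp: c_def)
  have j1: "Suc j < 2 ^ k"
  proof (rule ccontr)
    assume "\<not> Suc j < 2 ^ k"
    then have "Suc j = 2 ^ k" using j(1) by simp
    then have "c = \<alpha> + h" unfolding c_def by (simp only: grid_N zero_less_power zero_less_numeral)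
    then show False using c aa by simp
  qed
  define x where "x = (a' + c) / 2"
  define y where "y = (c + b') / 2"
  have xy: "a' < x" "x < c" "c < y" "y < b'" using c by (auto simp: x_def y_def field_simps)
  have "I n\<^sub>0 \<in> intervals (a n\<^sub>0) (b n\<^sub>0)" using I(1) by (simp add: interval_seq_def)
  from intervals_interior[OF this] have sub: "{x..y} \<subseteq> I n\<^sub>0"
    using xy by (auto simp: a'_def b'_def subset_iff)
  \<comment> \<open>The jump at c is at least \<open>8 * E\<close>, and g varies by less than E near
    c. Depending on the side of \<open>?f c - 4 * E\<close> on which \<open>g c\<close> lies, the
    two functions stay at least \<open>2 * E\<close> apart to the right or to the left of c.\<close>
  define E where "E = lc_monom (1 / 8) (of_nat k)"
  have E: "0 < E" "8 * E = dpow k"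
    using lc_monom_times[of 8 0 "1/8" "of_nat k"] of_nat_lc[of 8] by (simp_all add: E_def)
  have xly: "x < y" using xy by simp
  obtain \<delta> where \<delta>: "0 < \<delta>"
    "\<And>z z'. z \<in> {x..y} \<Longrightarrow> z' \<in> {x..y} \<Longrightarrow> \<bar>z - z'\<bar> < \<delta> \<Longrightarrow> \<bar>g z - g z'\<bar> < E"
    using simple_uniformly_continuous[OF xly I(5)[rule_format] sub E(1)] by blast
  \<comment> \<open>Fixed before n is chosen, so that the length of the interval where the functions
    differ is uniform in n.\<close>
  define \<rho> where "\<rho> = min \<delta> (min (c - x) (y - c)) / 2"
  have m: "0 < min \<delta> (min (c - x) (y - c))" using \<delta>(1) xy by simp
  have \<rho>: "0 < \<rho>" "\<rho> < min \<delta> (min (c - x) (y - c))" using m by (auto simp: \<rho>_def simp del: min_less_iff_conj)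
  then have \<rho>': "\<rho> < \<delta>" "\<rho> < c - x" "\<rho> < y - c" by simp_all
  have "\<exists>u. {u..<u + \<rho>} \<subseteq> A \<and> (\<forall>x. u \<le> x \<and> x < u + \<rho> \<longrightarrow> 2 * E \<le> \<bar>jump n x - g x\<bar>)"
    if n: "k \<le> n" for n
  proof -
    let ?f = "jump n"
    have near: "\<bar>g z - g c\<bar> < E" if "c - \<rho> \<le> z" "z < c + \<rho>" for z
    proof (rule \<delta>(2))
      show "z \<in> {x..y}" "c \<in> {x..y}" using that \<rho>' xy by (auto simp: algebra_simps)
      have "\<bar>z - c\<bar> \<le> \<rho>" using that by (auto simp: abs_le_iff algebra_simps)
      then show "\<bar>z - c\<bar> < \<delta>" using \<rho>'(1) by simp
    qed
    have Asub: "{c - \<rho>..<c + \<rho>} \<subseteq> A \<inter> {\<alpha>..<\<alpha> + h}"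
    proof
      fix z assume "z \<in> {c - \<rho>..<c + \<rho>}"
      then have "a' < z" "z < b'" using \<rho>' xy by (auto simp: algebra_simps)
      then have "z \<in> {\<alpha>..<\<alpha> + h}" using aa by auto
      then show "z \<in> A \<inter> {\<alpha>..<\<alpha> + h}" using A(2) by blast
    qed
    have cA: "c \<in> {c - \<rho>..<c + \<rho>}" using \<rho>(1) by simp
    show ?thesis
    proof (cases "g c \<le> ?f c - 4 * E")
      case True
      have "2 * E \<le> \<bar>?f z - g z\<bar>" if z: "c \<le> z" "z < c + \<rho>" for z
      proof -
        have zz: "c - \<rho> \<le> z" using z \<rho>(1) by simp
        have "?f c \<le> ?f z" using subsetD[OF Asub, of z] subsetD[OF Asub cA] zz z by (intro jump_sum_mono) auto
        moreover have "g z < g c + E" using near[OF zz z(2)] by (simp add: abs_less_iff)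
        ultimately have "2 * E \<le> ?f z - g z" using True E(1) by linarith
        then show ?thesis by (rule order_trans) (rule abs_ge_self)
      qed
      moreover have "{c..<c + \<rho>} \<subseteq> {c - \<rho>..<c + \<rho>}" using \<rho>(1) by (simp add: ivl_subset)
      then have "{c..<c + \<rho>} \<subseteq> A" using Asub by blast
      ultimately show ?thesis by blast
    next
      case False
      have "2 * E \<le> \<bar>?f z - g z\<bar>" if z: "c - \<rho> \<le> z" "z < c" for z
      proof -
        have zz: "z < c + \<rho>" using z \<rho>(1) by simp
        have "?f z + dpow k \<le> ?f c"
          by (rule jump_sum_jump[OF _ z(2) _ c_def _ j1 n]) (use subsetD[OF Asub, of z] subsetD[OF Asub cA] z zz in auto)
        moreover have "g c < g z + E" using near[OF z(1) zz] by (simp add: abs_less_iff)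
        ultimately have "2 * E \<le> g z - ?f z" using False E by linarith
        then show ?thesis by (rule order_trans) (metis abs_ge_self abs_minus_commute)
      qed
      moreover have "{c - \<rho>..<c - \<rho> + \<rho>} \<subseteq> {c - \<rho>..<c + \<rho>}" using \<rho>(1) by (simp add: ivl_subset)
      then have "{c - \<rho>..<c - \<rho> + \<rho>} \<subseteq> A" using Asub by blast
      ultimately show ?thesis by (intro exI[of _ "c - \<rho>"]) auto
    qed
  qed
  moreover have "0 < 2 * E" using E by simp
  ultimately show ?thesis using \<rho>(1) by blast
qed

lemma jump_sum_in_lp:
  assumes r: "0 < r"
  shows "jump n \<in> lp_space (Fin r) A"
proof -
  note S = step_function_jump_sum[OF h order_refl, of \<alpha> n]
  have N: "(0::nat) < 2 ^ n" by simp
  have "jump n \<in> measurable_funs A" by (rule step_function_measurable[OF S h N A])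
  moreover have "step_function \<alpha> h (2 ^ n) (\<lambda>x. lc_powr (jump n x) r)"
    using step_function_compose2[OF S S, of "\<lambda>u v. lc_powr u r"] lc_powr_0[OF r] by simp
  then have "(\<lambda>x. lc_powr (jump n x) r) \<in> measurable_funs A"
    by (rule step_function_measurable[OF _ h N A])
  moreover have "step_function \<alpha> h (2 ^ n) (\<lambda>x. lc_powr \<bar>jump n x\<bar> r)"
    using step_function_compose2[OF S S, of "\<lambda>u v. lc_powr \<bar>u\<bar> r"] lc_powr_0[OF r] by simp
  then have "\<exists>L. lc_has_integral (\<lambda>x. lc_powr \<bar>jump n x\<bar> r) A L"
    using step_function_has_integral[OF _ h N A] by blast
  ultimately show ?thesis by simp
qed

lemma step_function_jump_diff:
  assumes "G 0 = 0" shows "step_function \<alpha> h (2 ^ max m n) (\<lambda>x. G (jump n x - jump m x))"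
  using assms step_function_compose2[OF step_function_jump_sum[OF h, of n "max m n" \<alpha>]
      step_function_jump_sum[OF h, of m "max m n" \<alpha>], of "\<lambda>u v. G (u - v)"] by simp

lemma jump_sum_Cauchy_lp:
  assumes r: "0 < r"
  shows "strongly_Cauchy_lp (Fin r) A jump"
  unfolding strongly_Cauchy_lp_def
proof (intro allI impI)
  fix \<epsilon> :: levi_civita assume e: "0 < \<epsilon>"
  obtain a b where ab: "quotient_of r = (a, b)" "0 < a" "0 < b" "quotient_of (1 / r) = (b, a)"
    using quotient_of_pos[OF r] by blast
  \<comment> \<open>For r = a/b the norm satisfies \<open>v ^ nat a = L ^ nat b\<close>, which is at
    most \<open>B ^ nat a * h ^ nat b\<close> with \<open>B = dpow (min m n)\<close>. As B is at
    most 1, this is below \<open>\<epsilon> ^ nat a\<close> once B is below the quotient considered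
    here.\<close>
  have "0 < \<epsilon> ^ nat a / h ^ nat b" using e h by simp
  then obtain N where N: "\<And>n. n > N \<Longrightarrow> dpow n < \<epsilon> ^ nat a / h ^ nat b"
    using monom_less_eventually by blast
  have "\<exists>v. has_lp_norm (Fin r) A (\<lambda>x. jump n x - jump m x) v \<and> v < \<epsilon>" if mn: "N < m" "N < n" for m n
  proof -
    define M where "M = max m n"
    have M: "(0::nat) < 2 ^ M" by simp
    define \<psi> where "\<psi> x = lc_powr \<bar>jump n x - jump m x\<bar> r" for x
    have "step_function \<alpha> h (2 ^ M) \<psi>"
      using step_function_jump_diff[of "\<lambda>u. lc_powr \<bar>u\<bar> r"] lc_powr_0[OF r] by (simp add: \<psi>_def[abs_def] M_def)
    from step_function_has_integral[OF this h M A]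
    obtain L where L: "lc_has_integral \<psi> A L" and Ldef: "L = (\<Sum>j<2 ^ M. \<psi> (grid \<alpha> h (2 ^ M) j) * (h / of_nat (2 ^ M)))"
      by blast
    define B where "B = dpow (min m n)"
    have B: "0 < B" "B \<le> 1" "B < \<epsilon> ^ nat a / h ^ nat b"
    proof -
      have "1 \<le> min m n" using mn by simp
      then have "vge B 1" unfolding B_def by (intro vge_monom) simp
      then show "B \<le> 1" using vge_less_monom[of B 1 0 1] by (simp add: abs_less_iff less_imp_le)
    qed (use mn N in \<open>auto simp: B_def\<close>)
    have \<psi>: "0 \<le> \<psi> x" "\<psi> x \<le> lc_powr B r" for x
      using lc_powr_spec(1)[OF ab(1)] lc_powr_mono[OF r, of "\<bar>jump n x - jump m x\<bar>" B]
        jump_sum_close[of \<alpha> h n x m] by (auto simp: \<psi>_def B_def less_imp_le)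
    have h0: "0 \<le> h / of_nat (2 ^ M)" using h by simp
    have L0: "0 \<le> L" unfolding Ldef using \<psi>(1) h0 by (intro sum_nonneg mult_nonneg_nonneg)
    have "L \<le> (\<Sum>j<(2::nat) ^ M. lc_powr B r * (h / of_nat (2 ^ M)))"
      unfolding Ldef using \<psi>(2) h0 by (intro sum_mono mult_right_mono)
    also have "\<dots> = lc_powr B r * h" by simp
    finally have Lle: "L \<le> lc_powr B r * h" .
    define v where "v = lc_powr L (1 / r)"
    have v: "0 \<le> v" "v ^ nat a = L ^ nat b" unfolding v_def using lc_powr_spec[OF ab(4) L0] by auto
    have "v < \<epsilon>"
    proof (rule ccontr)
      assume "\<not> v < \<epsilon>"
      then have "\<epsilon> ^ nat a \<le> v ^ nat a" using e by (intro power_mono) auto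
      also have "\<dots> \<le> (lc_powr B r * h) ^ nat b" unfolding v(2) using Lle L0 by (rule power_mono)
      also have "\<dots> = B ^ nat a * h ^ nat b"
        using lc_powr_spec(2)[OF ab(1), of B] B(1) by (simp add: power_mult_distrib)
      also have "\<dots> \<le> B * h ^ nat b"
      proof (rule mult_right_mono)
        have "B ^ nat a \<le> B ^ 1" by (rule power_decreasing) (use B ab(2) in auto)
        then show "B ^ nat a \<le> B" by simp
      qed (use h in simp)
      also have "\<dots> < \<epsilon> ^ nat a" using B(3) h by (simp add: pos_less_divide_eq)
      finally show False by simp
    qed
    moreover have "has_lp_norm (Fin r) A (\<lambda>x. jump n x - jump m x) v"
      using L by (auto simp: v_def \<psi>_def[abs_def])
    ultimately show ?thesis by blast
  qed
  then show "\<exists>N. \<forall>m>N. \<forall>n>N. \<exists>v. has_lp_norm (Fin r) A (\<lambda>x. jump n x - jump m x) v \<and> v < \<epsilon>"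
    by blast
qed

lemma jump_sum_not_convergent_lp:
  assumes r: "0 < r" and g: "g \<in> measurable_funs A"
  shows "\<not> strongly_converges_lp (Fin r) A jump g"
proof -
  obtain a b where ab: "quotient_of r = (a, b)" "0 < a" "0 < b" "quotient_of (1 / r) = (b, a)"
    using quotient_of_pos[OF r] by blast
  from jump_sum_far_from_measurable[OF g]
  obtain k e \<rho> where e: "0 < e" and \<rho>: "0 < \<rho>" and far: "\<forall>n\<ge>k. \<exists>u. {u..<u + \<rho>} \<subseteq> A \<and>
      (\<forall>x. u \<le> x \<and> x < u + \<rho> \<longrightarrow> e \<le> \<bar>jump n x - g x\<bar>)"
    by (elim exE conjE)
  define \<kappa> where "\<kappa> = lc_powr e r"
  have \<kappa>: "0 < \<kappa>" unfolding \<kappa>_def by (rule lc_powr_pos[OF r e])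
  \<comment> \<open>The norm satisfies \<open>v ^ nat a \<ge> K\<close>. This bounds v itself by K
    from below when v < 1, since then \<open>v ^ nat a \<le> v\<close>; hence the bound
    \<open>min 1 K\<close>.\<close>
  define K where "K = (\<kappa> * \<rho>) ^ nat b"
  have K: "0 < min 1 K" unfolding K_def using \<kappa> \<rho> by simp
  show ?thesis
  proof (rule lp_norm_bound_not_convergent[OF K])
    fix n v assume n: "k \<le> n" and "has_lp_norm (Fin r) A (\<lambda>x. jump n x - g x) v"
    then obtain L where L: "lc_has_integral (\<lambda>x. lc_powr \<bar>jump n x - g x\<bar> r) A L" and v: "v = lc_powr L (1 / r)"
      by auto
    from far[THEN spec, THEN mp, OF n] obtain u where u: "{u..<u + \<rho>} \<subseteq> A"
        and uf: "\<forall>x. u \<le> x \<and> x < u + \<rho> \<longrightarrow> e \<le> \<bar>jump n x - g x\<bar>"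
      by (elim exE conjE)
    have "\<kappa> * (u + \<rho> - u) \<le> L"
    proof (rule integral_lower_bound[OF A(1) L _ u])
      show "\<kappa> \<le> lc_powr \<bar>jump n x - g x\<bar> r" if "u \<le> x" "x < u + \<rho>" for x
        unfolding \<kappa>_def by (rule lc_powr_mono[OF r]) (use e uf that in auto)
    qed (use \<rho> \<kappa> lc_powr_spec(1)[OF ab(1)] in auto)
    then have L1: "\<kappa> * \<rho> \<le> L" by simp
    have "0 < \<kappa> * \<rho>" using \<kappa> \<rho> by simp
    then have L0: "0 \<le> L" using L1 by simp
    have v0: "0 \<le> v" "v ^ nat a = L ^ nat b" unfolding v using lc_powr_spec[OF ab(4) L0] by auto
    have "K \<le> v" if "v < 1"
    proof -
      have "K \<le> L ^ nat b" unfolding K_def using L1 \<open>0 < \<kappa> * \<rho>\<close> by (intro power_mono) auto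
      also have "\<dots> \<le> v" unfolding v0(2)[symmetric]
        using power_decreasing[of 1 "nat a" v] v0(1) that ab(2) by simp
      finally show ?thesis .
    qed
    then show "min 1 K \<le> \<bar>v\<bar>" using v0(1) by (cases "v < 1") auto
  qed
qed

lemma jump_sum_Linf:
  shows "jump n \<in> lp_space Pinf A" and "strongly_Cauchy_lp Pinf A jump"
    and "g \<in> measurable_funs A \<Longrightarrow> \<not> strongly_converges_lp Pinf A jump g"
proof -
  note S = step_function_jump_sum[OF h order_refl, of \<alpha> n]
  have N: "(0::nat) < 2 ^ n" by simp
  have "step_function \<alpha> h (2 ^ n) (\<lambda>x. \<bar>jump n x\<bar>)"
    using step_function_compose2[OF S S, of "\<lambda>u v. \<bar>u\<bar>"] by simp
  from step_function_essential_sup[OF this h N A abs_ge_zero]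
  have "\<exists>v. has_lp_norm Pinf A (jump n) v" unfolding has_lp_norm.simps by blast
  then show "jump n \<in> lp_space Pinf A"
    using step_function_measurable[OF S h N A] unfolding lp_space.simps by blast
next
  show "strongly_Cauchy_lp Pinf A jump"
    unfolding strongly_Cauchy_lp_def
  proof (intro allI impI)
    fix \<epsilon> :: levi_civita assume e: "0 < \<epsilon>"
    then obtain N where N: "\<And>n. n > N \<Longrightarrow> dpow n < \<epsilon>"
      using monom_less_eventually by blast
    have "\<exists>v. has_lp_norm Pinf A (\<lambda>x. jump n x - jump m x) v \<and> v < \<epsilon>" if mn: "N < m" "N < n" for m n
    proof -
      define M where "M = max m n"
      have M: "(0::nat) < 2 ^ M" by simp
      have "step_function \<alpha> h (2 ^ M) (\<lambda>x. \<bar>jump n x - jump m x\<bar>)"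
        using step_function_jump_diff[of abs] by (simp add: M_def)
      note glb = step_function_essential_sup[OF this h M A abs_ge_zero]
      define v where "v = Max ((\<lambda>j. \<bar>jump n (grid \<alpha> h (2 ^ M) j) - jump m (grid \<alpha> h (2 ^ M) j)\<bar>) ` {..<2 ^ M})"
      have mn': "dpow (min m n) < \<epsilon>" using mn by (intro N) simp
      have "0 \<in> {..<(2::nat) ^ M}" by simp
      then have "{..<(2::nat) ^ M} \<noteq> {}" by blast
      then have "v < \<epsilon>" unfolding v_def
        by (subst Max_less_iff) (use less_trans[OF jump_sum_close mn'] in auto)
      then show ?thesis using glb by (intro exI[of _ v]) (simp add: v_def)
    qed
    then show "\<exists>N. \<forall>m>N. \<forall>n>N. \<exists>v. has_lp_norm Pinf A (\<lambda>x. jump n x - jump m x) v \<and> v < \<epsilon>"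
      by blast
  qed
next
  assume g: "g \<in> measurable_funs A"
  from jump_sum_far_from_measurable[OF g]
  obtain k e \<rho> where e: "0 < e" and \<rho>: "0 < \<rho>" and far: "\<forall>n\<ge>k. \<exists>u. {u..<u + \<rho>} \<subseteq> A \<and>
      (\<forall>x. u \<le> x \<and> x < u + \<rho> \<longrightarrow> e \<le> \<bar>jump n x - g x\<bar>)"
    by (elim exE conjE)
  show "\<not> strongly_converges_lp Pinf A jump g"
  proof (rule lp_norm_bound_not_convergent[OF e])
    fix n v assume n: "k \<le> n" and "has_lp_norm Pinf A (\<lambda>x. jump n x - g x) v"
    then have glb: "isGlb UNIV {c. lc_ae A (\<lambda>x. \<bar>jump n x - g x\<bar> \<le> c)} v" by simp
    from far[THEN spec, THEN mp, OF n] obtain u where u: "{u..<u + \<rho>} \<subseteq> A"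
        and uf: "\<forall>x. u \<le> x \<and> x < u + \<rho> \<longrightarrow> e \<le> \<bar>jump n x - g x\<bar>"
      by (elim exE conjE)
    have "e \<le> c" if c: "lc_ae A (\<lambda>x. \<bar>jump n x - g x\<bar> \<le> c)" for c
    proof (rule ccontr)
      assume "\<not> e \<le> c"
      let ?B = "{x \<in> A. \<bar>jump n x - g x\<bar> \<le> c}"
      \<comment> \<open>A bound c below e fails on a whole interval, so the points where it holds
        form a set of smaller measure than A.\<close>
      have "?B \<inter> {u..<u + \<rho>} = {}" using uf \<open>\<not> e \<le> c\<close> by (auto dest: order_trans)
      from measure_subset_avoiding[OF A(1) _ u _ _ this] c \<rho> show False by (auto simp: lc_ae_def)
    qed
    then have "isLb UNIV {c. lc_ae A (\<lambda>x. \<bar>jump n x - g x\<bar> \<le> c)} e"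
      by (intro isLbI setgeI) auto
    from isGlb_le_isLb[OF glb this] show "e \<le> \<bar>v\<bar>" by simp
  qed
qed

end

theorem proposition4p15:
  fixes A :: "levi_civita set" and p :: "rat extended"
  assumes "lc_measurable A" and "0 < lc_measure A" and "1 \<le> p"
  shows "\<exists>f :: nat \<Rightarrow> levi_civita \<Rightarrow> levi_civita.
    (\<forall>n. f n \<in> lp_space p A) \<and> strongly_Cauchy_lp p A f \<and>
    \<not> (\<exists>g \<in> lp_space p A. strongly_converges_lp p A f g)"
proof -
  obtain u v where uv: "u < v" "{u..v} \<subseteq> A" using measure_pos_contains_interval[OF assms(1,2)] by blast
  define h where "h = v - u"
  have h: "0 < h" using uv by (simp add: h_def)
  have A: "{u..<u + h} \<subseteq> A" using uv(2) by (auto simp: h_def)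
  note jump = assms(1) A h
  have "(\<forall>n. jump_sum u h n \<in> lp_space p A) \<and> strongly_Cauchy_lp p A (jump_sum u h) \<and>
    (\<forall>g\<in>lp_space p A. \<not> strongly_converges_lp p A (jump_sum u h) g)"
  proof (cases p)
    case (Fin r)
    then have "0 < r" using assms(3) by (simp add: one_extended_def)
    then show ?thesis unfolding Fin
      using jump_sum_in_lp[OF jump] jump_sum_Cauchy_lp[OF jump] jump_sum_not_convergent_lp[OF jump] by simp
  next
    case Pinf
    then show ?thesis using jump_sum_Linf[OF jump] by simp
  next
    case Minf
    then show ?thesis using assms(3) by (simp add: one_extended_def)
  qed
  then show ?thesis by blast
qed

end
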